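(* Consider on $\mathcal{S}^1$ the linearization of the De Gregorio equation ($\partial_t\omega+u\partial_\theta\omega=\omega\partial_\theta u$, $\partial_\theta u=H\omega$) at the stationary solution $-\sin 2\theta$, namely $$\partial_t\eta=L_2\eta,\qquad L_2\eta=-\tfrac12\sin(2\theta)\,\partial_\theta\eta+\cos(2\theta)\,\eta-\sin(2\theta)\,\partial_\theta v+2\cos(2\theta)\,v,$$ where $v$ is determined by $\partial_\theta v=H\eta$ and $\int_{\mathcal{S}^1}v\,d\theta\equiv 0$. Let the initial data be even, $\eta(0,\theta)=\sum_{k\ge1}\eta_k\cos(k\theta)\in H^{3/2}(\mathcal{S}^1)$. Then for any $0<T<\infty$ the problem is well-posed in $C([0,T];H^{3/2}(\mathcal{S}^1))$ (there is a unique solution in this class), and, writing the solution as $\eta(t,\theta)=\sum_{k\ge1}\eta_k^{(e)}(t)\cos(k\theta)$, it satisfies $$\frac{d}{dt}\|\eta\|_X^2+\frac32\,|\eta_1^{(e)}|^2=0,\qquad \|\eta\|_X^2:=\sum_{k\ge1,\ k\ne2}g_k^{(e)}|\eta_k^{(e)}|^2,$$ where the weights $g_k^{(e)}$ are those defined in the context, for which $g_1^{(e)}=1$ and $g_k^{(e)}\sim k^3$ (i.e. $c\,k^3\le g_k^{(e)}\le C\,k^3$ for all $k\neq 2$, with constants $0<c\le C$). Moreover $\eta_2^{(e)}$ grows at most linearly: there is a constant $M$, depending on the initial data, such that $|\eta_2^{(e)}(t)|\le M(1+t)$ for all $t\ge0$.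
   Context: All functions are real-valued. $\mathcal{S}^1=\mathbb{R}/2\pi\mathbb{Z}$, identified with $[-\pi,\pi)$. $H$ is the Hilbert transform on $\mathcal{S}^1$: $H\omega(\theta)=\frac{1}{2\pi}\mathrm{P.V.}\int_{-\pi}^{\pi}\cot\frac{\theta-\phi}{2}\,\omega(\phi)\,d\phi$. Put $A_k=-\frac{(k-2)^2}{4k}$ and $B_k=\frac{(k+2)(k-2)}{4k}$. The weights are defined by $g_1^{(e)}=g_4^{(e)}=1$, $g_2^{(e)}=0$, and the recursion $g_k^{(e)}B_{k+2}+g_{k+2}^{(e)}A_k=0$ for all $k\ge1$ (for $k=2$ this reads $0=0$). Solutions are understood in the sense of distributions. *)

theory Defs
  imports "HOL-Analysis.Analysis"
begin

text \<open>
  Functions on the circle are 2 pi-periodic functions on the real line, taken up to equality almost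
  everywhere.
\<close>

definition fourier_coeff :: "(real \<Rightarrow> real) \<Rightarrow> int \<Rightarrow> complex" where
  "fourier_coeff f n = (LBINT \<theta>:{-pi..pi}. f \<theta> *\<^sub>R cis (- (of_int n * \<theta>))) /\<^sub>R (2 * pi)"

definition in_sobolev :: "real \<Rightarrow> (real \<Rightarrow> real) \<Rightarrow> bool" where
  "in_sobolev s f \<longleftrightarrow>
     f \<in> borel_measurable lborel \<and>
     (\<forall>\<theta>. f (\<theta> + 2 * pi) = f \<theta>) \<and>
     set_integrable lborel {-pi..pi} (\<lambda>\<theta>. (f \<theta>)\<^sup>2) \<and>
     (\<lambda>n::int. (1 + (of_int n)\<^sup>2) powr s * (cmod (fourier_coeff f n))\<^sup>2) summable_on UNIV"

definition sobolev_norm :: "real \<Rightarrow> (real \<Rightarrow> real) \<Rightarrow> real" where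
  "sobolev_norm s f =
     sqrt (\<Sum>\<^sub>\<infinity>n::int. (1 + (of_int n)\<^sup>2) powr s * (cmod (fourier_coeff f n))\<^sup>2)"

definition in_C_sobolev :: "real \<Rightarrow> real \<Rightarrow> (real \<Rightarrow> real \<Rightarrow> real) \<Rightarrow> bool" where
  "in_C_sobolev T s \<eta> \<longleftrightarrow>
     (\<forall>t\<in>{0..T}. in_sobolev s (\<eta> t)) \<and>
     (\<forall>t\<in>{0..T}. ((\<lambda>r. sobolev_norm s (\<lambda>\<theta>. \<eta> r \<theta> - \<eta> t \<theta>)) \<longlongrightarrow> 0) (at t within {0..T}))"

text \<open>
  \<open>cosine_sums a f\<close>: \<open>f = (\<Sum>k\<ge>1. a k * cos (k \<theta>))\<close> with convergence in
  square mean. This determines \<open>a k\<close> for \<open>k \<ge> 1\<close>, and makes \<open>f\<close> even with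
  mean zero; \<open>a 0\<close> plays no role.
\<close>

definition cosine_sums :: "(nat \<Rightarrow> real) \<Rightarrow> (real \<Rightarrow> real) \<Rightarrow> bool" where
  "cosine_sums a f \<longleftrightarrow>
     (\<lambda>N. LBINT \<theta>:{-pi..pi}. (f \<theta> - (\<Sum>k=1..N. a k * cos (real k * \<theta>)))\<^sup>2) \<longlonglongrightarrow> 0"

text \<open>
  The singularity is cut out symmetrically in the distance of the circle; for periodic \<open>\<omega>\<close>
  the window of length 2 pi may be centred at \<open>\<theta>\<close>. For \<open>\<omega>\<close> in
  \<open>H^s\<close>, \<open>s > 1/2\<close>, the limit exists at every \<open>\<theta>\<close>.
\<close>

definition hilbert_transform :: "(real \<Rightarrow> real) \<Rightarrow> real \<Rightarrow> real" where
  "hilbert_transform \<omega> \<theta> =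
     Lim (at_right 0) (\<lambda>\<epsilon>. 1 / (2 * pi) *
       (LBINT \<phi>:{\<theta> - pi..\<theta> + pi} - {\<theta> - \<epsilon><..<\<theta> + \<epsilon>}. cot ((\<theta> - \<phi>) / 2) * \<omega> \<phi>))"

text \<open>
  For \<open>\<eta>\<close> in \<open>H^(3/2)\<close> the function \<open>H \<eta>\<close> is continuous, so
  the derivative can be taken classically.
\<close>

definition is_velocity :: "(real \<Rightarrow> real) \<Rightarrow> (real \<Rightarrow> real) \<Rightarrow> bool" where
  "is_velocity \<eta> v \<longleftrightarrow>
     (\<forall>\<theta>. v (\<theta> + 2 * pi) = v \<theta>) \<and>
     (\<forall>\<theta>. (v has_real_derivative hilbert_transform \<eta> \<theta>) (at \<theta>)) \<and>
     (LBINT \<theta>:{-pi..pi}. v \<theta>) = 0"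

text \<open>
  The pairing of \<open>L\<^sub>2 \<eta>\<close> with a smooth periodic \<open>\<rho>\<close>. The term
  \<open>- 1/2 sin (2\<theta>) \<partial>\<eta>\<close> is integrated by parts, the derivative of
  \<open>\<eta>\<close> being a distributional one.
\<close>

definition L2_pairing :: "(real \<Rightarrow> real) \<Rightarrow> (real \<Rightarrow> real) \<Rightarrow> (real \<Rightarrow> real) \<Rightarrow> real" where
  "L2_pairing \<eta> v \<rho> =
     (LBINT \<theta>:{-pi..pi}.
        1/2 * \<eta> \<theta> * deriv (\<lambda>x. sin (2 * x) * \<rho> x) \<theta>
        + (cos (2 * \<theta>) * \<eta> \<theta> - sin (2 * \<theta>) * deriv v \<theta> + 2 * cos (2 * \<theta>) * v \<theta>) * \<rho> \<theta>)"

text \<open>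
  Test functions on \<open>(0,T) \<times> S^1\<close>; \<open>D i j\<close> is the partial derivative of order
  \<open>i\<close> in time and \<open>j\<close> in space.
\<close>

definition smooth2 :: "(real \<Rightarrow> real \<Rightarrow> real) \<Rightarrow> bool" where
  "smooth2 \<psi> \<longleftrightarrow> (\<exists>D :: nat \<Rightarrow> nat \<Rightarrow> real \<Rightarrow> real \<Rightarrow> real. D 0 0 = \<psi> \<and>
     (\<forall>i j. continuous_on UNIV (\<lambda>(t, \<theta>). D i j t \<theta>) \<and>
        (\<forall>t \<theta>. ((\<lambda>r. D i j r \<theta>) has_real_derivative D (Suc i) j t \<theta>) (at t) \<and>
               ((\<lambda>x. D i j t x) has_real_derivative D i (Suc j) t \<theta>) (at \<theta>))))"

definition test_function :: "real \<Rightarrow> (real \<Rightarrow> real \<Rightarrow> real) \<Rightarrow> bool" where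
  "test_function T \<psi> \<longleftrightarrow>
     smooth2 \<psi> \<and>
     (\<forall>t \<theta>. \<psi> t (\<theta> + 2 * pi) = \<psi> t \<theta>) \<and>
     (\<exists>a b. 0 < a \<and> b < T \<and> (\<forall>t \<theta>. t \<notin> {a..b} \<longrightarrow> \<psi> t \<theta> = 0))"

text \<open>
  Solutions in \<open>C([0,T]; H^(3/2))\<close>, in the sense of distributions on
  \<open>(0,T) \<times> S^1\<close>. The integrals are iterated, so that the choice of a representative of each
  \<open>\<eta> t\<close> is irrelevant.
\<close>

definition is_solution :: "real \<Rightarrow> (real \<Rightarrow> real) \<Rightarrow> (real \<Rightarrow> real \<Rightarrow> real) \<Rightarrow> bool" where
  "is_solution T \<eta>0 \<eta> \<longleftrightarrow>
     in_C_sobolev T (3/2) \<eta> \<and>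
     (AE \<theta> in lborel. \<eta> 0 \<theta> = \<eta>0 \<theta>) \<and>
     (\<exists>v. (\<forall>t\<in>{0..T}. is_velocity (\<eta> t) (v t)) \<and>
        (\<forall>\<psi>. test_function T \<psi> \<longrightarrow>
           (LBINT t:{0..T}. (LBINT \<theta>:{-pi..pi}. \<eta> t \<theta> * deriv (\<lambda>r. \<psi> r \<theta>) t)
              + L2_pairing (\<eta> t) (v t) (\<psi> t)) = 0))"

definition A_coeff :: "nat \<Rightarrow> real" where
  "A_coeff k = - ((real k - 2)\<^sup>2 / (4 * real k))"

definition B_coeff :: "nat \<Rightarrow> real" where
  "B_coeff k = (real k + 2) * (real k - 2) / (4 * real k)"

text \<open>
  The recursion does not determine the weight at 4 (both of its terms vanish at index 2), whence
  the prescribed value there. The value at 0 is a dummy.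
\<close>

fun g_e :: "nat \<Rightarrow> real" where
  "g_e k = (if k = 1 \<or> k = 4 then 1 else if k \<le> 2 then 0
            else - g_e (k - 2) * B_coeff k / A_coeff (k - 2))"

declare g_e.simps [simp del]

lemma g_e_initial: "g_e 1 = 1" "g_e 2 = 0" "g_e 4 = 1"
  by (simp_all add: g_e.simps)

lemma g_e_recursion:
  assumes "k \<ge> 1"
  shows "g_e k * B_coeff (k + 2) + g_e (k + 2) * A_coeff k = 0"
proof (cases "k = 2")
  case True
  then show ?thesis by (simp add: g_e_initial A_coeff_def)
next
  case False
  then have "A_coeff k \<noteq> 0" using assms by (simp add: A_coeff_def)
  moreover have "g_e (k + 2) = - g_e k * B_coeff (k + 2) / A_coeff k"
    using False assms by (subst g_e.simps) simp
  ultimately show ?thesis by simp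
qed

definition X_norm_sq :: "(nat \<Rightarrow> real) \<Rightarrow> real" where
  "X_norm_sq a = (\<Sum>\<^sub>\<infinity>k\<in>{1..} - {2}. g_e k * \<bar>a k\<bar>\<^sup>2)"

end

(*
  On cosine modes the linearized operator is L cos(k x) = B_k cos((k-2) x) + A_k cos((k+2) x), so the
  equation is a tridiagonal system for the Fourier coefficients. The weights make it skew-symmetric up
  to the damping -(3/4) of mode 1 (for the sine modes +(3/4)), and they have the closed form
  g_k = c (k+2) (k-2)^2 with c = 1/3 for odd and c = 1/24 for even k. For a solution bounded in the
  weighted norm the boundary term of the energy balance cut off at N is at most N times the N-th term of
  a convergent series; since the harmonic series diverges, it vanishes along a subsequence and the energy
  balance is exact. It gives uniqueness by Gronwall, and turns a weak limit of Galerkin solutions into a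
  norm-continuous one. Mode 2 drives no other mode and is an integral of mode 4.
*)

theory Submission
  imports Defs "HOL-Complex_Analysis.Great_Picard"
begin

section \<open>The weights and the energy balance of the mode system\<close>

text \<open>Uniqueness is claimed among all distributional solutions of the class, and nothing makes
  these even in advance. Each Fourier coefficient is therefore split into a real (cosine) and an
  imaginary (sine) part. Both obey the same system except for the sign at mode 1, where mode -1
  folds back onto mode 1; hence the parameter \<open>\<sigma>\<close>, equal to 1 or -1. For -1 the
  energy may grow, which is why monotonicity does not suffice. The mean needs its own conservation
  law, since a constant would feed mode 2. The passage between functions and coefficients has its
  own obstacle: H is a pointwise principal value. Exchanging its limit with the Fourier series needs
  a bound on the truncated kernel integrals that is uniform in the cut. Growth like sqrt k, cruder
  than the true logarithm, is good enough, because H^(3/2) makes the sum of sqrt k |c_k| finite.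
  Conversely, testing the weak equation with a time cutoff times a single mode and applying the du
  Bois-Reymond lemma yields classical differential equations for the coefficients.\<close>

lemma g_e_closed_form:
  assumes "k \<ge> 1"
  shows "g_e k = (real k + 2) * (real k - 2)\<^sup>2 / (if odd k then 3 else 24)"
  using assms
proof (induction k rule: less_induct)
  case (less k)
  \<comment> \<open>The two seeds fix the denominators: (1+2)(1-2)^2 = 3 and (4+2)(4-2)^2 = 24. The
    even chain restarts at 4 because the weight at 2 is zero. Elsewhere -B_(j+2)/A_j is the quotient
    of (k+2)(k-2)^2 at k = j+2 and at k = j.\<close>
  consider "k = 1" | "k = 2" | "k = 4" | "k \<ge> 3" "k \<noteq> 4" using less.prems by linarith
  then show ?case
  proof cases
    case 4
    define j where "j = k - 2"
    have k: "k = j + 2" and j: "j \<ge> 1" "j \<noteq> 2" using 4 by (auto simp: j_def)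
    have "g_e k = - g_e j * B_coeff k / A_coeff j"
      using 4 by (subst g_e.simps) (simp add: j_def)
    also have "g_e j = (real j + 2) * (real j - 2)\<^sup>2 / (if odd j then 3 else 24)"
      using less.IH[of j] j k by simp
    also have "- ((real j + 2) * (real j - 2)\<^sup>2 / (if odd j then 3 else 24)) * B_coeff k / A_coeff j
        = (real k + 2) * (real k - 2)\<^sup>2 / (if odd k then 3 else 24)"
    proof -
      define x where "x = real j"
      have x: "x > 0" "x - 2 \<noteq> 0" "x + 2 \<noteq> 0" using j by (auto simp: x_def)
      have kx: "real k = x + 2" by (simp add: k x_def)
      have "- ((x + 2) * u / d) * ((x + 2 + 2) * (x + 2 - 2) / (4 * (x + 2))) / (- (u / (4 * x)))
         = (x + 2 + 2) * (x + 2 - 2)\<^sup>2 / d" if "d \<noteq> 0" "u \<noteq> 0" for d u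
        using x that by (simp add: divide_simps) (simp add: power2_eq_square)
      from this[of _ "(x - 2)\<^sup>2"] show ?thesis
        unfolding A_coeff_def B_coeff_def kx x_def[symmetric] using k x by simp
    qed
    finally show ?thesis .
  qed (auto simp: g_e_initial[unfolded One_nat_def])
qed

lemma g_e_0 [simp]: "g_e 0 = 0"
  by (simp add: g_e.simps)

lemma g_e_nonneg: "g_e k \<ge> 0"
  by (cases "k = 0") (auto simp: g_e_closed_form)

lemma g_e_upper: "g_e k \<le> real k ^ 3"
proof (cases "k = 0")
  case False
  define x where "x = real k"
  have x: "x \<ge> 1" using False by (simp add: x_def)
  have "(x - 2)\<^sup>2 \<le> x\<^sup>2" using x by (simp add: power2_eq_square algebra_simps)
  then have "(x + 2) * (x - 2)\<^sup>2 \<le> (3 * x) * x\<^sup>2"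
    by (rule mult_mono[rotated]) (use x in auto)
  moreover have "g_e k \<le> (x + 2) * (x - 2)\<^sup>2 / 3"
    using x False by (subst g_e_closed_form) (auto simp: x_def intro!: divide_left_mono)
  ultimately show ?thesis
    by (simp add: x_def power3_eq_cube power2_eq_square)
qed auto

text \<open>216 = 9 * 24: off 2 one has |k - 2| \<ge> k/3, with equality at 3, and 24 is the larger
  denominator of the closed form. At k = 2 the estimate fails, so mode 2 is controlled separately
  wherever the energy is compared with the Sobolev norm.\<close>

lemma g_e_lower:
  assumes "k \<ge> 1" "k \<noteq> 2"
  shows "real k ^ 3 / 216 \<le> g_e k"
proof -
  define x where "x = real k"
  have x: "x \<ge> 1" using assms by (simp add: x_def)
  have "x\<^sup>2 / 9 \<le> (x - 2)\<^sup>2"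
  proof (cases "k = 1")
    case False
    then have "k \<ge> 3" using assms by auto
    then have "x \<ge> 3" by (simp add: x_def)
    then have "(x / 3)\<^sup>2 \<le> (x - 2)\<^sup>2" by (intro power_mono) auto
    then show ?thesis by (simp add: power_divide)
  qed (simp add: x_def)
  then have "x * (x\<^sup>2 / 9) \<le> (x + 2) * (x - 2)\<^sup>2"
    by (intro mult_mono) (use x in auto)
  moreover have "(x + 2) * (x - 2)\<^sup>2 / 24 \<le> g_e k"
    using x assms by (subst g_e_closed_form) (auto simp: x_def intro!: divide_left_mono)
  ultimately show ?thesis
    by (simp add: x_def power3_eq_cube power2_eq_square)
qed

text \<open>For k = 1 and k = 2 natural subtraction yields index 0, and \<open>A_coeff 0\<close> = 0
  (a division by zero) removes that term. \<open>\<sigma>\<close> = 1 gives the cosine system, -1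
  the sine system; 3/4 is -B_1, the part of mode 1 that is sent to mode -1 and reflected.\<close>

definition mode_rhs :: "real \<Rightarrow> (nat \<Rightarrow> real) \<Rightarrow> nat \<Rightarrow> real" where
  "mode_rhs \<sigma> y k = A_coeff (k - 2) * y (k - 2) + B_coeff (k + 2) * y (k + 2)
     - (if k = 1 then \<sigma> * (3/4) * y 1 else 0)"

text \<open>Half the rate at which weighted energy passes from mode N to mode N + 2.\<close>

definition flux :: "(nat \<Rightarrow> real) \<Rightarrow> nat \<Rightarrow> real" where
  "flux y N = g_e (N + 2) * A_coeff N * y N * y (N + 2)"

lemma A_coeff_0 [simp]: "A_coeff 0 = 0"
  by (simp add: A_coeff_def)

text \<open>By the recursion g_k B_(k+2) = -g_(k+2) A_k, so mode k gains 2 flux(k-2) and loses 2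
  flux(k). The sum telescopes with stride two, separately over odd and even modes; this leaves two
  boundary terms, at N and at N - 1.\<close>

lemma energy_production:
  assumes "N \<ge> 1"
  shows "(\<Sum>k=1..N. g_e k * (2 * y k * mode_rhs \<sigma> y k))
    = - (3/2) * \<sigma> * (y 1)\<^sup>2 - 2 * flux y N - 2 * flux y (N - 1)"
  using assms
proof (induction N rule: dec_induct)
  case base
  have "g_e 1 * B_coeff 3 = - g_e 3 * A_coeff 1"
    using g_e_recursion[of 1] by (simp add: numeral_3_eq_3)
  moreover have "(\<Sum>k=1..1. g_e k * (2 * y k * mode_rhs \<sigma> y k)) =
      2 * y 1 * ((g_e 1 * B_coeff 3) * y 3) - (3/2) * \<sigma> * (y 1)\<^sup>2"
    by (simp add: mode_rhs_def g_e_initial[unfolded One_nat_def] numeral_3_eq_3 algebra_simps power2_eq_square)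
  ultimately show ?case
    by (simp add: flux_def numeral_3_eq_3 algebra_simps)
next
  case (step N)
  have "g_e (N + 1) * B_coeff (N + 1 + 2) = - g_e (N + 1 + 2) * A_coeff (N + 1)"
    using g_e_recursion[of "N + 1"] by simp
  moreover have "g_e (Suc N) * (2 * y (Suc N) * mode_rhs \<sigma> y (Suc N)) =
      2 * flux y (N - 1) + 2 * y (N + 1) * (g_e (N + 1) * B_coeff (N + 1 + 2)) * y (N + 1 + 2)"
    using step.hyps by (simp add: mode_rhs_def flux_def algebra_simps)
  ultimately have "g_e (Suc N) * (2 * y (Suc N) * mode_rhs \<sigma> y (Suc N)) =
      2 * flux y (N - 1) - 2 * flux y (Suc N)"
    by (simp add: flux_def)
  with step show ?case by simp
qed

text \<open>A cubic weight times a linear coefficient has size N^4. One factor N is split off so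
  that the bracket consists of terms of the squared Sobolev norm.\<close>

lemma flux_bound:
  "\<bar>flux y N\<bar> \<le> real N * (real N ^ 3 * (y N)\<^sup>2 + real (N + 2) ^ 3 * (y (N + 2))\<^sup>2)"
proof (cases "N = 0")
  case False
  define x where "x = real N"
  have x: "x \<ge> 1" using False by (simp add: x_def)
  have "(x - 2)\<^sup>2 \<le> x\<^sup>2" using x by (simp add: power2_eq_square algebra_simps)
  have "\<bar>g_e (N + 2) * A_coeff N\<bar> = g_e (N + 2) * ((x - 2)\<^sup>2 / (4 * x))"
    by (simp add: A_coeff_def abs_mult g_e_nonneg x_def)
  also have "\<dots> \<le> ((x + 4) * x\<^sup>2 / 3) * (x\<^sup>2 / (4 * x))"
  proof (rule mult_mono)
    have "g_e (N + 2) = (x + 4) * x\<^sup>2 / (if odd N then 3 else 24)"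
      by (simp add: g_e_closed_form x_def add.commute)
    also have "\<dots> \<le> (x + 4) * x\<^sup>2 / 3"
      using x by (intro divide_left_mono) auto
    finally show "g_e (N + 2) \<le> (x + 4) * x\<^sup>2 / 3" .
    show "(x - 2)\<^sup>2 / (4 * x) \<le> x\<^sup>2 / (4 * x)"
      using \<open>(x - 2)\<^sup>2 \<le> x\<^sup>2\<close> x by (intro divide_right_mono) auto
  qed (use x in auto)
  also have "\<dots> = (x + 4) * x ^ 3 / 12"
    using x by (simp add: field_simps power2_eq_square power3_eq_cube)
  also have "\<dots> \<le> (12 * x) * x ^ 3 / 12"
    using x by (intro divide_right_mono mult_right_mono) auto
  finally have "\<bar>g_e (N + 2) * A_coeff N\<bar> \<le> x * x ^ 3" by simp
  moreover have "\<bar>y N * y (N + 2)\<bar> \<le> (y N)\<^sup>2 + (y (N + 2))\<^sup>2"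
  proof -
    have "2 * \<bar>y N * y (N + 2)\<bar> \<le> (y N)\<^sup>2 + (y (N + 2))\<^sup>2"
      using sum_squares_bound[of "\<bar>y N\<bar>" "\<bar>y (N + 2)\<bar>"] by (simp add: abs_mult)
    then show ?thesis by (smt (verit) abs_ge_zero)
  qed
  ultimately have "\<bar>flux y N\<bar> \<le> (x * x ^ 3) * ((y N)\<^sup>2 + (y (N + 2))\<^sup>2)"
    unfolding flux_def mult.assoc[of "_ * _" "y N"] abs_mult[of "_ * _" "y N * _"]
    by (intro mult_mono) (use x in auto)
  also have "\<dots> = x * (x ^ 3 * (y N)\<^sup>2 + x ^ 3 * (y (N + 2))\<^sup>2)"
    by (simp add: algebra_simps)
  also have "\<dots> \<le> x * (x ^ 3 * (y N)\<^sup>2 + real (N + 2) ^ 3 * (y (N + 2))\<^sup>2)"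
    using x by (intro mult_left_mono add_left_mono mult_right_mono power_mono) (auto simp: x_def)
  finally show ?thesis by (simp add: x_def)
qed (simp add: flux_def)

text \<open>Replaces the choice of a subsequence: a positive d would force q_N \<ge> d/(N+1) for all
  large N, and q would dominate the harmonic series.\<close>

lemma eq_0_if_le_mult_summable:
  fixes d :: real
  assumes "\<And>N. N \<ge> N0 \<Longrightarrow> d \<le> (real N + 1) * q N" and "summable q"
  shows "d \<le> 0"
proof (rule ccontr)
  assume "\<not> d \<le> 0"
  then have d: "d > 0" by simp
  have "summable (\<lambda>N. inverse (real (Suc N)))"
  proof (rule summable_comparison_test)
    show "\<exists>N. \<forall>n\<ge>N. norm (inverse (real (Suc n))) \<le> q n / d"
      using assms(1) d by (intro exI[of _ N0]) (auto simp: field_simps)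
    show "summable (\<lambda>n. q n / d)"
      using assms(2) by (rule summable_divide)
  qed
  then have "summable (\<lambda>N. inverse (real N))"
    by (subst (asm) summable_Suc_iff)
  then show False
    using not_summable_harmonic[where ?'a = real] by simp
qed

lemma weighted_summable:
  assumes "summable (\<lambda>k. real k ^ 3 * (y k)\<^sup>2)"
  shows "summable (\<lambda>k. g_e k * (y k)\<^sup>2)"
  by (rule summable_comparison_test'[OF assms])
     (auto simp: g_e_nonneg abs_mult intro!: mult_right_mono g_e_upper)

definition energy :: "(nat \<Rightarrow> real) \<Rightarrow> real" where
  "energy y = (\<Sum>k. g_e k * (y k)\<^sup>2)"

lemma energy_partial_tendsto:
  assumes "summable (\<lambda>k. real k ^ 3 * (y k)\<^sup>2)"
  shows "(\<lambda>N. \<Sum>k=1..N. g_e k * (y k)\<^sup>2) \<longlonglongrightarrow> energy y"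
proof -
  have "(\<lambda>N. \<Sum>k\<le>N. g_e k * (y k)\<^sup>2) \<longlonglongrightarrow> energy y"
    unfolding energy_def using summable_LIMSEQ'[OF weighted_summable[OF assms]] by simp
  moreover have "(\<Sum>k\<le>N. g_e k * (y k)\<^sup>2) = (\<Sum>k=1..N. g_e k * (y k)\<^sup>2)" for N
    by (rule sum.mono_neutral_right) (auto simp: not_le)
  ultimately show ?thesis by simp
qed

text \<open>The norm bound is imposed on partial sums, uniformly in N and t, so that it can be
  integrated in time before any exchange with the infinite sum.\<close>

locale mode_solution =
  fixes \<sigma> T K :: real and y :: "nat \<Rightarrow> real \<Rightarrow> real"
  assumes ode: "\<And>k t. k \<ge> 1 \<Longrightarrow> t \<in> {0..T} \<Longrightarrow>
      (y k has_real_derivative mode_rhs \<sigma> (\<lambda>j. y j t) k) (at t within {0..T})"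
    and bound: "\<And>N t. t \<in> {0..T} \<Longrightarrow> (\<Sum>k\<le>N. real k ^ 3 * (y k t)\<^sup>2) \<le> K"
begin

lemma cont: "k \<ge> 1 \<Longrightarrow> continuous_on {0..T} (y k)"
  using ode by (meson DERIV_continuous_on)

lemma summable_weighted: "t \<in> {0..T} \<Longrightarrow> summable (\<lambda>k. real k ^ 3 * (y k t)\<^sup>2)"
  by (rule bounded_imp_summable[where B = K]) (use bound in auto)

lemma energy_balance:
  assumes st: "0 \<le> s" "s \<le> t" "t \<le> T"
  shows "energy (\<lambda>k. y k t) - energy (\<lambda>k. y k s) =
      - (3/2) * \<sigma> * integral {s..t} (\<lambda>r. (y 1 r)\<^sup>2)"
proof -
  have sub: "{s..t} \<subseteq> {0..T}" using st by auto
  have cnt: "continuous_on {s..t} (y k)" if "k \<ge> 1" for k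
    using cont[OF that] sub continuous_on_subset by blast
  define F where "F N r = flux (\<lambda>k. y k r) N" for N r
  have contF: "continuous_on {s..t} (F N)" for N
  proof (cases "N = 0")
    case False
    then show ?thesis unfolding F_def flux_def by (intro continuous_intros cnt) auto
  qed (simp add: F_def flux_def)
  define E where "E N r = (\<Sum>k=1..N. g_e k * (y k r)\<^sup>2)" for N r
  define I where "I = integral {s..t} (\<lambda>r. (y 1 r)\<^sup>2)"
  have id: "E N t - E N s = - (3/2) * \<sigma> * I - 2 * integral {s..t} (F N) - 2 * integral {s..t} (F (N - 1))"
    if "N \<ge> 1" for N
  proof -
    have "(E N has_real_derivative - (3/2) * \<sigma> * (y 1 r)\<^sup>2 - 2 * F N r - 2 * F (N - 1) r) (at r within {s..t})"
      if r: "r \<in> {s..t}" for r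
    proof -
      have "((\<lambda>r. \<Sum>k=1..N. g_e k * (y k r)\<^sup>2) has_real_derivative
          (\<Sum>k=1..N. g_e k * (2 * y k r * mode_rhs \<sigma> (\<lambda>j. y j r) k))) (at r within {0..T})"
        by (rule DERIV_sum) (use r sub in \<open>auto intro!: derivative_eq_intros ode\<close>)
      then have "((\<lambda>r. \<Sum>k=1..N. g_e k * (y k r)\<^sup>2) has_real_derivative
          (\<Sum>k=1..N. g_e k * (2 * y k r * mode_rhs \<sigma> (\<lambda>j. y j r) k))) (at r within {s..t})"
        using sub DERIV_subset by blast
      then show ?thesis
        using energy_production[OF \<open>N \<ge> 1\<close>, of "\<lambda>j. y j r" \<sigma>] by (simp add: E_def[abs_def] F_def)
    qed
    then have "((\<lambda>r. - (3/2) * \<sigma> * (y 1 r)\<^sup>2 - 2 * F N r - 2 * F (N - 1) r) has_integral E N t - E N s) {s..t}"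
      by (intro fundamental_theorem_of_calculus)
         (use st in \<open>auto simp: has_real_derivative_iff_has_vector_derivative[symmetric]\<close>)
    moreover have "((\<lambda>r. - (3/2) * \<sigma> * (y 1 r)\<^sup>2 - 2 * F N r - 2 * F (N - 1) r) has_integral
        - (3/2) * \<sigma> * I - 2 * integral {s..t} (F N) - 2 * integral {s..t} (F (N - 1))) {s..t}"
      unfolding I_def
      by (intro has_integral_diff has_integral_mult_right integrable_integral
            integrable_continuous_real contF continuous_intros cnt) auto
    ultimately show ?thesis by (rule has_integral_unique)
  qed
  \<comment> \<open>The time integrals of k^3 y_k^2 are summable by the uniform bound. This is the
    convergent series against which the fluxes, also integrated in time, are compared.\<close>
  define w where "w k = integral {s..t} (\<lambda>r. real k ^ 3 * (y k r)\<^sup>2)" for k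
  have contw: "continuous_on {s..t} (\<lambda>r. real k ^ 3 * (y k r)\<^sup>2)" for k
    by (cases "k = 0") (auto intro!: continuous_intros cnt)
  have w0: "w k \<ge> 0" for k
    unfolding w_def by (intro integral_nonneg integrable_continuous_real contw) auto
  have sumw: "summable w"
  proof (rule bounded_imp_summable[where B = "K * (t - s)"])
    fix n
    have "(\<Sum>k\<le>n. w k) = integral {s..t} (\<lambda>r. \<Sum>k\<le>n. real k ^ 3 * (y k r)\<^sup>2)"
      unfolding w_def by (intro integral_sum[symmetric] integrable_continuous_real contw) auto
    also have "\<dots> \<le> integral {s..t} (\<lambda>r. K)"
      by (intro integral_le integrable_continuous_real continuous_intros contw)
         (use bound sub in auto)
    finally show "(\<Sum>k\<le>n. w k) \<le> K * (t - s)" using st by (simp add: mult.commute)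
  qed (rule w0)
  have absF: "\<bar>integral {s..t} (F N)\<bar> \<le> (real N + 1) * (w N + w (N + 2))" for N
  proof -
    have "\<bar>integral {s..t} (F N)\<bar> \<le> integral {s..t} (\<lambda>r. real N * (real N ^ 3 * (y N r)\<^sup>2 + real (N + 2) ^ 3 * (y (N + 2) r)\<^sup>2))"
      unfolding real_norm_def[symmetric]
    proof (rule integral_norm_bound_integral)
      show "F N integrable_on {s..t}" by (intro integrable_continuous_real contF)
      show "(\<lambda>r. real N * (real N ^ 3 * (y N r)\<^sup>2 + real (N + 2) ^ 3 * (y (N + 2) r)\<^sup>2)) integrable_on {s..t}"
        using integrable_continuous_real[OF continuous_on_mult_left[OF continuous_on_add[OF contw contw]]] .
      show "norm (F N r) \<le> real N * (real N ^ 3 * (y N r)\<^sup>2 + real (N + 2) ^ 3 * (y (N + 2) r)\<^sup>2)" for r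
        using flux_bound[of "\<lambda>k. y k r" N] by (simp add: F_def)
    qed
    also have "\<dots> = real N * (w N + w (N + 2))"
      unfolding w_def integral_mult_right
      by (subst integral_add[OF integrable_continuous_real[OF contw] integrable_continuous_real[OF contw]]) simp
    also have "\<dots> \<le> (real N + 1) * (w N + w (N + 2))"
      by (intro mult_right_mono) (use w0 in \<open>auto simp: add_nonneg_nonneg\<close>)
    finally show ?thesis .
  qed
  define \<delta> where "\<delta> = energy (\<lambda>k. y k t) - energy (\<lambda>k. y k s) + (3/2) * \<sigma> * I"
  have lim: "(\<lambda>N. E N t - E N s + (3/2) * \<sigma> * I) \<longlonglongrightarrow> \<delta>"
    unfolding \<delta>_def E_def
    by (intro tendsto_intros energy_partial_tendsto summable_weighted) (use st in auto)
  have "\<bar>\<delta>\<bar> \<le> 0"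
  proof (cases "\<delta> = 0")
    case False
    then have "\<forall>\<^sub>F N in sequentially. \<bar>E N t - E N s + (3/2) * \<sigma> * I\<bar> > \<bar>\<delta>\<bar> / 2"
      using order_tendstoD(1)[OF tendsto_rabs[OF lim], of "\<bar>\<delta>\<bar> / 2"] by simp
    then obtain N0 where N0: "\<And>N. N \<ge> N0 \<Longrightarrow> \<bar>E N t - E N s + (3/2) * \<sigma> * I\<bar> > \<bar>\<delta>\<bar> / 2"
      by (auto simp: eventually_sequentially)
    \<comment> \<open>Cutting at N + 1 produces the fluxes at N + 1 and at N, each with a factor 2
      from the energy identity; the last factor 2 comes from N + 2 \<le> 2 (N + 1).\<close>
    let ?q = "\<lambda>N. 2 * (w (N + 1) + w (N + 3) + w N + w (N + 2)) * 2"
    have "\<bar>\<delta>\<bar> / 2 \<le> 0"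
    proof (rule eq_0_if_le_mult_summable[where q = ?q])
      show "\<bar>\<delta>\<bar> / 2 \<le> (real N + 1) * ?q N" if "N \<ge> N0" for N
      proof -
        have "\<bar>\<delta>\<bar> / 2 \<le> \<bar>E (N + 1) t - E (N + 1) s + (3/2) * \<sigma> * I\<bar>"
          using N0[of "N + 1"] that by simp
        also have "\<dots> \<le> 2 * \<bar>integral {s..t} (F (N + 1))\<bar> + 2 * \<bar>integral {s..t} (F N)\<bar>"
          using id[of "N + 1"] by simp
        also have "\<dots> \<le> 2 * ((real (N + 1) + 1) * (w (N + 1) + w (N + 3))) + 2 * ((real N + 1) * (w N + w (N + 2)))"
          using absF[of "N + 1"] absF[of N] by (simp add: numeral_3_eq_3)
        also have "\<dots> \<le> 2 * ((2 * (real N + 1)) * (w (N + 1) + w (N + 3))) + 2 * ((2 * (real N + 1)) * (w N + w (N + 2)))"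
          by (intro add_mono mult_left_mono mult_right_mono) (use w0 in \<open>auto simp: add_nonneg_nonneg\<close>)
        also have "\<dots> = (real N + 1) * ?q N" by (simp add: algebra_simps)
        finally show ?thesis .
      qed
      show "summable ?q"
        by (intro summable_mult summable_mult2 summable_add summable_ignore_initial_segment sumw)
    qed
    then show ?thesis by simp
  qed simp
  then show ?thesis by (simp add: \<delta>_def I_def)
qed

text \<open>The balance writes the energy as the integral of a continuous function, so it is
  differentiable although its series cannot be differentiated term by term.\<close>

lemma energy_has_derivative:
  assumes "t \<in> {0..T}"
  shows "((\<lambda>s. energy (\<lambda>k. y k s)) has_real_derivative - (3/2) * \<sigma> * (y 1 t)\<^sup>2) (at t within {0..T})"
proof -
  have "((\<lambda>u. integral {0..u} (\<lambda>r. (y 1 r)\<^sup>2)) has_real_derivative (y 1 t)\<^sup>2) (at t within {0..T})"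
    by (intro integral_has_real_derivative continuous_intros cont assms) auto
  then have "((\<lambda>u. energy (\<lambda>k. y k 0) + (- (3/2) * \<sigma> * integral {0..u} (\<lambda>r. (y 1 r)\<^sup>2)))
      has_real_derivative 0 + (- (3/2) * \<sigma> * (y 1 t)\<^sup>2)) (at t within {0..T})"
    by (intro DERIV_add DERIV_const DERIV_cmult)
  moreover have "energy (\<lambda>k. y k s) = energy (\<lambda>k. y k 0) + (- (3/2) * \<sigma> * integral {0..s} (\<lambda>r. (y 1 r)\<^sup>2))"
    if "s \<in> {0..T}" for s
    using energy_balance[of 0 s] that by simp
  ultimately show ?thesis
    using has_field_derivative_transform_within[where d = 1, OF _ _ assms]
    by (smt (verit) add_0)
qed

end

section \<open>Existence for the mode system by Galerkin truncation\<close>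

lemma square_diff_le: "(p - q)\<^sup>2 \<le> 2 * p\<^sup>2 + 2 * q\<^sup>2" for p q :: real
  using zero_le_power2[of "p + q"] unfolding power2_sum power2_diff by simp

context mode_solution
begin

text \<open>Coefficientwise continuity together with continuity of the energy gives continuity in
  norm. Mode 2, invisible to the energy, is added by its own continuity.\<close>

lemma weighted_continuous:
  assumes t: "t \<in> {0..T}"
  shows "((\<lambda>s. \<Sum>k. real k ^ 3 * (y k s - y k t)\<^sup>2) \<longlongrightarrow> 0) (at t within {0..T})"
proof -
  define E where "E s = energy (\<lambda>k. y k s)" for s
  define EN where "EN N s = (\<Sum>k=1..N. g_e k * (y k s)\<^sup>2)" for N s
  have yt: "((\<lambda>s. y k s) \<longlongrightarrow> y k t) (at t within {0..T})" if "k \<ge> 1" for k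
    using cont[OF that] t by (simp add: continuous_on)
  have Et: "(E \<longlongrightarrow> E t) (at t within {0..T})"
    using DERIV_continuous[OF energy_has_derivative[OF t]] by (simp add: continuous_within E_def[abs_def])
  have ENt: "(EN N \<longlongrightarrow> EN N t) (at t within {0..T})" for N
    unfolding EN_def by (intro tendsto_intros yt) auto
  have sums: "summable (\<lambda>k. real k ^ 3 * (y k s - y k t)\<^sup>2)" if s: "s \<in> {0..T}" for s
  proof (rule summable_comparison_test')
    show "summable (\<lambda>k. 2 * (real k ^ 3 * (y k s)\<^sup>2) + 2 * (real k ^ 3 * (y k t)\<^sup>2))"
      by (intro summable_add summable_mult summable_weighted s t)
    show "norm (real k ^ 3 * (y k s - y k t)\<^sup>2) \<le> 2 * (real k ^ 3 * (y k s)\<^sup>2) + 2 * (real k ^ 3 * (y k t)\<^sup>2)"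
      for k using mult_left_mono[OF square_diff_le[of "y k s" "y k t"], of "real k ^ 3"] by (simp add: algebra_simps)
  qed
  \<comment> \<open>Up to N the difference itself is kept. Beyond N it is bounded by twice the
    squares at s and at t, and these tails are written as energy minus partial sum, which is
    continuous in s for fixed N.\<close>
  define \<Phi> where "\<Phi> N s = (\<Sum>k=1..N. g_e k * (y k s - y k t)\<^sup>2) + 2 * (E s - EN N s) + 2 * (E t - EN N t)" for N s
  have energy_le: "energy (\<lambda>k. y k s - y k t) \<le> \<Phi> N s" if s: "s \<in> {0..T}" for N s
  proof (rule LIMSEQ_le_const2)
    show "(\<lambda>M. \<Sum>k=1..M. g_e k * (y k s - y k t)\<^sup>2) \<longlonglongrightarrow> energy (\<lambda>k. y k s - y k t)"
      by (rule energy_partial_tendsto[OF sums[OF s]])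
    have "(\<Sum>k=1..M. g_e k * (y k s - y k t)\<^sup>2) \<le> \<Phi> N s" if "M \<ge> N" for M
    proof -
      have split: "(\<Sum>k=1..M. h k) = (\<Sum>k=1..N. h k) + (\<Sum>k=N+1..M. h k)" for h :: "nat \<Rightarrow> real"
        using sum.ub_add_nat[of 1 N h "M - N"] that by simp
      have EN_le: "EN M r \<le> E r" if "r \<in> {0..T}" for r
        unfolding E_def EN_def
        by (rule incseq_le[OF _ energy_partial_tendsto[OF summable_weighted[OF that]]])
           (auto intro!: incseq_SucI simp: g_e_nonneg)
      have "(\<Sum>k=N+1..M. g_e k * (y k s - y k t)\<^sup>2)
          \<le> (\<Sum>k=N+1..M. 2 * (g_e k * (y k s)\<^sup>2) + 2 * (g_e k * (y k t)\<^sup>2))"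
        by (rule sum_mono) (use mult_left_mono[OF square_diff_le g_e_nonneg] in \<open>simp add: algebra_simps\<close>)
      also have "\<dots> = 2 * (EN M s - EN N s) + 2 * (EN M t - EN N t)"
        using split[of "\<lambda>k. g_e k * (y k s)\<^sup>2"] split[of "\<lambda>k. g_e k * (y k t)\<^sup>2"]
        by (simp add: EN_def sum.distrib sum_distrib_left)
      also have "\<dots> \<le> 2 * (E s - EN N s) + 2 * (E t - EN N t)"
        using EN_le[OF s] EN_le[OF t] by simp
      finally show ?thesis unfolding \<Phi>_def by (subst split) simp
    qed
    then show "\<exists>M0. \<forall>M\<ge>M0. (\<Sum>k=1..M. g_e k * (y k s - y k t)\<^sup>2) \<le> \<Phi> N s" by blast
  qed
  \<comment> \<open>216 is the constant of \<open>g_e_lower\<close>; 8 = 2^3 is the Sobolev weight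
    of mode 2, which the energy misses.\<close>
  have le: "(\<Sum>k. real k ^ 3 * (y k s - y k t)\<^sup>2) \<le> 216 * energy (\<lambda>k. y k s - y k t) + 8 * (y 2 s - y 2 t)\<^sup>2"
    if s: "s \<in> {0..T}" for s
  proof -
    have "real k ^ 3 * d \<le> 216 * (g_e k * d) + (if k = 2 then 8 * d else 0)" if "d \<ge> 0" for k d
      using mult_right_mono[OF g_e_lower[of k] that] by (cases "k = 0") (auto simp: g_e_initial)
    then have "(\<Sum>k. real k ^ 3 * (y k s - y k t)\<^sup>2)
        \<le> (\<Sum>k. 216 * (g_e k * (y k s - y k t)\<^sup>2) + (if k = 2 then 8 * (y k s - y k t)\<^sup>2 else 0))"
      by (intro suminf_le sums[OF s] summable_add summable_mult weighted_summable) auto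
    also have "\<dots> = 216 * energy (\<lambda>k. y k s - y k t) + (\<Sum>k. if k = 2 then 8 * (y k s - y k t)\<^sup>2 else 0)"
      unfolding energy_def
      by (subst suminf_add[symmetric]) (auto intro!: summable_mult weighted_summable sums[OF s] simp: suminf_mult[OF weighted_summable[OF sums[OF s]]])
    also have "(\<Sum>k. if k = 2 then 8 * (y k s - y k t)\<^sup>2 else 0) = 8 * (y 2 s - y 2 t)\<^sup>2"
      using sums_If_finite[of "\<lambda>k. k = 2" "\<lambda>k. 8 * (y k s - y k t)\<^sup>2"] by (simp add: sums_iff)
    finally show ?thesis .
  qed
  show ?thesis
  proof (rule order_tendstoI)
    fix e :: real assume "e < 0"
    then show "\<forall>\<^sub>F s in at t within {0..T}. e < (\<Sum>k. real k ^ 3 * (y k s - y k t)\<^sup>2)"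
      by (auto simp: eventually_at_filter intro!: always_eventually less_le_trans[OF _ suminf_nonneg[OF sums]])
  next
    fix e :: real assume e: "0 < e"
    have "(\<lambda>N. E t - EN N t) \<longlonglongrightarrow> E t - E t"
      unfolding E_def EN_def by (intro tendsto_intros energy_partial_tendsto summable_weighted t)
    \<comment> \<open>In the limit s to t the tail at t appears four times, times 216, which makes
      864 < 1000.\<close>
    then have "\<forall>\<^sub>F N in sequentially. E t - EN N t < e / 1000"
      by (rule order_tendstoD) (use e in auto)
    then obtain N where N: "E t - EN N t < e / 1000"
      using eventually_happens by fastforce
    have "((\<lambda>s. 216 * \<Phi> N s + 8 * (y 2 s - y 2 t)\<^sup>2) \<longlongrightarrow>
       216 * ((\<Sum>k=1..N. g_e k * (y k t - y k t)\<^sup>2) + 2 * (E t - EN N t) + 2 * (E t - EN N t)) + 8 * (y 2 t - y 2 t)\<^sup>2) (at t within {0..T})"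
      unfolding \<Phi>_def by (intro tendsto_intros yt Et ENt) auto
    then have "\<forall>\<^sub>F s in at t within {0..T}. 216 * \<Phi> N s + 8 * (y 2 s - y 2 t)\<^sup>2 < e"
      by (rule order_tendstoD) (use N e in simp)
    moreover have "\<forall>\<^sub>F s in at t within {0..T}. s \<in> {0..T}"
      by (auto simp: eventually_at_filter)
    ultimately show "\<forall>\<^sub>F s in at t within {0..T}. (\<Sum>k. real k ^ 3 * (y k s - y k t)\<^sup>2) < e"
    proof eventually_elim
      case (elim s)
      show ?case using le[OF elim(2)] energy_le[OF elim(2), of N] elim(1) by linarith
    qed
  qed
qed

end

text \<open>The solution is exp(t m) a as a power series: \<open>c n\<close> is the n-th power of
  the matrix applied to \<open>a\<close>. It grows at most geometrically, with ratio the sum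
  \<open>R\<close> of all absolute entries, so dividing by the factorial gives convergence for every
  t.\<close>

lemma linear_ode_exists:
  fixes m :: "'i \<Rightarrow> 'i \<Rightarrow> real" and a :: "'i \<Rightarrow> real"
  assumes "finite S"
  obtains x where "\<And>k. k \<in> S \<Longrightarrow> x k 0 = a k"
    "\<And>k t. k \<in> S \<Longrightarrow> (x k has_real_derivative (\<Sum>j\<in>S. m k j * x j t)) (at t)"
proof -
  define c where "c n = ((\<lambda>b k. \<Sum>j\<in>S. m k j * b j) ^^ n) a" for n
  have c0: "c 0 = a" and cS: "c (Suc n) k = (\<Sum>j\<in>S. m k j * c n j)" for n k
    by (simp_all add: c_def)
  define R where "R = (\<Sum>k\<in>S. \<Sum>j\<in>S. \<bar>m k j\<bar>)"
  define M where "M = (\<Sum>k\<in>S. \<bar>a k\<bar>)"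
  have M: "M \<ge> 0" unfolding M_def by (simp add: sum_nonneg)
  have bnd: "\<bar>c n k\<bar> \<le> M * R ^ n" if "k \<in> S" for n k
    using that
  proof (induction n arbitrary: k)
    case 0
    then show ?case using assms by (auto simp: c0 M_def intro: member_le_sum)
  next
    case (Suc n)
    have "\<bar>c (Suc n) k\<bar> \<le> (\<Sum>j\<in>S. \<bar>m k j\<bar> * (M * R ^ n))"
      unfolding cS by (intro order_trans[OF sum_abs] sum_mono) (auto simp: abs_mult intro!: mult_left_mono Suc)
    also have "\<dots> = (\<Sum>j\<in>S. \<bar>m k j\<bar>) * (M * R ^ n)" by (simp add: sum_distrib_right)
    also have "\<dots> \<le> R * (M * R ^ n)"
    proof (rule mult_right_mono)
      show "(\<Sum>j\<in>S. \<bar>m k j\<bar>) \<le> R"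
        unfolding R_def using assms Suc.prems by (intro member_le_sum) (auto intro: sum_nonneg)
      have "R \<ge> 0" unfolding R_def by (intro sum_nonneg) auto
      then show "0 \<le> M * R ^ n" using M by simp
    qed
    finally show ?case by (simp add: mult_ac)
  qed
  define x where "x k t = (\<Sum>n. (c n k / fact n) * t ^ n)" for k t
  have smb: "summable (\<lambda>n. (c n k / fact n) * t ^ n)" if "k \<in> S" for k t
  proof (rule summable_comparison_test')
    show "summable (\<lambda>n. M * (inverse (fact n) * (R * \<bar>t\<bar>) ^ n))"
      by (intro summable_mult summable_exp)
    show "norm ((c n k / fact n) * t ^ n) \<le> M * (inverse (fact n) * (R * \<bar>t\<bar>) ^ n)" for n
      using mult_right_mono[OF bnd[OF that, of n], of "\<bar>t\<bar> ^ n / fact n"]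
      by (simp add: abs_mult power_abs power_mult_distrib field_simps)
  qed
  show ?thesis
  proof
    show "x k 0 = a k" if "k \<in> S" for k
      using powser_zero[of "\<lambda>n. c n k / fact n"] by (simp add: x_def c0)
    fix k t assume k: "k \<in> S"
    have "(x k has_real_derivative (\<Sum>n. diffs (\<lambda>n. c n k / fact n) n * t ^ n)) (at t)"
      unfolding x_def by (rule termdiffs_strong_converges_everywhere) (rule smb[OF k])
    also have "(\<Sum>n. diffs (\<lambda>n. c n k / fact n) n * t ^ n) = (\<Sum>n. \<Sum>j\<in>S. m k j * ((c n j / fact n) * t ^ n))"
    proof (rule suminf_cong)
      fix n
      have "diffs (\<lambda>n. c n k / fact n) n = c (Suc n) k / fact n"
        by (simp add: diffs_def field_simps del: of_nat_Suc)
      then show "diffs (\<lambda>n. c n k / fact n) n * t ^ n = (\<Sum>j\<in>S. m k j * ((c n j / fact n) * t ^ n))"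
        by (simp add: cS sum_divide_distrib sum_distrib_right mult.assoc)
    qed
    also have "\<dots> = (\<Sum>j\<in>S. m k j * x j t)"
    proof -
      have "(\<Sum>n. \<Sum>j\<in>S. m k j * ((c n j / fact n) * t ^ n)) = (\<Sum>j\<in>S. \<Sum>n. m k j * ((c n j / fact n) * t ^ n))"
        by (rule suminf_sum) (intro summable_mult smb)
      also have "\<dots> = (\<Sum>j\<in>S. m k j * x j t)"
        unfolding x_def by (rule sum.cong[OF refl]) (rule suminf_mult[OF smb])
      finally show ?thesis .
    qed
    finally show "(x k has_real_derivative (\<Sum>j\<in>S. m k j * x j t)) (at t)" .
  qed
qed


text \<open>Matrix form of the truncated system, as \<open>linear_ode_exists\<close> requires it:
  column j is the image of the j-th unit vector.\<close>

lemma mode_rhs_sum: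
  assumes "finite S"
  shows "mode_rhs \<sigma> (\<lambda>i. if i \<in> S then x i else 0) k
    = (\<Sum>j\<in>S. mode_rhs \<sigma> (\<lambda>i. if i = j then 1 else 0) k * x j)"
proof -
  have "(if i \<in> S then x i else 0) = (\<Sum>j\<in>S. (if i = j then 1 else 0) * x j)" for i
    using assms by (auto simp: if_distrib[of "\<lambda>c. c * _"] cong: if_cong)
  then show ?thesis
    by (simp add: mode_rhs_def sum_distrib_left algebra_simps sum.distrib sum_subtractf del: mult_delta_left)
qed

text \<open>Truncating the system to \<open>1..N\<close> kills both boundary fluxes, so the truncation keeps the exact energy balance.\<close>

lemma galerkin_exists:
  fixes a :: "nat \<Rightarrow> real" and N :: nat
  assumes "N \<ge> 1"
  defines "S \<equiv> {1..N} - {2}"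
  obtains y :: "nat \<Rightarrow> real \<Rightarrow> real" where
    "\<And>k. k \<in> S \<Longrightarrow> y k 0 = a k" "\<And>k t. k \<notin> S \<Longrightarrow> y k t = 0"
    "\<And>k t. k \<in> S \<Longrightarrow> (y k has_real_derivative mode_rhs 1 (\<lambda>j. y j t) k) (at t)"
    "\<And>t. t \<ge> 0 \<Longrightarrow> (\<Sum>k=1..N. g_e k * (y k t)\<^sup>2) \<le> (\<Sum>k=1..N. g_e k * (a k)\<^sup>2)"
proof -
  have fin: "finite S" by (simp add: S_def)
  obtain x where x0: "\<And>k. k \<in> S \<Longrightarrow> x k 0 = a k" and
    xd: "\<And>k t. k \<in> S \<Longrightarrow> (x k has_real_derivative
      (\<Sum>j\<in>S. mode_rhs 1 (\<lambda>i. if i = j then 1 else 0) k * x j t)) (at t)"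
    by (rule linear_ode_exists[OF fin, of a "\<lambda>k j. mode_rhs 1 (\<lambda>i. if i = j then 1 else 0) k"]) auto
  define y where "y k t = (if k \<in> S then x k t else 0)" for k t
  have yd: "(y k has_real_derivative mode_rhs 1 (\<lambda>j. y j t) k) (at t)" if "k \<in> S" for k t
    using xd[OF that, of t] that unfolding y_def mode_rhs_sum[OF fin] by (simp add: y_def[abs_def])
  show ?thesis
  proof
    show "y k 0 = a k" if "k \<in> S" for k using x0 that by (simp add: y_def)
    show "y k t = 0" if "k \<notin> S" for k t using that by (simp add: y_def)
    show "(y k has_real_derivative mode_rhs 1 (\<lambda>j. y j t) k) (at t)" if "k \<in> S" for k t
      by (rule yd[OF that])
    fix t :: real assume t: "t \<ge> 0"
    have "(\<Sum>k=1..N. g_e k * (y k t)\<^sup>2) \<le> (\<Sum>k=1..N. g_e k * (y k 0)\<^sup>2)"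
    proof (rule DERIV_nonpos_imp_nonincreasing[OF t])
      fix r
      \<comment> \<open>Mode 2 is absent from \<open>S\<close>, but its weight is zero, so the
        energy sum may still run over all of 1..N.\<close>
      have "((\<lambda>r. g_e k * (y k r)\<^sup>2) has_real_derivative g_e k * (2 * y k r * mode_rhs 1 (\<lambda>j. y j r) k)) (at r)"
        if "k \<in> {1..N}" for k
      proof (cases "k = 2")
        case False
        then have "k \<in> S" using that by (simp add: S_def)
        then show ?thesis by (auto intro!: derivative_eq_intros yd)
      qed (simp add: g_e_initial)
      then have "((\<lambda>r. \<Sum>k=1..N. g_e k * (y k r)\<^sup>2) has_real_derivative
          (\<Sum>k=1..N. g_e k * (2 * y k r * mode_rhs 1 (\<lambda>j. y j r) k))) (at r)"
        by (rule DERIV_sum)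
      moreover have "flux (\<lambda>j. y j r) N = 0" "flux (\<lambda>j. y j r) (N - 1) = 0"
        using assms by (auto simp: flux_def y_def S_def)
      ultimately show "\<exists>D. ((\<lambda>r. \<Sum>k=1..N. g_e k * (y k r)\<^sup>2) has_real_derivative D) (at r) \<and> D \<le> 0"
        unfolding energy_production[OF \<open>N \<ge> 1\<close>] by (intro exI conjI) auto
    qed
    also have "\<dots> = (\<Sum>k=1..N. g_e k * (a k)\<^sup>2)"
    proof (rule sum.cong)
      show "g_e k * (y k 0)\<^sup>2 = g_e k * (a k)\<^sup>2" if "k \<in> {1..N}" for k
        using x0 that by (cases "k = 2") (auto simp: y_def S_def g_e_initial)
    qed simp
    finally show "(\<Sum>k=1..N. g_e k * (y k t)\<^sup>2) \<le> (\<Sum>k=1..N. g_e k * (a k)\<^sup>2)" .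
  qed
qed

section \<open>Passing to the limit in the truncations\<close>

lemma mode_rhs_bound:
  assumes "\<And>j. \<bar>y j\<bar> \<le> M"
  shows "\<bar>mode_rhs \<sigma> y k\<bar> \<le> (\<bar>A_coeff (k - 2)\<bar> + \<bar>B_coeff (k + 2)\<bar> + \<bar>\<sigma>\<bar>) * M"
proof -
  have *: "\<bar>c * y j\<bar> \<le> \<bar>c\<bar> * M" for c j
    using assms[of j] by (simp add: abs_mult mult_left_mono)
  have "\<bar>if k = 1 then \<sigma> * (3/4) * y 1 else 0\<bar> \<le> \<bar>\<sigma>\<bar> * M"
  proof (cases "k = 1")
    case True
    have "\<bar>\<sigma> * (3/4)\<bar> * M \<le> \<bar>\<sigma>\<bar> * M"
      using assms[of 0] by (intro mult_right_mono) (auto simp: abs_mult)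
    then show ?thesis using *[of "\<sigma> * (3/4)" 1] True by simp
  qed (use assms[of 0] in simp)
  then show ?thesis
    unfolding mode_rhs_def using *[of "A_coeff (k - 2)" "k - 2"] *[of "B_coeff (k + 2)" "k + 2"]
    unfolding distrib_right by linarith
qed

lemma mode_rhs_tendsto:
  assumes "\<And>j. ((\<lambda>n. x n j) \<longlongrightarrow> y j) F"
  shows "((\<lambda>n. mode_rhs \<sigma> (x n) k) \<longlongrightarrow> mode_rhs \<sigma> y k) F"
  using assms by (cases "k = 1") (auto simp: mode_rhs_def intro!: tendsto_intros)

text \<open>Mode 2 drives no other mode, so it is left out of the compactness argument and recovered by integration.\<close>

lemma mode_solution_exists:
  fixes a :: "nat \<Rightarrow> real"
  assumes a: "summable (\<lambda>k. real k ^ 3 * (a k)\<^sup>2)"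
  obtains y K where "\<And>k. k \<ge> 1 \<Longrightarrow> y k 0 = a k" "\<And>T. T > 0 \<Longrightarrow> mode_solution 1 T (K T) y"
proof -
  define E0 where "E0 = energy a"
  have E0: "(\<Sum>k=1..N. g_e k * (a k)\<^sup>2) \<le> E0" for N
    unfolding E0_def
    by (rule incseq_le[OF _ energy_partial_tendsto[OF a]]) (auto intro!: incseq_SucI simp: g_e_nonneg)
  \<comment> \<open>\<open>Suc N\<close> because \<open>galerkin_exists\<close> asks for an upper
    index of at least 1.\<close>
  define S where "S N = {1..Suc N} - {2::nat}" for N
  have "\<exists>y. (\<forall>k\<in>S N. y k 0 = a k) \<and> (\<forall>k t. k \<notin> S N \<longrightarrow> y k t = 0) \<and>
     (\<forall>k t. k \<in> S N \<longrightarrow> (y k has_real_derivative mode_rhs 1 (\<lambda>j. y j t) k) (at t)) \<and>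
     (\<forall>t\<ge>0. (\<Sum>k=1..Suc N. g_e k * (y k t)\<^sup>2) \<le> E0)" for N
  proof -
    obtain y :: "nat \<Rightarrow> real \<Rightarrow> real" where
      "\<And>k. k \<in> S N \<Longrightarrow> y k 0 = a k" "\<And>k t. k \<notin> S N \<Longrightarrow> y k t = 0"
      "\<And>k t. k \<in> S N \<Longrightarrow> (y k has_real_derivative mode_rhs 1 (\<lambda>j. y j t) k) (at t)"
      and yE: "\<And>t. t \<ge> 0 \<Longrightarrow> (\<Sum>k=1..Suc N. g_e k * (y k t)\<^sup>2) \<le> (\<Sum>k=1..Suc N. g_e k * (a k)\<^sup>2)"
      unfolding S_def by (rule galerkin_exists[of "Suc N" a]) auto
    moreover have "(\<Sum>k=1..Suc N. g_e k * (y k t)\<^sup>2) \<le> E0" if "t \<ge> 0" for t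
      using yE[OF that] E0[of "Suc N"] by linarith
    ultimately show ?thesis by (intro exI[of _ y]) blast
  qed
  then have "\<forall>N. \<exists>y. (\<forall>k\<in>S N. y k 0 = a k) \<and> (\<forall>k t. k \<notin> S N \<longrightarrow> y k t = 0) \<and>
     (\<forall>k t. k \<in> S N \<longrightarrow> (y k has_real_derivative mode_rhs 1 (\<lambda>j. y j t) k) (at t)) \<and>
     (\<forall>t\<ge>0. (\<Sum>k=1..Suc N. g_e k * (y k t)\<^sup>2) \<le> E0)"
    by (rule allI)
  from choice[OF this] obtain Y where Y: "\<forall>N. (\<forall>k\<in>S N. Y N k 0 = a k) \<and> (\<forall>k t. k \<notin> S N \<longrightarrow> Y N k t = 0) \<and>
     (\<forall>k t. k \<in> S N \<longrightarrow> (Y N k has_real_derivative mode_rhs 1 (\<lambda>j. Y N j t) k) (at t)) \<and>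
     (\<forall>t\<ge>0. (\<Sum>k=1..Suc N. g_e k * (Y N k t)\<^sup>2) \<le> E0)"
    by (rule exE)
  have Y0: "Y N k 0 = a k"
    and Yd: "(Y N k has_real_derivative mode_rhs 1 (\<lambda>j. Y N j t) k) (at t)" if "k \<in> S N" for N k t
    using Y that by blast+
  have Yout: "Y N k t = 0" if "k \<notin> S N" for N k t
    using Y that by blast
  have YE: "(\<Sum>k=1..Suc N. g_e k * (Y N k t)\<^sup>2) \<le> E0" if "t \<ge> 0" for N t
    using Y that by blast
  \<comment> \<open>Off mode 2 the weights are at least 1/216, so a single term of the energy bounds
    every mode, uniformly in truncation and time.\<close>
  define M where "M = sqrt (216 * E0)"
  have E0nn: "E0 \<ge> 0" using E0[of 0] by simp
  have M0: "M \<ge> 0" using E0nn by (simp add: M_def)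
  have YM: "\<bar>Y N k t\<bar> \<le> M" if "t \<ge> 0" for N k t
  proof (cases "k \<in> S N")
    case True
    then have k: "k \<ge> 1" "k \<noteq> 2" "k \<le> Suc N" by (auto simp: S_def)
    have "(Y N k t)\<^sup>2 / 216 \<le> real k ^ 3 / 216 * (Y N k t)\<^sup>2"
      using mult_right_mono[of 1 "real k ^ 3" "(Y N k t)\<^sup>2"] k by simp
    also have "\<dots> \<le> g_e k * (Y N k t)\<^sup>2"
      by (intro mult_right_mono g_e_lower k) auto
    also have "\<dots> \<le> (\<Sum>k=1..Suc N. g_e k * (Y N k t)\<^sup>2)"
      using k by (intro member_le_sum) (auto simp: g_e_nonneg)
    also have "\<dots> \<le> E0" by (rule YE[OF that])
    finally show ?thesis
      unfolding M_def by (intro real_le_rsqrt) (simp add: power2_abs)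
  qed (simp add: Yout M0)
  \<comment> \<open>A bound for the k-th right-hand side that does not depend on the truncation: for
    fixed k the approximations are equi-Lipschitz in time.\<close>
  define L where "L k = (\<bar>A_coeff (k - 2)\<bar> + \<bar>B_coeff (k + 2)\<bar> + 1) * M" for k
  have L0: "L k \<ge> 0" for k using M0 by (simp add: L_def)
  have YL: "\<bar>Y N k t - Y N k s\<bar> \<le> L k * \<bar>t - s\<bar>" if "t \<ge> 0" "s \<ge> 0" for N k t s
  proof (cases "k \<in> S N")
    case True
    have "norm (Y N k t - Y N k s) \<le> L k * norm (t - s)"
    proof (rule field_differentiable_bound[of "{0..}"])
      show "(Y N k has_field_derivative mode_rhs 1 (\<lambda>j. Y N j z) k) (at z within {0..})" for z
        by (rule DERIV_subset[OF Yd[OF True]]) simp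
      show "norm (mode_rhs 1 (\<lambda>j. Y N j z) k) \<le> L k" if "z \<in> {0..}" for z
        using mode_rhs_bound[of "\<lambda>j. Y N j z" M 1 k] YM[of z N] that by (simp add: L_def)
    qed (use that in auto)
    then show ?thesis by simp
  qed (simp add: Yout L0)
  \<comment> \<open>A diagonal argument over the countable set of pairs (mode, rational time). The
    common Lipschitz constants then carry convergence from rational times to every t \<ge>
    0.\<close>
  obtain r where r: "strict_mono (r :: nat \<Rightarrow> nat)"
    and rconv: "\<And>x. x \<in> UNIV \<times> (\<rat> \<inter> {0..}) \<Longrightarrow> \<exists>l. (\<lambda>n. case x of (k, q) \<Rightarrow> Y (r n) k q) \<longlonglongrightarrow> l"
    by (rule function_convergent_subsequence[of "(UNIV :: nat set) \<times> (\<rat> \<inter> {0..})" "\<lambda>n (k, q). Y n k q" M])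
       (auto intro!: YM countable_SIGMA countable_Int1 countable_rat)
  have conv: "convergent (\<lambda>n. Y (r n) k t)" if t: "t \<ge> 0" for k t
  proof -
    have "Cauchy (\<lambda>n. Y (r n) k t)"
    proof (rule metric_CauchyI)
      fix e :: real assume e: "e > 0"
      define d where "d = e / (4 * (L k + 1))"
      have d: "d > 0" using e L0[of k] by (simp add: d_def)
      obtain q where q: "q \<in> \<rat>" "t < q" "q < t + d"
        using Rats_dense_in_real[of t "t + d"] d by auto
      have qt: "L k * \<bar>t - q\<bar> \<le> e / 4"
      proof -
        have "L k * \<bar>t - q\<bar> \<le> (L k + 1) * d"
          using q L0[of k] by (intro mult_mono) auto
        also have "\<dots> = e / 4" using L0[of k] by (simp add: d_def field_simps)
        finally show ?thesis .
      qed
      have "\<exists>l. (\<lambda>n. Y (r n) k q) \<longlonglongrightarrow> l" using rconv[of "(k, q)"] q t by auto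
      then have "Cauchy (\<lambda>n. Y (r n) k q)"
        using convergent_Cauchy convergent_def by blast
      then obtain M' where M': "\<And>m n. m \<ge> M' \<Longrightarrow> n \<ge> M' \<Longrightarrow> dist (Y (r m) k q) (Y (r n) k q) < e / 4"
        using metric_CauchyD[of _ "e / 4"] e by fastforce
      show "\<exists>M. \<forall>m\<ge>M. \<forall>n\<ge>M. dist (Y (r m) k t) (Y (r n) k t) < e"
      proof (intro exI[of _ M'] allI impI)
        fix m n assume mn: "M' \<le> m" "M' \<le> n"
        have "\<bar>Y (r m) k t - Y (r m) k q\<bar> \<le> e / 4" "\<bar>Y (r n) k t - Y (r n) k q\<bar> \<le> e / 4"
          using YL[of t q "r m" k] YL[of t q "r n" k] q t qt by auto
        then show "dist (Y (r m) k t) (Y (r n) k t) < e"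
          using M'[OF mn] e unfolding dist_real_def by linarith
      qed
    qed
    then show ?thesis by (rule Cauchy_convergent)
  qed
  define z where "z k t = lim (\<lambda>n. Y (r n) k t)" for k t
  have zlim: "(\<lambda>n. Y (r n) k t) \<longlonglongrightarrow> z k t" if "t \<ge> 0" for k t
    using conv[OF that] by (simp add: z_def convergent_LIMSEQ_iff)
  have inS: "\<forall>\<^sub>F n in sequentially. k \<in> S (r n)" if "k \<ge> 1" "k \<noteq> 2" for k
  proof (rule eventually_sequentiallyI)
    show "k \<in> S (r n)" if "n \<ge> k" for n
      using that \<open>k \<ge> 1\<close> \<open>k \<noteq> 2\<close> seq_suble[OF r, of n] by (auto simp: S_def)
  qed
  have zL: "\<bar>z k t - z k s\<bar> \<le> L k * \<bar>t - s\<bar>" if "t \<ge> 0" "s \<ge> 0" for k t s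
    by (rule LIMSEQ_le_const2[OF tendsto_rabs[OF tendsto_diff[OF zlim[OF that(1)] zlim[OF that(2)]]]])
       (use YL[OF that] in auto)
  have zM: "\<bar>z k t\<bar> \<le> M" if "t \<ge> 0" for k t
    by (rule LIMSEQ_le_const2[OF tendsto_rabs[OF zlim[OF that]]]) (use YM[OF that] in auto)
  have zcont: "continuous_on {0..} (z k)" for k
  proof -
    have "(L k)-lipschitz_on {0..} (z k)"
      by (intro lipschitz_onI) (use zL L0 in \<open>auto simp: dist_real_def\<close>)
    then show ?thesis by (rule lipschitz_on_continuous_on)
  qed
  have zE: "(\<Sum>k=1..N. g_e k * (z k t)\<^sup>2) \<le> E0" if t: "t \<ge> 0" for N t
  proof (rule LIMSEQ_le_const2)
    show "(\<lambda>n. \<Sum>k=1..N. g_e k * (Y (r n) k t)\<^sup>2) \<longlonglongrightarrow> (\<Sum>k=1..N. g_e k * (z k t)\<^sup>2)"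
      by (intro tendsto_intros zlim t)
    have "(\<Sum>k=1..N. g_e k * (Y (r n) k t)\<^sup>2) \<le> E0" if "n \<ge> N" for n
    proof -
      have "(\<Sum>k=1..N. g_e k * (Y (r n) k t)\<^sup>2) \<le> (\<Sum>k=1..Suc (r n). g_e k * (Y (r n) k t)\<^sup>2)"
        using that seq_suble[OF r, of n] by (intro sum_mono2) (auto simp: g_e_nonneg)
      also have "\<dots> \<le> E0" by (rule YE[OF t])
      finally show ?thesis .
    qed
    then show "\<exists>n0. \<forall>n\<ge>n0. (\<Sum>k=1..N. g_e k * (Y (r n) k t)\<^sup>2) \<le> E0" by blast
  qed
  \<comment> \<open>Each equation couples only finitely many modes, so dominated convergence passes
    to the limit in its integrated form. The index shift n + k guarantees that mode k belongs to the
    truncation for every n.\<close>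
  have zint: "z k t = a k + integral {0..t} (\<lambda>s. mode_rhs 1 (\<lambda>j. z j s) k)"
    if k: "k \<ge> 1" "k \<noteq> 2" and t: "t \<ge> 0" for k t
  proof -
    have Yint: "((\<lambda>s. mode_rhs 1 (\<lambda>j. Y N j s) k) has_integral Y N k t - a k) {0..t}" if "k \<in> S N" for N
      unfolding Y0[OF that, symmetric]
      by (rule fundamental_theorem_of_calculus[OF t])
         (auto simp: has_real_derivative_iff_has_vector_derivative[symmetric] intro: DERIV_subset[OF Yd[OF that]])
    have "(\<lambda>n. integral {0..t} (\<lambda>s. mode_rhs 1 (\<lambda>j. Y (r (n + k)) j s) k))
        \<longlonglongrightarrow> integral {0..t} (\<lambda>s. mode_rhs 1 (\<lambda>j. z j s) k)"
    proof (rule dominated_convergence(2))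
      have "k \<in> S (r (n + k))" for n
        using k seq_suble[OF r, of "n + k"] by (auto simp: S_def)
      then show "(\<lambda>s. mode_rhs 1 (\<lambda>j. Y (r (n + k)) j s) k) integrable_on {0..t}" for n
        using Yint by (meson has_integral_integrable)
      show "(\<lambda>_. L k) integrable_on {0..t}" by (rule integrable_const_ivl)
      show "norm (mode_rhs 1 (\<lambda>j. Y (r (n + k)) j s) k) \<le> L k" if "s \<in> {0..t}" for n s
        using mode_rhs_bound[of "\<lambda>j. Y (r (n + k)) j s" M 1 k] YM[of s "r (n + k)"] that by (simp add: L_def)
      show "(\<lambda>n. mode_rhs 1 (\<lambda>j. Y (r (n + k)) j s) k) \<longlonglongrightarrow> mode_rhs 1 (\<lambda>j. z j s) k" if "s \<in> {0..t}" for s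
        by (intro mode_rhs_tendsto LIMSEQ_ignore_initial_segment[OF zlim]) (use that in simp)
    qed
    moreover have "integral {0..t} (\<lambda>s. mode_rhs 1 (\<lambda>j. Y (r (n + k)) j s) k) = Y (r (n + k)) k t - a k" for n
      using k seq_suble[OF r, of "n + k"] by (intro integral_unique Yint) (auto simp: S_def)
    moreover have "(\<lambda>n. Y (r (n + k)) k t - a k) \<longlonglongrightarrow> z k t - a k"
      by (intro tendsto_intros LIMSEQ_ignore_initial_segment[OF zlim] t)
    ultimately show ?thesis using LIMSEQ_unique by fastforce
  qed
  define y where "y k t = (if k = 2 then a 2 + integral {0..t} (\<lambda>s. B_coeff 4 * z 4 s) else z k t)" for k t
  \<comment> \<open>Exchanging \<open>z 2\<close> for \<open>y 2\<close> alters no right-hand side,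
    since A_2 = B_2 = 0.\<close>
  have rhs: "mode_rhs 1 (\<lambda>j. y j s) k = mode_rhs 1 (\<lambda>j. z j s) k" if "k \<ge> 1" for k s
  proof -
    have "A_coeff 2 = 0" "B_coeff 2 = 0" by (simp_all add: A_coeff_def B_coeff_def)
    then have "A_coeff (k - 2) * y (k - 2) s = A_coeff (k - 2) * z (k - 2) s"
      by (cases "k - 2 = 2") (simp_all add: y_def)
    then show ?thesis using that by (simp add: mode_rhs_def y_def)
  qed
  have yint: "y k t = a k + integral {0..t} (\<lambda>s. mode_rhs 1 (\<lambda>j. y j s) k)" if "k \<ge> 1" "t \<ge> 0" for k t
    unfolding rhs[OF that(1)] using zint[OF that(1) _ that(2)] by (simp add: y_def mode_rhs_def)
  show ?thesis
  proof
    show "y k 0 = a k" if "k \<ge> 1" for k using yint[OF that, of 0] by simp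
    fix T :: real assume T: "T > 0"
    \<comment> \<open>Only this constant depends on T, through the growth of mode 2, whose Sobolev
      weight is 8. The same \<open>y\<close> serves every T, which later gives bounds uniform in
      T.\<close>
    show "mode_solution 1 T (216 * E0 + 8 * (\<bar>a 2\<bar> + (\<bar>B_coeff 4\<bar> * M) * T)\<^sup>2) y"
    proof
      fix k t assume k: "(k::nat) \<ge> 1" and t: "t \<in> {0..T}"
      have "continuous_on {0..T} (\<lambda>s. mode_rhs 1 (\<lambda>j. z j s) k)"
        unfolding mode_rhs_def
        by (cases "k = 1") (auto intro!: continuous_intros continuous_on_subset[OF zcont])
      then have "((\<lambda>u. a k + integral {0..u} (\<lambda>s. mode_rhs 1 (\<lambda>j. y j s) k)) has_real_derivative 0 + mode_rhs 1 (\<lambda>j. y j t) k) (at t within {0..T})"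
        by (intro DERIV_add DERIV_const integral_has_real_derivative) (auto simp: rhs[OF k] t[simplified])
      then show "(y k has_real_derivative mode_rhs 1 (\<lambda>j. y j t) k) (at t within {0..T})"
        using has_field_derivative_transform_within[where d = 1 and g = "y k", OF _ _ t] yint[OF k]
        by auto
    next
      fix t N assume t: "t \<in> {0..T}"
      have y2: "\<bar>y 2 t\<bar> \<le> \<bar>a 2\<bar> + (\<bar>B_coeff 4\<bar> * M) * T"
      proof -
        have "norm (integral {0..t} (\<lambda>s. B_coeff 4 * z 4 s)) \<le> (\<bar>B_coeff 4\<bar> * M) * (t - 0)"
          by (rule integral_bound)
             (use t zM in \<open>auto intro!: continuous_intros continuous_on_subset[OF zcont] mult_left_mono simp: abs_mult\<close>)
        also have "\<dots> \<le> (\<bar>B_coeff 4\<bar> * M) * T" using t M0 by (intro mult_left_mono) auto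
        finally show ?thesis by (simp add: y_def)
      qed
      have "(\<Sum>k\<le>N. real k ^ 3 * (y k t)\<^sup>2) \<le> (\<Sum>k\<le>N. 216 * (g_e k * (z k t)\<^sup>2) + (if k = 2 then 8 * (y k t)\<^sup>2 else 0))"
      proof (rule sum_mono)
        show "real k ^ 3 * (y k t)\<^sup>2 \<le> 216 * (g_e k * (z k t)\<^sup>2) + (if k = 2 then 8 * (y k t)\<^sup>2 else 0)" for k
          using mult_right_mono[OF g_e_lower[of k], of "(z k t)\<^sup>2"] by (cases "k = 0") (auto simp: g_e_initial y_def)
      qed
      also have "\<dots> \<le> 216 * (\<Sum>k=1..N. g_e k * (z k t)\<^sup>2) + 8 * (y 2 t)\<^sup>2"
      proof -
        have "(\<Sum>k\<le>N. g_e k * (z k t)\<^sup>2) = (\<Sum>k=1..N. g_e k * (z k t)\<^sup>2)"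
          by (rule sum.mono_neutral_right) (auto simp: not_le)
        then show ?thesis by (simp add: sum.distrib sum_distrib_left[symmetric])
      qed
      also have "\<dots> \<le> 216 * E0 + 8 * (\<bar>a 2\<bar> + (\<bar>B_coeff 4\<bar> * M) * T)\<^sup>2"
        using zE[of t N] t power_mono[OF y2, of 2] by auto
      finally show "(\<Sum>k\<le>N. real k ^ 3 * (y k t)\<^sup>2) \<le> 216 * E0 + 8 * (\<bar>a 2\<bar> + (\<bar>B_coeff 4\<bar> * M) * T)\<^sup>2" .
    qed
  qed
qed

section \<open>Uniqueness of Fourier coefficients\<close>

lemma set_integrable_mult_bounded:
  fixes f h :: "'a \<Rightarrow> 'b::{banach,second_countable_topology,real_normed_algebra}"
  assumes f: "set_integrable M S f" and h: "h \<in> borel_measurable M" and B: "\<And>x. norm (h x) \<le> B"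
  shows "set_integrable M S (\<lambda>x. f x * h x)"
proof -
  have B0: "B \<ge> 0" using B[of undefined] norm_ge_zero order_trans by blast
  have eq: "indicator S x *\<^sub>R (f x * h x) = (indicator S x *\<^sub>R f x) * h x" for x by simp
  have fi: "integrable M (\<lambda>x. indicator S x *\<^sub>R f x)" using f by (simp add: set_integrable_def)
  show ?thesis
    unfolding set_integrable_def eq
  proof (rule Bochner_Integration.integrable_bound)
    show "integrable M (\<lambda>x. B * norm (indicator S x *\<^sub>R f x))"
      using fi by (intro integrable_mult_right integrable_norm)
    show "(\<lambda>x. indicator S x *\<^sub>R f x * h x) \<in> borel_measurable M"
      using h borel_measurable_integrable[OF fi] by measurable
    show "AE x in M. norm (indicator S x *\<^sub>R f x * h x) \<le> norm (B * norm (indicator S x *\<^sub>R f x))"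
    proof (rule AE_I2)
      fix x
      have "norm (indicator S x *\<^sub>R f x * h x) \<le> norm (indicator S x *\<^sub>R f x) * norm (h x)"
        by (rule norm_mult_ineq)
      also have "\<dots> \<le> norm (indicator S x *\<^sub>R f x) * B" by (intro mult_left_mono B) auto
      finally show "norm (indicator S x *\<^sub>R f x * h x) \<le> norm (B * norm (indicator S x *\<^sub>R f x))"
        using B0 by (simp add: mult.commute)
    qed
  qed
qed

text \<open>\<open>f\<close> is merely integrable while the uniform summable bounds sit on
  \<open>h\<close>. In this form it covers the Fourier coefficients of a series, the Hilbert
  integral with its cotangent factor, and the time integral of the weak equation.\<close>

lemma set_integral_mult_suminf:
  fixes f :: "'a \<Rightarrow> 'b::{banach,second_countable_topology,real_normed_algebra}"
  assumes f: "set_integrable M S f" and h: "\<And>k. h k \<in> borel_measurable M"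
    and B: "\<And>k x. norm (h k x) \<le> B k" and sB: "summable (B :: nat \<Rightarrow> real)"
  shows "(\<lambda>k. LINT x:S|M. f x * h k x) sums (LINT x:S|M. f x * (\<Sum>k. h k x))"
proof -
  have sh: "summable (\<lambda>k. norm (h k x))" for x
    by (rule summable_comparison_test'[OF sB]) (use B in auto)
  have int: "integrable M (\<lambda>x. indicator S x *\<^sub>R (f x * h k x))" for k
    using set_integrable_mult_bounded[OF f h B] by (simp add: set_integrable_def)
  have fi: "integrable M (\<lambda>x. indicator S x *\<^sub>R f x)" using f by (simp add: set_integrable_def)
  have nle: "norm (indicator S x *\<^sub>R (f x * h k x)) \<le> norm (indicator S x *\<^sub>R f x) * B k" for x k
    using norm_mult_ineq[of "indicator S x *\<^sub>R f x" "h k x"] B[of k x]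
    by (simp add: norm_mult) (smt (verit, best) mult_left_mono norm_ge_zero norm_mult_ineq mult.assoc indicator_pos_le abs_ge_zero)
  have "(\<lambda>k. integral\<^sup>L M (\<lambda>x. indicator S x *\<^sub>R (f x * h k x))) sums
      (LINT x|M. (\<Sum>k. indicator S x *\<^sub>R (f x * h k x)))"
  proof (rule sums_integral[OF int])
    show "AE x in M. summable (\<lambda>k. norm (indicator S x *\<^sub>R (f x * h k x)))"
    proof (rule AE_I2)
      fix x show "summable (\<lambda>k. norm (indicator S x *\<^sub>R (f x * h k x)))"
        by (rule summable_comparison_test'[OF summable_mult[OF sB]]) (use nle in auto)
    qed
    show "summable (\<lambda>k. LINT x|M. norm (indicator S x *\<^sub>R (f x * h k x)))"
    proof (rule summable_comparison_test')
      show "summable (\<lambda>k. (LINT x|M. norm (indicator S x *\<^sub>R f x)) * B k)"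
        by (intro summable_mult sB)
      fix k
      have "(LINT x|M. norm (indicator S x *\<^sub>R (f x * h k x))) \<le> (LINT x|M. norm (indicator S x *\<^sub>R f x) * B k)"
        by (intro integral_mono integrable_norm int integrable_mult_left fi nle)
      then show "norm (LINT x|M. norm (indicator S x *\<^sub>R (f x * h k x))) \<le> (LINT x|M. norm (indicator S x *\<^sub>R f x)) * B k"
        by simp
    qed
  qed
  moreover have "(\<Sum>k. indicator S x *\<^sub>R (f x * h k x)) = indicator S x *\<^sub>R (f x * (\<Sum>k. h k x))" for x
    using suminf_mult[OF summable_norm_cancel[OF sh], of "f x" x]
    by (cases "x \<in> S") auto
  ultimately show ?thesis by (simp add: set_lebesgue_integral_def)
qed

lemma fourier_coeff_uminus: "fourier_coeff f (- n) = cnj (fourier_coeff f n)"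
proof -
  have "(LBINT x:{-pi..pi}. f x *\<^sub>R cis (- (of_int (- n) * x))) =
      (LINT x|lborel. cnj (indicator {-pi..pi} x *\<^sub>R f x *\<^sub>R cis (- (of_int n * x))))"
    by (simp add: set_lebesgue_integral_def cis_cnj)
  also have "\<dots> = cnj (LBINT x:{-pi..pi}. f x *\<^sub>R cis (- (of_int n * x)))"
    unfolding set_lebesgue_integral_def by (rule Bochner_Integration.integral_cnj)
  finally have "(LBINT x:{-pi..pi}. f x *\<^sub>R cis (- (of_int (- n) * x))) =
      cnj (LBINT x:{-pi..pi}. f x *\<^sub>R cis (- (of_int n * x)))" .
  then show ?thesis by (simp add: fourier_coeff_def)
qed

lemma cis_measurable [measurable]: "(\<lambda>x::real. cis (a * x)) \<in> borel_measurable borel"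
  by (intro borel_measurable_continuous_onI continuous_intros)

lemma set_integrable_scaleR_cis:
  assumes "set_integrable lborel S f"
  shows "set_integrable lborel S (\<lambda>x. f x *\<^sub>R cis (a * x))"
proof -
  have "set_integrable lborel S (\<lambda>x. complex_of_real (f x))"
    using assms by (simp add: set_integrable_def scaleR_conv_of_real flip: of_real_mult)
  then have "set_integrable lborel S (\<lambda>x. complex_of_real (f x) * cis (a * x))"
    by (rule set_integrable_mult_bounded[where B = 1]) auto
  then show ?thesis by (simp add: scaleR_conv_of_real)
qed

text \<open>The complex amplitude \<open>c\<close> handles cosine and sine integrals at
  once.\<close>

lemma fourier_pairing:
  assumes "set_integrable lborel {-pi..pi} f"
  shows "(LBINT x:{-pi..pi}. f x * Re (c * cis (of_int n * x))) = 2 * pi * Re (c * fourier_coeff f (- n))"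
proof -
  have "(LBINT x:{-pi..pi}. f x * Re (c * cis (of_int n * x)))
      = (LBINT x:{-pi..pi}. Re (c * (f x *\<^sub>R cis (of_int n * x))))"
    by (simp add: algebra_simps)
  also have "\<dots> = Re (c * (LBINT x:{-pi..pi}. f x *\<^sub>R cis (of_int n * x)))"
  proof -
    have "set_integrable lborel {-pi..pi} (\<lambda>x. c * (f x *\<^sub>R cis (of_int n * x)))"
      by (intro set_integrable_mult_right set_integrable_scaleR_cis assms)
    then have "Re (LBINT x:{-pi..pi}. c * (f x *\<^sub>R cis (of_int n * x))) = (LBINT x:{-pi..pi}. Re (c * (f x *\<^sub>R cis (of_int n * x))))"
      unfolding set_lebesgue_integral_def set_integrable_def
      by (subst integral_Re[symmetric]) (auto simp: scaleR_conv_of_real)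
    then show ?thesis by (simp only: set_integral_mult_right)
  qed
  also have "\<dots> = 2 * pi * Re (c * fourier_coeff f (- n))"
    by (simp add: fourier_coeff_def)
  finally show ?thesis .
qed

text \<open>Waves with complex amplitude are real-valued and closed under products up to sums, so
  the class contains every real polynomial restricted to the circle.\<close>

inductive trig_poly :: "(real \<Rightarrow> real) \<Rightarrow> bool" where
  cis: "trig_poly (\<lambda>x. Re (c * cis (of_int n * x)))"
| add: "trig_poly p \<Longrightarrow> trig_poly q \<Longrightarrow> trig_poly (\<lambda>x. p x + q x)"

lemma trig_poly_mult_cis:
  assumes "trig_poly q"
  shows "trig_poly (\<lambda>x. Re (c * cis (of_int n * x)) * q x)"
  using assms
proof (induction rule: trig_poly.induct)
  case (cis d m)
  have "Re (c * cis (of_int n * x)) * Re (d * cis (of_int m * x)) =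
      Re (c * d / 2 * cis (of_int (n + m) * x)) + Re (c * cnj d / 2 * cis (of_int (n - m) * x))" for x
  proof -
    have "Re u * Re v = Re (u * v / 2) + Re (u * cnj v / 2)" for u v :: complex
      by (simp add: field_simps)
    moreover have "c * cis (of_int n * x) * (d * cis (of_int m * x)) = c * d * cis (of_int (n + m) * x)"
    proof -
      have "cis (of_int (n + m) * x) = cis (of_int n * x) * cis (of_int m * x)"
        by (simp add: distrib_right cis_mult)
      then show ?thesis by (simp only: mult_ac)
    qed
    moreover have "c * cis (of_int n * x) * cnj (d * cis (of_int m * x)) = c * cnj d * cis (of_int (n - m) * x)"
    proof -
      have "cis (of_int (n - m) * x) = cis (of_int n * x) * cis (- (of_int m * x))"
        by (simp add: left_diff_distrib cis_mult)
      then show ?thesis by (simp only: complex_cnj_mult cis_cnj mult_ac)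
    qed
    ultimately show ?thesis by (metis times_divide_eq_left)
  qed
  then have eq: "(\<lambda>x. Re (c * cis (of_int n * x)) * Re (d * cis (of_int m * x))) =
      (\<lambda>x. Re (c * d / 2 * cis (of_int (n + m) * x)) + Re (c * cnj d / 2 * cis (of_int (n - m) * x)))"
    by (rule ext)
  show ?case unfolding eq by (intro trig_poly.intros)
next
  case (add p q)
  then show ?case by (simp only: distrib_left trig_poly.add)
qed

lemma trig_poly_mult:
  assumes "trig_poly p" "trig_poly q"
  shows "trig_poly (\<lambda>x. p x * q x)"
  using assms(1)
proof (induction rule: trig_poly.induct)
  case (cis c n)
  show ?case by (rule trig_poly_mult_cis[OF assms(2)])
next
  case (add p q)
  then show ?case by (simp only: distrib_right trig_poly.add)
qed

text \<open>On the circle a linear functional reads f(1) cos x + f(i) sin x, a wave of frequency 1.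
  This is what lets Stone-Weierstrass for polynomials serve as density of trigonometric
  polynomials.\<close>

lemma trig_poly_polynomial:
  assumes "real_polynomial_function g"
  shows "trig_poly (\<lambda>x. g (cis x))"
  using assms
proof (induction rule: real_polynomial_function.induct)
  case (linear f)
  then interpret bounded_linear f .
  have "f (cis x) = Re (Complex (f 1) (- f \<i>) * cis (of_int 1 * x))" for x
  proof -
    have "cis x = cos x *\<^sub>R 1 + sin x *\<^sub>R \<i>" by (simp add: complex_eq_iff)
    then have "f (cis x) = cos x * f 1 + sin x * f \<i>" by (simp only: add scaleR real_scaleR_def)
    then show ?thesis by simp
  qed
  then show ?case by (simp only: trig_poly.cis)
next
  case (const c)
  have "c = Re (of_real c * cis (of_int 0 * x))" for x by simp
  then show ?case by (metis (no_types, lifting) trig_poly.cis ext)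
qed (auto intro: trig_poly.add trig_poly_mult)

lemma trig_poly_bounded_measurable:
  assumes "trig_poly p"
  shows "p \<in> borel_measurable borel" "\<exists>B. \<forall>x. \<bar>p x\<bar> \<le> B"
  using assms
proof (induction rule: trig_poly.induct)
  case (cis c n)
  { case 1 show ?case by (intro borel_measurable_continuous_onI continuous_intros) next
    case 2 show ?case using abs_Re_le_cmod[of "c * cis _"] by (auto simp: norm_mult intro!: exI[of _ "cmod c"]) }
next
  case (add p q)
  { case 1 show ?case using add by measurable next
    case 2 show ?case using add.IH(2,4) by (meson abs_triangle_ineq add_mono order_trans) }
qed

lemma trig_poly_integral_0:
  assumes f: "set_integrable lborel {-pi..pi} f" "\<And>n. fourier_coeff f n = 0" and "trig_poly p"
  shows "(LBINT x:{-pi..pi}. f x * p x) = 0"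
  using assms(3)
proof (induction rule: trig_poly.induct)
  case (cis c n)
  then show ?case using fourier_pairing[OF f(1)] f(2) by simp
next
  case (add p q)
  have "set_integrable lborel {-pi..pi} (\<lambda>x. f x * r x)" if "trig_poly r" for r
    using trig_poly_bounded_measurable[OF that] set_integrable_mult_bounded[OF f(1), of r] by auto
  with add show ?case by (simp add: distrib_left set_integral_add)
qed

text \<open>Test functions of the form \<open>G (cis x)\<close> are periodic by construction.
  Uniform approximation within e on the compact unit circle changes the integral by at most e times
  the L^1 norm of \<open>f\<close>.\<close>

lemma circle_continuous_integral_0:
  fixes G :: "complex \<Rightarrow> real"
  assumes f: "set_integrable lborel {-pi..pi} f" "\<And>n. fourier_coeff f n = 0"
    and G: "continuous_on UNIV G"
  shows "(LBINT x:{-pi..pi}. f x * G (cis x)) = 0"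
proof -
  define I where "I = (LBINT x:{-pi..pi}. \<bar>f x\<bar>)"
  have fabs: "set_integrable lborel {-pi..pi} (\<lambda>x. \<bar>f x\<bar>)" using f(1) by (rule set_integrable_abs)
  have I0: "I \<ge> 0" unfolding I_def set_lebesgue_integral_def by (intro integral_nonneg_AE) auto
  have Gm: "(\<lambda>x. G (cis x)) \<in> borel_measurable borel"
    by (intro borel_measurable_continuous_onI continuous_on_compose2[OF G] continuous_intros) auto
  obtain BG where BG: "\<And>x. \<bar>G (cis x)\<bar> \<le> BG"
  proof -
    have "bounded (G ` sphere 0 1)"
      by (intro compact_imp_bounded compact_continuous_image continuous_on_subset[OF G]) auto
    then obtain b where "\<forall>z\<in>sphere 0 1. norm (G z) \<le> b" by (auto simp: bounded_iff)
    then show ?thesis by (intro that[of b]) auto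
  qed
  have le: "\<bar>LBINT x:{-pi..pi}. f x * G (cis x)\<bar> \<le> e * I" if e: "e > 0" for e
  proof -
    obtain g where g: "real_polynomial_function g" "\<And>z. z \<in> sphere 0 1 \<Longrightarrow> \<bar>G z - g z\<bar> < e"
      using Stone_Weierstrass_real_polynomial_function[of "sphere 0 1" G e] e continuous_on_subset[OF G] by auto
    have p: "trig_poly (\<lambda>x. g (cis x))" by (rule trig_poly_polynomial[OF g(1)])
    have i1: "set_integrable lborel {-pi..pi} (\<lambda>x. f x * G (cis x))"
      using set_integrable_mult_bounded[OF f(1)] Gm BG by auto
    have i2: "set_integrable lborel {-pi..pi} (\<lambda>x. f x * g (cis x))"
      using trig_poly_bounded_measurable[OF p] set_integrable_mult_bounded[OF f(1), of "\<lambda>x. g (cis x)"] by auto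
    have "(LBINT x:{-pi..pi}. f x * G (cis x)) = (LBINT x:{-pi..pi}. f x * G (cis x)) - (LBINT x:{-pi..pi}. f x * g (cis x))"
      using trig_poly_integral_0[OF f p] by simp
    also have "\<dots> = (LBINT x:{-pi..pi}. f x * G (cis x) - f x * g (cis x))"
      using i1 i2 by (rule set_integral_diff(2)[symmetric])
    finally have eq: "(LBINT x:{-pi..pi}. f x * G (cis x)) = \<dots>" .
    have "\<bar>LBINT x:{-pi..pi}. f x * G (cis x) - f x * g (cis x)\<bar> \<le> (LBINT x:{-pi..pi}. e * \<bar>f x\<bar>)"
      unfolding set_lebesgue_integral_def real_norm_def[symmetric]
    proof (rule Bochner_Integration.integral_norm_bound_integral)
      show "integrable lborel (\<lambda>x. indicat_real {- pi..pi} x *\<^sub>R (f x * G (cis x) - f x * g (cis x)))"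
        using set_integral_diff(1)[OF i1 i2] by (simp add: set_integrable_def)
      show "integrable lborel (\<lambda>x. indicat_real {- pi..pi} x *\<^sub>R (e * norm (f x)))"
        using set_integrable_mult_right[OF fabs, of e] by (simp add: set_integrable_def)
      show "norm (indicat_real {- pi..pi} x *\<^sub>R (f x * G (cis x) - f x * g (cis x))) \<le> indicat_real {- pi..pi} x *\<^sub>R (e * norm (f x))" for x
        using g(2)[of "cis x"] mult_right_mono[of "\<bar>G (cis x) - g (cis x)\<bar>" e "\<bar>f x\<bar>"]
        by (auto simp: indicator_def abs_mult[symmetric] algebra_simps)
    qed
    also have "\<dots> = e * I" by (simp add: I_def)
    finally show ?thesis using eq by simp
  qed
  have "\<bar>LBINT x:{-pi..pi}. f x * G (cis x)\<bar> \<le> 0 + e" if "e > 0" for e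
  proof -
    have "\<bar>LBINT x:{-pi..pi}. f x * G (cis x)\<bar> \<le> e / (I + 1) * I"
      using le[of "e / (I + 1)"] that I0 by auto
    also have "\<dots> \<le> e" using that I0 by (simp add: field_simps)
    finally show ?thesis by simp
  qed
  then have "\<bar>LBINT x:{-pi..pi}. f x * G (cis x)\<bar> \<le> 0" by (rule field_le_epsilon)
  then show ?thesis by simp
qed


section \<open>From continuous functions on the circle to vanishing almost everywhere\<close>

lemma cis_eq_imp_eq:
  assumes "cis x = cis y" "\<bar>x - y\<bar> < 2 * pi"
  shows "x = y"
proof -
  have "sin x = sin y \<and> cos x = cos y" using assms(1) by (simp add: complex_eq_iff)
  then obtain n :: int where n: "x = y + 2 * pi * of_int n" using sin_cos_eq_iff by auto
  then have "2 * pi * \<bar>of_int n\<bar> < 2 * pi * 1" using assms(2) by (simp add: abs_mult)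
  then have "\<bar>of_int n :: real\<bar> < 1" using pi_gt_zero by (subst (asm) mult_less_cancel_left_pos) auto
  then have "n = 0" by linarith
  then show ?thesis using n by simp
qed

text \<open>Zero integrals spread from continuous functions on the circle to closed sets, whose
  indicators are decreasing limits of distance cutoffs, and from these to all Borel sets, since
  closed sets form an intersection-stable generator. A density with zero integral over every Borel
  set vanishes almost everywhere. Integrability of \<open>f\<close> is all that this takes.\<close>

lemma fourier_coeff_unique:
  assumes f: "set_integrable lborel {-pi..pi} f" "\<And>n. fourier_coeff f n = 0"
  shows "AE x in lborel. x \<in> {-pi..pi} \<longrightarrow> f x = 0"
proof -
  define h where "h x = indicator {-pi..pi} x *\<^sub>R f x" for x
  have hi: "integrable lborel h" using f(1) by (simp add: h_def[abs_def] set_integrable_def)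
  have h_on: "set_integrable lborel A h" if "A \<in> sets borel" for A
    using integrable_mult_indicator[OF _ hi, of A] that by (simp add: set_integrable_def)
  have closed0: "(LBINT x:K. h x) = 0" if K: "closed K" for K
  proof -
    define C where "C = cis ` (K \<inter> {-pi..pi})"
    have C: "closed C"
      unfolding C_def using K
      by (intro compact_imp_closed compact_continuous_image continuous_intros closed_Int_compact[OF K]) auto
    show ?thesis
    \<comment> \<open>\<open>infdist\<close> to the empty set is 0 by convention, so the distance
      cutoffs would be constantly 1 instead of tending to 0.\<close>
    proof (cases "C = {}")
      case True
      then have "(\<lambda>x. indicator K x *\<^sub>R h x) = (\<lambda>x. 0)" by (intro ext) (auto simp: C_def h_def indicator_def)
      then show ?thesis by (simp only: set_lebesgue_integral_def integral_zero)
    next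
      case False
      define G where "G n z = max 0 (1 - real n * infdist z C)" for n z
      have Gc: "continuous_on UNIV (G n)" for n
        unfolding G_def by (intro continuous_intros)
      have G01: "0 \<le> G n z" "G n z \<le> 1" for n z by (auto simp: G_def infdist_nonneg)
      have Glim: "(\<lambda>n. G n z) \<longlonglongrightarrow> indicator C z" for z
      proof (cases "z \<in> C")
        case True
        then show ?thesis by (simp add: G_def)
      next
        case z: False
        then have pos: "infdist z C > 0" using C False in_closed_iff_infdist_zero[of C z] infdist_nonneg[of z C] by fastforce
        obtain N where N: "1 < real N * infdist z C" using reals_Archimedean3[OF pos] by auto
        have "G n z = 0" if "n \<ge> N" for n
        proof -
          have "real N * infdist z C \<le> real n * infdist z C" using that pos by (intro mult_right_mono) auto
          then show ?thesis using N by (simp add: G_def)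
        qed
        then show ?thesis using z by (intro tendsto_eventually) (auto simp: eventually_sequentially)
      qed
      have "(\<lambda>n. LINT x|lborel. h x * G n (cis x)) \<longlonglongrightarrow> (LINT x|lborel. indicator K x *\<^sub>R h x)"
      proof (rule integral_dominated_convergence)
        show "integrable lborel (\<lambda>x. norm (h x))" using hi by simp
        show "(\<lambda>x. indicator K x *\<^sub>R h x) \<in> borel_measurable lborel"
          using hi K by (intro borel_measurable_scaleR borel_measurable_indicator) auto
        show "(\<lambda>x. h x * G n (cis x)) \<in> borel_measurable lborel" for n
        proof -
          have "(\<lambda>x. G n (cis x)) \<in> borel_measurable borel"
            by (intro borel_measurable_continuous_onI continuous_on_compose2[OF Gc] continuous_intros) auto
          then show ?thesis using hi by (intro borel_measurable_times) auto
        qed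
        \<comment> \<open>The points -pi and pi have the same image on the circle, so one may lie in
          \<open>K\<close> without the other. Without these two points \<open>cis\<close> is
          injective.\<close>
        show "AE x in lborel. (\<lambda>n. h x * G n (cis x)) \<longlonglongrightarrow> indicator K x *\<^sub>R h x"
          using AE_lborel_singleton[of "-pi"] AE_lborel_singleton[of pi]
        proof eventually_elim
          case (elim x)
          have "h x * indicator C (cis x) = indicator K x *\<^sub>R h x"
          proof (cases "x \<in> {-pi<..<pi}")
            case True
            have "x \<in> K" if xC: "cis x \<in> C"
            proof -
              obtain y where y: "y \<in> K" "y \<in> {-pi..pi}" "cis x = cis y" using xC by (auto simp: C_def)
              then have "x = y" using True by (intro cis_eq_imp_eq) auto
              then show ?thesis using y by simp
            qed
            moreover have "cis x \<in> C" if "x \<in> K" using that True by (auto simp: C_def)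
            ultimately show ?thesis by (auto simp: indicator_def)
          next
            case False
            then show ?thesis using elim by (auto simp: h_def indicator_def)
          qed
          then show ?case using tendsto_mult[OF tendsto_const Glim[of "cis x"], of "h x"] by (simp only:)
        qed
        show "AE x in lborel. norm (h x * G n (cis x)) \<le> norm (h x)" for n
          using G01 by (intro AE_I2) (simp add: abs_mult mult_left_le)
      qed
      moreover have "(LINT x|lborel. h x * G n (cis x)) = 0" for n
        using circle_continuous_integral_0[OF f Gc] by (simp add: h_def set_lebesgue_integral_def mult.assoc)
      ultimately show ?thesis by (simp add: set_lebesgue_integral_def LIMSEQ_const_iff)
    qed
  qed
  have all0: "(LBINT x:A. h x) = 0" if "A \<in> sets borel" for A
  proof -
    have A: "A \<in> sigma_sets UNIV (Collect closed)" using that by (simp add: borel_eq_closed)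
    have meas: "sigma_sets UNIV (Collect closed) = sets (borel :: real measure)" by (simp add: borel_eq_closed)
    have "Int_stable (Collect (closed :: real set \<Rightarrow> bool))" by (auto simp: Int_stable_def)
    moreover have "Collect (closed :: real set \<Rightarrow> bool) \<subseteq> Pow UNIV" by simp
    ultimately show ?thesis
      using A
    proof (induction rule: sigma_sets_induct_disjoint)
      case (basic A)
      then show ?case using closed0 by simp
    next
      case (compl A)
      have Ab: "A \<in> sets borel" using compl(1) meas by simp
      have "(LBINT x:(UNIV - A) \<union> A. h x) = (LBINT x:UNIV - A. h x) + (LBINT x:A. h x)"
        using Ab by (intro set_integral_Un h_on) auto
      then show ?case using closed0[of UNIV] compl(2) by simp
    next
      case (union A)
      have Ab: "range A \<subseteq> sets borel" using union(2) meas by simp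
      have "(LBINT x:(\<Union>i. A i). h x) = (\<Sum>i. LBINT x:A i. h x)"
        using Ab union(1) by (intro lebesgue_integral_countable_add h_on) (auto simp: disjoint_family_on_def)
      then show ?case using union(3) by simp
    qed (auto simp: set_lebesgue_integral_def)
  qed
  have "AE x in lborel. h x = 0"
    by (rule sigma_finite_measure.density_zero[OF sigma_finite_lborel hi]) (use all0 in simp)
  then show ?thesis by eventually_elim (auto simp: h_def)
qed

section \<open>Absolutely convergent trigonometric series\<close>

lemma integral_cis:
  "(LBINT x:{-pi..pi}. cis (of_int m * x)) = (if m = 0 then of_real (2 * pi) else 0)"
proof (cases "m = 0")
  case False
  have "((\<lambda>x. cis (of_int m * x)) has_integral
      (cis (of_int m * pi) / (\<i> * of_int m) - cis (of_int m * (- pi)) / (\<i> * of_int m))) {-pi..pi}"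
  proof (rule fundamental_theorem_of_calculus)
    fix x
    show "((\<lambda>x. cis (of_int m * x) / (\<i> * of_int m)) has_vector_derivative cis (of_int m * x)) (at x within {-pi..pi})"
      unfolding has_vector_derivative_def
      by (rule has_derivative_eq_rhs, (rule derivative_intros)+)
         (use False in \<open>auto simp: fun_eq_iff scaleR_conv_of_real field_simps\<close>)
  qed simp
  moreover have "cis (of_int m * pi) = cis (of_int m * (- pi))"
    by (simp add: complex_eq_iff)
       (metis mult.commute sin_npi_int neg_equal_zero)
  moreover have "set_integrable lborel {-pi..pi} (\<lambda>x. cis (of_int m * x))"
    by (intro borel_integrable_atLeastAtMost' continuous_intros)
  ultimately show ?thesis
    using False by (simp add: set_borel_integral_eq_integral integral_unique)
next
  case True
  have "(LBINT x:{-pi..pi}. (1::complex)) = of_real (2 * pi)"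
    by (subst set_integral_const) (auto simp: scaleR_conv_of_real)
  then show ?thesis using True by simp
qed

text \<open>A real Fourier series: for k > 0, \<open>c k\<close> = a_k - i b_k stands for a_k cos kx
  + b_k sin kx.\<close>

definition tser :: "(nat \<Rightarrow> complex) \<Rightarrow> real \<Rightarrow> real" where
  "tser c x = (\<Sum>k. Re (c k * cis (real k * x)))"

lemma tser_term_le: "\<bar>Re (c * cis a)\<bar> \<le> cmod c"
  using abs_Re_le_cmod[of "c * cis a"] by (simp add: norm_mult)

lemma tser_summable:
  assumes "summable (\<lambda>k. cmod (c k))"
  shows "summable (\<lambda>k. Re (c k * cis (real k * x)))"
  by (rule summable_comparison_test'[OF assms]) (use tser_term_le in auto)

lemma tser_bound:
  assumes "summable (\<lambda>k. cmod (c k))"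
  shows "\<bar>tser c x\<bar> \<le> (\<Sum>k. cmod (c k))"
proof -
  have "\<bar>tser c x\<bar> \<le> (\<Sum>k. \<bar>Re (c k * cis (real k * x))\<bar>)"
    unfolding tser_def
    by (rule summable_rabs, rule summable_comparison_test'[OF assms]) (simp only: real_norm_def abs_idempotent tser_term_le)
  also have "\<dots> \<le> (\<Sum>k. cmod (c k))"
    by (intro suminf_le assms tser_term_le summable_comparison_test'[OF assms]) (simp only: real_norm_def abs_idempotent tser_term_le)
  finally show ?thesis .
qed

lemma tser_uniform_limit:
  assumes "summable (\<lambda>k. cmod (c k))"
  shows "uniform_limit UNIV (\<lambda>N x. \<Sum>k<N. Re (c k * cis (real k * x))) (tser c) sequentially"
  unfolding tser_def[abs_def]
  by (rule Weierstrass_m_test[OF _ assms]) (simp only: real_norm_def tser_term_le)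

lemma tser_continuous:
  assumes "summable (\<lambda>k. cmod (c k))"
  shows "continuous_on UNIV (tser c)"
  by (rule uniform_limit_theorem[OF _ tser_uniform_limit[OF assms]])
     (auto intro!: always_eventually continuous_intros)

lemma tser_measurable:
  assumes "summable (\<lambda>k. cmod (c k))"
  shows "tser c \<in> borel_measurable borel"
  by (intro borel_measurable_continuous_onI tser_continuous assms)

lemma tser_set_integrable:
  assumes "summable (\<lambda>k. cmod (c k))"
  shows "set_integrable lborel {a..b} (tser c)"
  by (intro borel_integrable_atLeastAtMost' continuous_on_subset[OF tser_continuous[OF assms]]) auto

lemma cis_periodic: "cis (of_int n * (x + 2 * pi)) = cis (of_int n * x)"
proof -
  have "cis (of_int n * (x + 2 * pi)) = cis (of_int n * x) * cis (2 * pi * of_int n)"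
    by (simp add: cis_mult algebra_simps)
  then show ?thesis by (simp del: cis_mult)
qed

lemma tser_periodic: "tser c (x + 2 * pi) = tser c x"
  unfolding tser_def using cis_periodic[of "int _" x] by (simp only: of_int_of_nat_eq)

text \<open>A real wave of frequency n > 0 splits evenly between n and -n, whereas a constant stays
  whole; hence the separate case 0.\<close>

lemma fourier_coeff_tser:
  assumes c: "summable (\<lambda>k. cmod (c k))" and c0: "Im (c 0) = 0"
  shows "fourier_coeff (tser c) (int n) = (if n = 0 then c 0 else c n / 2)"
proof -
  let ?f = "\<lambda>x. cis (- (of_int (int n) * x))"
  have fi: "set_integrable lborel {-pi..pi} ?f"
    by (intro borel_integrable_atLeastAtMost' continuous_intros)
  have "(\<lambda>k. LBINT x:{-pi..pi}. ?f x * of_real (Re (c k * cis (real k * x)))) sums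
      (LBINT x:{-pi..pi}. ?f x * (\<Sum>k. of_real (Re (c k * cis (real k * x)))))"
  proof (rule set_integral_mult_suminf[OF fi _ _ c])
    show "(\<lambda>x. complex_of_real (Re (c k * cis (real k * x)))) \<in> borel_measurable lborel" for k
    proof -
      have "(\<lambda>x. complex_of_real (Re (c k * cis (real k * x)))) \<in> borel_measurable borel"
        by (intro borel_measurable_continuous_onI continuous_intros)
      then show ?thesis by simp
    qed
    show "cmod (complex_of_real (Re (c k * cis (real k * x)))) \<le> cmod (c k)" for k x
      by (simp only: norm_of_real tser_term_le)
  qed
  moreover have "?f x * (\<Sum>k. of_real (Re (c k * cis (real k * x)))) = tser c x *\<^sub>R ?f x" for x
    unfolding tser_def
    by (subst suminf_of_real[OF tser_summable[OF c], symmetric]) (simp only: scaleR_conv_of_real mult.commute)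
  moreover have "(LBINT x:{-pi..pi}. ?f x * of_real (Re (c k * cis (real k * x)))) =
      (if k = n then (if n = 0 then of_real (2 * pi) * c 0 else of_real pi * c n) else 0)" for k
  proof -
    have "?f x * of_real (Re (c k * cis (real k * x))) =
        c k / 2 * cis (of_int (int k - int n) * x) + cnj (c k) / 2 * cis (of_int (- int k - int n) * x)" for x
    proof -
      have "complex_of_real (Re u) = (u + cnj u) / 2" for u :: complex by (simp add: complex_eq_iff)
      then have "?f x * of_real (Re (c k * cis (real k * x))) =
        c k / 2 * (cis (real k * x) * ?f x) + cnj (c k) / 2 * (cis (- (real k * x)) * ?f x)"
        by (simp only: complex_cnj_mult cis_cnj add_divide_distrib distrib_left mult_ac times_divide_eq_left times_divide_eq_right)
      then show ?thesis by (simp add: cis_mult algebra_simps)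
    qed
    then have "(LBINT x:{-pi..pi}. ?f x * of_real (Re (c k * cis (real k * x)))) =
      (LBINT x:{-pi..pi}. c k / 2 * cis (of_int (int k - int n) * x)) + (LBINT x:{-pi..pi}. cnj (c k) / 2 * cis (of_int (- int k - int n) * x))"
      by (simp only:) (intro set_integral_add borel_integrable_atLeastAtMost' continuous_intros)
    also have "\<dots> = c k / 2 * (if int k - int n = 0 then of_real (2 * pi) else 0) + cnj (c k) / 2 * (if - int k - int n = 0 then of_real (2 * pi) else 0)"
      by (simp only: set_integral_mult_right integral_cis)
    also have "\<dots> = (if k = n then (if n = 0 then of_real (2 * pi) * c 0 else of_real pi * c n) else 0)"
      using c0 by (auto simp: complex_eq_iff)
    finally show ?thesis .
  qed
  ultimately have "(\<lambda>k. if k = n then (if n = 0 then of_real (2 * pi) * c 0 else of_real pi * c n) else 0) sums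
      (LBINT x:{-pi..pi}. tser c x *\<^sub>R ?f x)" by simp
  then have "(LBINT x:{-pi..pi}. tser c x *\<^sub>R ?f x) = (if n = 0 then of_real (2 * pi) * c 0 else of_real pi * c n)"
    using sums_single[of n "\<lambda>k. if n = 0 then of_real (2 * pi) * c 0 else of_real pi * c n"] sums_unique2 by blast
  then show ?thesis by (simp add: fourier_coeff_def scaleR_conv_of_real)
qed

text \<open>Doubling every coefficient except the mean makes this the inverse of
  \<open>tser\<close>.\<close>

definition fhat :: "(real \<Rightarrow> real) \<Rightarrow> nat \<Rightarrow> complex" where
  "fhat f k = (if k = 0 then 1 else 2) * fourier_coeff f (int k)"

lemma Im_fhat_0: "Im (fhat f 0) = 0"
  using fourier_coeff_uminus[of f 0] by (simp add: fhat_def complex_eq_iff)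

lemma fhat_tser:
  assumes "summable (\<lambda>k. cmod (c k))" "Im (c 0) = 0"
  shows "fhat (tser c) = c"
  using fourier_coeff_tser[OF assms, of 0] by (auto simp: fhat_def fourier_coeff_tser[OF assms] fun_eq_iff)

lemma fourier_coeff_eq_fhat:
  "fourier_coeff f n = (if n = 0 then fhat f 0 else if n > 0 then fhat f (nat n) / 2 else cnj (fhat f (nat (- n))) / 2)"
  using fourier_coeff_uminus[of f "- n"] by (auto simp: fhat_def)

lemma fourier_coeff_diff:
  assumes "set_integrable lborel {-pi..pi} f" "set_integrable lborel {-pi..pi} g"
  shows "fourier_coeff (\<lambda>x. f x - g x) n = fourier_coeff f n - fourier_coeff g n"
  using set_integral_diff(2)[OF set_integrable_scaleR_cis[OF assms(1), of "- of_int n"] set_integrable_scaleR_cis[OF assms(2), of "- of_int n"]]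
  by (simp add: fourier_coeff_def scaleR_diff_left scaleR_diff_right)

text \<open>The null set exceptional in one period is translated by all multiples of 2 pi; a
  countable union of null sets is null.\<close>

lemma AE_periodic:
  fixes P :: "real \<Rightarrow> bool"
  assumes ae: "AE x in lborel. x \<in> {-pi..pi} \<longrightarrow> P x"
    and per: "\<And>x. P (x + 2 * pi) = P x"
  shows "AE x in lborel. P x"
proof -
  have per': "P (x + 2 * pi * of_int n) = P x" for x n
  proof (induction n rule: int_induct[of _ 0])
    case (step1 i)
    then show ?case using per[of "x + 2 * pi * of_int i"] by (simp add: algebra_simps)
  next
    case (step2 i)
    then show ?case using per[of "x + 2 * pi * of_int (i - 1)"] by (simp add: algebra_simps)
  qed simp
  have "AE x in lborel. 2 * pi * of_int n + x \<in> {-pi..pi} \<longrightarrow> P (2 * pi * of_int n + x)" for n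
  proof -
    obtain N where N: "{x. \<not> (x \<in> {-pi..pi} \<longrightarrow> P x)} \<subseteq> N" "N \<in> null_sets lborel"
      using ae by (auto simp: eventually_ae_filter)
    have "(\<lambda>x. 2 * pi * of_int n + x) -` N \<in> null_sets lborel"
    proof -
      have "N \<in> null_sets (distr lborel borel ((+) (2 * pi * of_int n)))"
        using N(2) by (simp add: lborel_distr_plus)
      then show ?thesis by (subst (asm) null_sets_distr_iff) auto
    qed
    then show ?thesis using N(1) by (intro AE_I') auto
  qed
  then have "AE x in lborel. \<forall>n::int. 2 * pi * of_int n + x \<in> {-pi..pi} \<longrightarrow> P (2 * pi * of_int n + x)"
    by (subst AE_all_countable) auto
  then show ?thesis
  proof eventually_elim
    case (elim x)
    define n where "n = \<lfloor>(pi - x) / (2 * pi)\<rfloor>"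
    have "of_int n \<le> (pi - x) / (2 * pi)" "(pi - x) / (2 * pi) < of_int n + 1"
      unfolding n_def by linarith+
    then have "2 * pi * of_int n + x \<in> {-pi..pi}"
      using pi_gt_zero by (auto simp: field_simps)
    then show ?case using elim per'[of x n] by (simp add: add.commute)
  qed
qed

text \<open>Uniqueness applied to \<open>f\<close> minus its own series, all of whose coefficients
  vanish. Periodicity then carries the equality beyond one period.\<close>

lemma AE_eq_tser:
  assumes f: "set_integrable lborel {-pi..pi} f" and c: "summable (\<lambda>k. cmod (fhat f k))"
    and per: "\<And>x. f (x + 2 * pi) = f x"
  shows "AE x in lborel. f x = tser (fhat f) x"
proof (rule AE_periodic)
  have "fhat (\<lambda>x. f x - tser (fhat f) x) k = 0" for k
  proof -
    have "fourier_coeff (\<lambda>x. f x - tser (fhat f) x) n = fourier_coeff f n - fourier_coeff (tser (fhat f)) n" for n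
      by (intro fourier_coeff_diff f tser_set_integrable c)
    then have "fhat (\<lambda>x. f x - tser (fhat f) x) k = fhat f k - fhat (tser (fhat f)) k"
      by (simp add: fhat_def)
    then show ?thesis
      using fhat_tser[OF c Im_fhat_0] by simp
  qed
  then have "AE x in lborel. x \<in> {-pi..pi} \<longrightarrow> f x - tser (fhat f) x = 0"
    by (intro fourier_coeff_unique set_integral_diff f tser_set_integrable c)
       (simp add: fourier_coeff_eq_fhat)
  then show "AE x in lborel. x \<in> {-pi..pi} \<longrightarrow> f x = tser (fhat f) x" by simp
qed (simp add: per tser_periodic)

section \<open>Fourier characterisation of the Sobolev space\<close>

lemma sobolev_weight_ge: "real k ^ 3 \<le> (1 + (real_of_int (int k))\<^sup>2) powr (3/2)"
proof (cases "k = 0")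
  case False
  have "real k ^ 3 = ((real k)\<^sup>2) powr (3/2)"
    using False by (simp add: powr_powr flip: powr_numeral)
  also have "\<dots> \<le> (1 + (real k)\<^sup>2) powr (3/2)"
    by (intro powr_mono2) auto
  finally show ?thesis by simp
qed simp

text \<open>For nonzero n, 1 + n^2 \<le> 2 n^2 costs a factor 2^(3/2), rounded up to 4.\<close>

lemma sobolev_weight_le:
  assumes "n \<noteq> 0"
  shows "(1 + (real_of_int n)\<^sup>2) powr (3/2) \<le> 4 * real (nat \<bar>n\<bar>) ^ 3"
proof -
  define x where "x = real (nat \<bar>n\<bar>)"
  have x: "x \<ge> 1" "(real_of_int n)\<^sup>2 = x\<^sup>2" using assms by (auto simp: x_def)
  have "(1 + x\<^sup>2) powr (3/2) \<le> (2 * x\<^sup>2) powr (3/2)"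
    using x one_le_power[of x 2] by (intro powr_mono2) auto
  also have "\<dots> = 2 powr (3/2) * x ^ 3"
    using x by (simp add: powr_mult powr_powr flip: powr_numeral)
  also have "\<dots> \<le> 2 powr 2 * x ^ 3"
    using x by (intro mult_right_mono powr_mono) auto
  also have "\<dots> = 4 * x ^ 3" by simp
  finally show ?thesis unfolding x(2) x_def .
qed

lemma in_sobolev_set_integrable:
  assumes "in_sobolev s f"
  shows "set_integrable lborel {-pi..pi} f"
proof (rule set_integrable_bound)
  show "set_integrable lborel {-pi..pi} (\<lambda>x. 1 + (f x)\<^sup>2)"
    using assms unfolding in_sobolev_def
    by (intro set_integral_add(1)[OF borel_integrable_atLeastAtMost'[OF continuous_on_const]]) blast
  show "set_borel_measurable lborel {-pi..pi} f"
    using assms unfolding set_borel_measurable_def in_sobolev_def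
    by (intro borel_measurable_scaleR borel_measurable_indicator) auto
  have "\<bar>y\<bar> \<le> 1 + y\<^sup>2" for y :: real
    using zero_le_power2[of "\<bar>y\<bar> - 1"] by (simp add: power2_diff)
  then show "AE x in lborel. x \<in> {-pi..pi} \<longrightarrow> norm (f x) \<le> norm (1 + (f x)\<^sup>2)"
    by (intro AE_I2) (simp add: abs_of_nonneg)
qed

lemma in_sobolev_periodic: "in_sobolev s f \<Longrightarrow> f (x + 2 * pi) = f x"
  by (simp add: in_sobolev_def)

lemma fhat_weighted_sum_le:
  assumes "in_sobolev (3/2) f"
  shows "(\<Sum>k\<le>N. real k ^ 3 * (cmod (fhat f k))\<^sup>2) \<le> 4 * (sobolev_norm (3/2) f)\<^sup>2"
proof -
  let ?g = "\<lambda>n::int. (1 + (of_int n)\<^sup>2) powr (3/2) * (cmod (fourier_coeff f n))\<^sup>2"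
  have sm: "?g summable_on UNIV" using assms by (simp add: in_sobolev_def)
  have "(\<Sum>k\<le>N. real k ^ 3 * (cmod (fhat f k))\<^sup>2) \<le> (\<Sum>k\<le>N. 4 * ?g (int k))"
  proof (rule sum_mono)
    fix k
    have "real k ^ 3 * (cmod (fhat f k))\<^sup>2 \<le> (1 + (of_int (int k))\<^sup>2) powr (3/2) * (4 * (cmod (fourier_coeff f (int k)))\<^sup>2)"
      by (intro mult_mono sobolev_weight_ge) (auto simp: fhat_def norm_mult power_mult_distrib)
    then show "real k ^ 3 * (cmod (fhat f k))\<^sup>2 \<le> 4 * ?g (int k)" by simp
  qed
  also have "\<dots> = 4 * (\<Sum>n\<in>int ` {..N}. ?g n)"
    by (simp add: sum_distrib_left sum.reindex)
  also have "\<dots> \<le> 4 * (\<Sum>\<^sub>\<infinity>n. ?g n)"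
    by (intro mult_left_mono finite_sum_le_infsum sm) auto
  also have "\<dots> = 4 * (sobolev_norm (3/2) f)\<^sup>2"
    unfolding sobolev_norm_def by (subst real_sqrt_pow2) (auto intro: infsum_nonneg)
  finally show ?thesis .
qed

lemma fhat_weighted_summable:
  assumes "in_sobolev (3/2) f"
  shows "summable (\<lambda>k. real k ^ 3 * (cmod (fhat f k))\<^sup>2)"
  by (rule bounded_imp_summable[where B = "4 * (sobolev_norm (3/2) f)\<^sup>2"])
     (auto intro: fhat_weighted_sum_le[OF assms])

text \<open>AM-GM: \<open>2 * sqrt k * a \<le> k^3 * a^2 + 1 / k^2\<close>.\<close>

lemma weighted_imp_sqrt_summable:
  fixes a :: "nat \<Rightarrow> real"
  assumes "summable (\<lambda>k. real k ^ 3 * (a k)\<^sup>2)"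
  shows "summable (\<lambda>k. sqrt (real k) * \<bar>a k\<bar>)"
proof (rule summable_comparison_test')
  show "summable (\<lambda>k. real k ^ 3 * (a k)\<^sup>2 + inverse (real k ^ 2))"
    by (intro summable_add assms inverse_power_summable) simp
  show "norm (sqrt (real k) * \<bar>a k\<bar>) \<le> real k ^ 3 * (a k)\<^sup>2 + inverse (real k ^ 2)" for k
  proof (cases "k = 0")
    case False
    define x where "x = sqrt (real k)"
    have x: "x > 0" "real k = x ^ 2" using False by (auto simp: x_def)
    have "2 * (x * \<bar>a k\<bar>) = 2 * (x ^ 3 * \<bar>a k\<bar>) * inverse (x ^ 2)"
      using x by (simp add: field_simps power2_eq_square power3_eq_cube)
    also have "\<dots> \<le> (x ^ 3 * \<bar>a k\<bar>)\<^sup>2 + (inverse (x ^ 2))\<^sup>2" by (rule sum_squares_bound)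
    also have "\<dots> = real k ^ 3 * (a k)\<^sup>2 + inverse (real k ^ 2)"
      unfolding x by (simp add: power_mult_distrib power_inverse flip: power_mult)
    finally have "2 * (x * \<bar>a k\<bar>) \<le> real k ^ 3 * (a k)\<^sup>2 + inverse (real k ^ 2)" .
    moreover have "0 \<le> x * \<bar>a k\<bar>" using x by simp
    ultimately show ?thesis unfolding x_def[symmetric] by simp
  qed simp
qed

lemma weighted_imp_summable:
  fixes a :: "nat \<Rightarrow> real"
  assumes "summable (\<lambda>k. real k ^ 3 * (a k)\<^sup>2)"
  shows "summable (\<lambda>k. \<bar>a k\<bar>)"
proof (rule summable_comparison_test)
  show "\<exists>N. \<forall>k\<ge>N. norm \<bar>a k\<bar> \<le> sqrt (real k) * \<bar>a k\<bar>"
    by (intro exI[of _ 1]) (auto simp: mult_le_cancel_right1)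
qed (rule weighted_imp_sqrt_summable[OF assms])

lemma fhat_summable:
  assumes "in_sobolev (3/2) f"
  shows "summable (\<lambda>k. cmod (fhat f k))"
  using weighted_imp_summable[OF fhat_weighted_summable[OF assms]] by simp

lemma in_sobolev_AE_eq_tser:
  assumes "in_sobolev (3/2) f"
  shows "AE x in lborel. f x = tser (fhat f) x"
  by (intro AE_eq_tser in_sobolev_set_integrable[OF assms] fhat_summable assms in_sobolev_periodic[OF assms])

text \<open>Coefficients n and -n both have modulus |c_n|/2. The quarter from squaring cancels the 4
  of \<open>sobolev_weight_le\<close>, so each half-line contributes at most the weighted sum; hence
  the factor 2.\<close>

lemma in_sobolev_tser:
  assumes w: "summable (\<lambda>k. real k ^ 3 * (cmod (c k))\<^sup>2)" and c0: "Im (c 0) = 0"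
  shows "in_sobolev (3/2) (tser c)"
    and "(sobolev_norm (3/2) (tser c))\<^sup>2 \<le> (cmod (c 0))\<^sup>2 + 2 * (\<Sum>k. real k ^ 3 * (cmod (c k))\<^sup>2)"
proof -
  have c: "summable (\<lambda>k. cmod (c k))" using weighted_imp_summable[OF w] by simp
  let ?g = "\<lambda>n::int. (1 + (of_int n)\<^sup>2) powr (3/2) * (cmod (fourier_coeff (tser c) n))\<^sup>2"
  let ?B = "(cmod (c 0))\<^sup>2 + 2 * (\<Sum>k. real k ^ 3 * (cmod (c k))\<^sup>2)"
  have bnd: "(\<Sum>n\<in>F. ?g n) \<le> ?B" if "finite F" for F :: "int set"
  proof -
    have le: "?g n \<le> real (nat \<bar>n\<bar>) ^ 3 * (cmod (c (nat \<bar>n\<bar>)))\<^sup>2" if "n \<noteq> 0" for n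
    proof -
      have "cmod (fourier_coeff (tser c) n) = cmod (c (nat \<bar>n\<bar>)) / 2"
        using that by (simp add: fourier_coeff_eq_fhat fhat_tser[OF c c0] norm_divide)
      then have "?g n \<le> (4 * real (nat \<bar>n\<bar>) ^ 3) * ((cmod (c (nat \<bar>n\<bar>)))\<^sup>2 / 4)"
        by (simp only: power_divide) (intro mult_mono sobolev_weight_le that, auto)
      also have "\<dots> \<le> real (nat \<bar>n\<bar>) ^ 3 * (cmod (c (nat \<bar>n\<bar>)))\<^sup>2" by simp
      finally show ?thesis .
    qed
    have half: "(\<Sum>n\<in>G. real (nat \<bar>n\<bar>) ^ 3 * (cmod (c (nat \<bar>n\<bar>)))\<^sup>2) \<le> (\<Sum>k. real k ^ 3 * (cmod (c k))\<^sup>2)"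
      if "finite G" "inj_on (\<lambda>n. nat \<bar>n\<bar>) G" for G :: "int set"
    proof -
      have "(\<Sum>n\<in>G. real (nat \<bar>n\<bar>) ^ 3 * (cmod (c (nat \<bar>n\<bar>)))\<^sup>2) = (\<Sum>k\<in>(\<lambda>n. nat \<bar>n\<bar>) ` G. real k ^ 3 * (cmod (c k))\<^sup>2)"
        by (simp add: sum.reindex[OF that(2)])
      also have "\<dots> \<le> (\<Sum>k. real k ^ 3 * (cmod (c k))\<^sup>2)"
        by (rule sum_le_suminf[OF w]) (use that in auto)
      finally show ?thesis .
    qed
    have "(\<Sum>n\<in>F. ?g n) = (\<Sum>n\<in>F \<inter> {0}. ?g n) + (\<Sum>n\<in>F \<inter> {0<..}. ?g n) + (\<Sum>n\<in>F \<inter> {..<0}. ?g n)"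
    proof -
      have "F = (F \<inter> {0} \<union> F \<inter> {0<..}) \<union> F \<inter> {..<0}" by auto
      moreover have "(\<Sum>n\<in>(F \<inter> {0} \<union> F \<inter> {0<..}) \<union> F \<inter> {..<0}. ?g n) = (\<Sum>n\<in>F \<inter> {0}. ?g n) + (\<Sum>n\<in>F \<inter> {0<..}. ?g n) + (\<Sum>n\<in>F \<inter> {..<0}. ?g n)"
        using that by (subst sum.union_disjoint, simp, simp, force, subst sum.union_disjoint) auto
      ultimately show ?thesis by simp
    qed
    also have "(\<Sum>n\<in>F \<inter> {0}. ?g n) \<le> (\<Sum>n\<in>{0}. ?g n)"
      by (intro sum_mono2) auto
    also have "(\<Sum>n\<in>{0}. ?g n) = (cmod (c 0))\<^sup>2"
      by (simp add: fourier_coeff_eq_fhat fhat_tser[OF c c0])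
    also have "(\<Sum>n\<in>F \<inter> {0<..}. ?g n) \<le> (\<Sum>n\<in>F \<inter> {0<..}. real (nat \<bar>n\<bar>) ^ 3 * (cmod (c (nat \<bar>n\<bar>)))\<^sup>2)"
      by (intro sum_mono le) auto
    also have "\<dots> \<le> (\<Sum>k. real k ^ 3 * (cmod (c k))\<^sup>2)"
      using that by (intro half) (auto simp: inj_on_def)
    also have "(\<Sum>n\<in>F \<inter> {..<0}. ?g n) \<le> (\<Sum>n\<in>F \<inter> {..<0}. real (nat \<bar>n\<bar>) ^ 3 * (cmod (c (nat \<bar>n\<bar>)))\<^sup>2)"
      by (intro sum_mono le) auto
    also have "\<dots> \<le> (\<Sum>k. real k ^ 3 * (cmod (c k))\<^sup>2)"
      using that by (intro half) (auto simp: inj_on_def)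
    finally show ?thesis by simp
  qed
  have sm: "?g summable_on UNIV"
    by (rule nonneg_bdd_above_summable_on) (auto intro!: bdd_aboveI2[where M = ?B] bnd)
  show "in_sobolev (3/2) (tser c)"
    unfolding in_sobolev_def
  proof (intro conjI allI)
    show "tser c \<in> borel_measurable lborel" using tser_measurable[OF c] by simp
    show "set_integrable lborel {-pi..pi} (\<lambda>x. (tser c x)\<^sup>2)"
      by (intro borel_integrable_atLeastAtMost' continuous_intros continuous_on_subset[OF tser_continuous[OF c]]) auto
  qed (use sm tser_periodic in auto)
  have "(sobolev_norm (3/2) (tser c))\<^sup>2 = (\<Sum>\<^sub>\<infinity>n. ?g n)"
    unfolding sobolev_norm_def by (subst real_sqrt_pow2) (auto intro: infsum_nonneg)
  also have "\<dots> \<le> ?B" by (intro infsum_le_finite_sums sm bnd)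
  finally show "(sobolev_norm (3/2) (tser c))\<^sup>2 \<le> ?B" .
qed

section \<open>The Hilbert transform of a trigonometric series\<close>

text \<open>The conjugate Dirichlet kernel: sin((k+1)u) - sin(ku) = 2 cos((k+1/2)u) sin(u/2), and
  the cotangent cancels the vanishing factor and leaves two cosines. With the singularity gone, the
  truncated integrals become explicit.\<close>

lemma cot_mult_sin:
  assumes "sin (u / 2) \<noteq> 0"
  shows "cot (u / 2) * sin (real k * u) = (\<Sum>j<k. cos (real j * u) + cos (real (Suc j) * u))"
proof (induction k)
  case (Suc k)
  define w where "w = (real k + 1/2) * u"
  have w: "real (Suc k) * u = w + u / 2" "real k * u = w - u / 2" by (simp_all add: w_def field_simps)
  have "cot (u / 2) * (sin (w + u / 2) - sin (w - u / 2)) = cos (w + u / 2) + cos (w - u / 2)"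
    using assms by (simp add: cot_def sin_add sin_diff cos_add cos_diff)
  then show ?case using Suc by (simp add: w[symmetric] algebra_simps)
qed simp

text \<open>The principal-value domain after substituting u = \<theta> - \<phi>. It is symmetric
  about 0, so odd integrands drop out.\<close>

definition cutoff :: "real \<Rightarrow> real set" where
  "cutoff \<epsilon> = {-pi..pi} - {-\<epsilon><..<\<epsilon>}"

lemma cutoff_eq: "0 < \<epsilon> \<Longrightarrow> \<epsilon> < pi \<Longrightarrow> cutoff \<epsilon> = {-pi..-\<epsilon>} \<union> {\<epsilon>..pi}"
  by (auto simp: cutoff_def)

lemma set_integrable_cutoff:
  fixes g :: "real \<Rightarrow> real"
  assumes \<epsilon>: "0 < \<epsilon>" "\<epsilon> < pi" and g: "continuous_on (cutoff \<epsilon>) g"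
  shows "set_integrable lborel (cutoff \<epsilon>) g"
proof -
  have "compact (cutoff \<epsilon>)" unfolding cutoff_eq[OF \<epsilon>] by (intro compact_Un compact_Icc)
  then show ?thesis unfolding set_integrable_def by (intro borel_integrable_compact g)
qed

lemma sin_half_nonzero:
  assumes "0 < \<epsilon>" "u \<in> cutoff \<epsilon>"
  shows "sin (u / 2) \<noteq> 0"
proof (cases "u > 0")
  case True
  then have "sin (u / 2) > 0" using assms by (intro sin_gt_zero) (auto simp: cutoff_def)
  then show ?thesis by simp
next
  case False
  then have "sin (- u / 2) > 0" using assms by (intro sin_gt_zero) (auto simp: cutoff_def)
  then show ?thesis by simp
qed

lemma cot_integrable_cutoff:
  assumes \<epsilon>: "0 < \<epsilon>" "\<epsilon> < pi"
  shows "set_integrable lborel (cutoff \<epsilon>) (\<lambda>u. cot (u / 2))"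
  unfolding cot_def
  by (intro set_integrable_cutoff[OF \<epsilon>] continuous_intros) (use sin_half_nonzero[OF \<epsilon>(1)] in auto)

lemma integral_cutoff_odd:
  fixes g :: "real \<Rightarrow> real"
  assumes "\<And>u. g (- u) = - g u"
  shows "(LBINT u:cutoff \<epsilon>. g u) = 0"
proof -
  have "indicator (cutoff \<epsilon>) (- u) = (indicator (cutoff \<epsilon>) u :: real)" for u
    by (auto simp: cutoff_def indicator_def)
  then have "(LBINT u:cutoff \<epsilon>. g u) = - (LBINT u:cutoff \<epsilon>. g u)"
    unfolding set_lebesgue_integral_def
    by (subst lborel_integral_real_affine[where c = "-1" and t = 0]) (simp_all add: assms)
  then show ?thesis by simp
qed

lemma integral_cutoff_cos:
  assumes \<epsilon>: "0 < \<epsilon>" "\<epsilon> < pi"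
  shows "(LBINT u:cutoff \<epsilon>. cos (real j * u)) = (if j = 0 then 2 * (pi - \<epsilon>) else - 2 * sin (real j * \<epsilon>) / real j)"
proof -
  have int: "set_integrable lborel {a..b} (\<lambda>u. cos (real j * u))" for a b
    by (intro borel_integrable_atLeastAtMost' continuous_intros)
  have val: "(LBINT u:{a..b}. cos (real j * u)) =
      (if j = 0 then b - a else sin (real j * b) / real j - sin (real j * a) / real j)" if "a \<le> b" for a b
  proof (cases "j = 0")
    case False
    have "((\<lambda>u. cos (real j * u)) has_integral (sin (real j * b) / real j - sin (real j * a) / real j)) {a..b}"
      by (rule fundamental_theorem_of_calculus[OF that])
         (use False in \<open>auto simp flip: has_real_derivative_iff_has_vector_derivative intro!: derivative_eq_intros\<close>)
    then show ?thesis using False int by (simp add: set_borel_integral_eq_integral integral_unique)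
  next
    case True
    then show ?thesis using that by (simp add: set_integral_const)
  qed
  have "(LBINT u:cutoff \<epsilon>. cos (real j * u)) = (LBINT u:{-pi..-\<epsilon>}. cos (real j * u)) + (LBINT u:{\<epsilon>..pi}. cos (real j * u))"
    unfolding cutoff_eq[OF \<epsilon>] by (intro set_integral_Un int) (use \<epsilon> in auto)
  also have "\<dots> = (if j = 0 then 2 * (pi - \<epsilon>) else - 2 * sin (real j * \<epsilon>) / real j)"
    using \<epsilon> by (simp add: val sin_npi)
  finally show ?thesis .
qed

text \<open>Up to the factor 1/(2 pi), the multiplier of the truncated Hilbert transform at
  frequency k.\<close>

definition conj_kernel :: "nat \<Rightarrow> real \<Rightarrow> real" where
  "conj_kernel k \<epsilon> = (LBINT u:cutoff \<epsilon>. cot (u / 2) * sin (real k * u))"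

lemma conj_kernel_eq:
  assumes \<epsilon>: "0 < \<epsilon>" "\<epsilon> < pi"
  defines "I \<equiv> \<lambda>j. if j = 0 then 2 * (pi - \<epsilon>) else - 2 * sin (real j * \<epsilon>) / real j"
  shows "conj_kernel k \<epsilon> = (\<Sum>j<k. I j + I (Suc j))"
proof -
  have int: "set_integrable lborel (cutoff \<epsilon>) (\<lambda>u. cos (real j * u))" for j
    by (intro set_integrable_cutoff[OF \<epsilon>] continuous_intros)
  have "conj_kernel k \<epsilon> = (LBINT u:cutoff \<epsilon>. (\<Sum>j<k. cos (real j * u) + cos (real (Suc j) * u)))"
    unfolding conj_kernel_def
    by (rule set_lebesgue_integral_cong) (use \<epsilon> cot_mult_sin[OF sin_half_nonzero] in \<open>auto simp: cutoff_eq[OF \<epsilon>]\<close>)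
  also have "\<dots> = (\<Sum>j<k. LBINT u:cutoff \<epsilon>. cos (real j * u) + cos (real (Suc j) * u))"
    unfolding set_lebesgue_integral_def sum_distrib_left scaleR_sum_right
    by (rule Bochner_Integration.integral_sum) (rule set_integral_add(1)[OF int int, unfolded set_integrable_def])
  also have "\<dots> = (\<Sum>j<k. I j + I (Suc j))"
    by (intro sum.cong refl, subst set_integral_add(2)[OF int int])
       (simp only: integral_cutoff_cos[OF \<epsilon>] I_def)
  finally show ?thesis .
qed

text \<open>Telescoping: 2 (sqrt(k+1) - sqrt k) \<ge> 1/sqrt(k+1) \<ge> 1/(k+1). The square root is
  chosen to match \<open>weighted_imp_sqrt_summable\<close>.\<close>

lemma sum_inverse_le_sqrt: "(\<Sum>j<k. 1 / real (Suc j)) \<le> 2 * sqrt (real k)"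
proof (induction k)
  case (Suc k)
  have "1 / real (Suc k) \<le> 2 * (sqrt (real (Suc k)) - sqrt (real k))"
  proof -
    define x y where "x = sqrt (real (Suc k))" and "y = sqrt (real k)"
    have xy: "x \<ge> 1" "0 \<le> y" "y \<le> x" "x\<^sup>2 = y\<^sup>2 + 1" by (auto simp: x_def y_def)
    have "(x - y) * (x + y) = 1" using xy by (simp add: power2_eq_square algebra_simps)
    moreover have "x + y \<le> 2 * x\<^sup>2"
      using xy mult_right_mono[of 1 x x] by (simp add: power2_eq_square)
    then have "(x - y) * (x + y) \<le> (x - y) * (2 * x\<^sup>2)" using xy by (intro mult_left_mono) auto
    ultimately have "1 \<le> (2 * (x - y)) * x\<^sup>2" by (simp only: mult_ac)
    moreover have "0 < x\<^sup>2" using xy(1) by simp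
    ultimately have "1 / x\<^sup>2 \<le> 2 * (x - y)" by (subst pos_divide_le_eq)
    then show ?thesis by (simp add: x_def y_def)
  qed
  then show ?case using Suc by simp
qed simp

text \<open>The sum contains I 0 once, at most 8 as pi < 4, and every other I j at most twice, each
  bounded by 2/j; together 8 + 8 sqrt k. Uniformity in \<epsilon> is what permits the limit inside
  the series.\<close>

lemma conj_kernel_bound:
  assumes \<epsilon>: "0 < \<epsilon>" "\<epsilon> < pi"
  shows "\<bar>conj_kernel k \<epsilon>\<bar> \<le> 16 * sqrt (real k)"
proof (cases "k = 0")
  case False
  define I where "I j = (if j = 0 then 2 * (pi - \<epsilon>) else - 2 * sin (real j * \<epsilon>) / real j)" for j
  have I1: "\<bar>I (Suc j)\<bar> \<le> 2 * (1 / real (Suc j))" for j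
    using mult_left_mono[OF abs_sin_le_one, of 2 "real (Suc j) * \<epsilon>"] by (simp add: I_def abs_mult divide_right_mono del: of_nat_Suc)
  have "\<bar>conj_kernel k \<epsilon>\<bar> \<le> (\<Sum>j<k. \<bar>I j\<bar>) + (\<Sum>j<k. \<bar>I (Suc j)\<bar>)"
    unfolding conj_kernel_eq[OF \<epsilon>] I_def[symmetric] sum.distrib[symmetric]
    by (intro order_trans[OF sum_abs] sum_mono abs_triangle_ineq)
  also have "(\<Sum>j<k. \<bar>I j\<bar>) \<le> \<bar>I 0\<bar> + (\<Sum>j<k. \<bar>I (Suc j)\<bar>)"
    unfolding sum.lessThan_Suc_shift[symmetric, of "\<lambda>j. \<bar>I j\<bar>" k] by (simp add: sum.lessThan_Suc_shift[symmetric])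
  also have "\<bar>I 0\<bar> \<le> 8" using \<epsilon> pi_less_4 by (simp add: I_def)
  also have "(\<Sum>j<k. \<bar>I (Suc j)\<bar>) \<le> (\<Sum>j<k. 2 * (1 / real (Suc j)))" by (intro sum_mono I1)
  also have "\<dots> \<le> 2 * (2 * sqrt (real k))"
    unfolding sum_distrib_left[symmetric] by (intro mult_left_mono sum_inverse_le_sqrt) simp
  finally have "\<bar>conj_kernel k \<epsilon>\<bar> \<le> 8 + 8 * sqrt (real k)" by simp
  moreover have "1 \<le> sqrt (real k)" using False by simp
  ultimately show ?thesis by linarith
qed (simp add: conj_kernel_eq[OF \<epsilon>])

text \<open>As the cut shrinks every I j with j > 0 tends to 0. The term I 0, with limit 2 pi,
  occurs exactly once as soon as k > 0.\<close>

lemma conj_kernel_tendsto: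
  "((\<lambda>\<epsilon>. conj_kernel k \<epsilon>) \<longlongrightarrow> (if k = 0 then 0 else 2 * pi)) (at_right 0)"
proof -
  define I where "I \<epsilon> j = (if j = 0 then 2 * (pi - \<epsilon>) else - 2 * sin (real j * \<epsilon>) / real j)" for \<epsilon> and j :: nat
  have Ilim: "((\<lambda>\<epsilon>. I \<epsilon> j) \<longlongrightarrow> (if j = 0 then 2 * pi else 0)) (at_right 0)" for j
  proof -
    have "((\<lambda>\<epsilon>. if j = 0 then 2 * (pi - \<epsilon>) else - 2 * sin (real j * \<epsilon>) / real j) \<longlongrightarrow>
       (if j = 0 then 2 * (pi - 0) else - 2 * sin (real j * 0) / real j)) (at_right 0)"
      by (cases "j = 0") (simp_all only: if_True if_False refl, (intro tendsto_intros; simp)+)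
    then show ?thesis by (cases "j = 0") (simp_all add: I_def)
  qed
  have "((\<lambda>\<epsilon>. \<Sum>j<k. I \<epsilon> j + I \<epsilon> (Suc j)) \<longlongrightarrow> (\<Sum>j<k. (if j = 0 then 2 * pi else 0) + (if Suc j = 0 then 2 * pi else 0))) (at_right 0)"
    by (intro tendsto_sum tendsto_add Ilim)
  also have "(\<Sum>j<k. (if j = 0 then 2 * pi else 0) + (if Suc j = 0 then 2 * pi else 0)) = (if k = 0 then 0 else 2 * pi)"
    by (cases k) (simp_all add: sum.lessThan_Suc_shift del: sum.lessThan_Suc)
  finally show ?thesis
  proof (rule Lim_transform_eventually)
    have "\<forall>\<^sub>F \<epsilon> in at_right 0. \<epsilon> \<in> {0<..<pi}" by (rule eventually_at_right_real) simp
    then show "\<forall>\<^sub>F \<epsilon> in at_right 0. (\<Sum>j<k. I \<epsilon> j + I \<epsilon> (Suc j)) = conj_kernel k \<epsilon>"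
      by eventually_elim (auto simp: conj_kernel_eq I_def)
  qed
qed

lemma hilbert_integral_tser:
  assumes c: "summable (\<lambda>k. cmod (c k))" and \<epsilon>: "0 < \<epsilon>" "\<epsilon> < pi"
  shows "(LBINT \<phi>:{\<theta> - pi..\<theta> + pi} - {\<theta> - \<epsilon><..<\<theta> + \<epsilon>}. cot ((\<theta> - \<phi>) / 2) * tser c \<phi>) =
    (\<Sum>k. Im (c k * cis (real k * \<theta>)) * conj_kernel k \<epsilon>)"
proof -
  let ?S = "{\<theta> - pi..\<theta> + pi} - {\<theta> - \<epsilon><..<\<theta> + \<epsilon>}"
  have "(LBINT \<phi>:?S. cot ((\<theta> - \<phi>) / 2) * tser c \<phi>) = (LBINT u:cutoff \<epsilon>. cot (u / 2) * tser c (\<theta> - u))"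
  proof -
    have "indicator ?S (\<theta> - u) = (indicator (cutoff \<epsilon>) u :: real)" for u
      by (auto simp: cutoff_def indicator_def)
    then show ?thesis
      unfolding set_lebesgue_integral_def
      by (subst lborel_integral_real_affine[where c = "-1" and t = \<theta>]) simp_all
  qed
  also have "\<dots> = (\<Sum>k. LBINT u:cutoff \<epsilon>. cot (u / 2) * Re (c k * cis (real k * (\<theta> - u))))"
    unfolding tser_def
  proof (rule sums_unique[OF set_integral_mult_suminf[OF cot_integrable_cutoff[OF \<epsilon>] _ _ c]])
    show "(\<lambda>u. Re (c k * cis (real k * (\<theta> - u)))) \<in> borel_measurable lborel" for k
    proof -
      have "(\<lambda>u. Re (c k * cis (real k * (\<theta> - u)))) \<in> borel_measurable borel"
        by (intro borel_measurable_continuous_onI continuous_intros)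
      then show ?thesis by simp
    qed
    show "norm (Re (c k * cis (real k * (\<theta> - u)))) \<le> cmod (c k)" for k u
      by (simp only: real_norm_def tser_term_le)
  qed
  also have "\<dots> = (\<Sum>k. Im (c k * cis (real k * \<theta>)) * conj_kernel k \<epsilon>)"
  proof (rule suminf_cong)
    fix k
    define d where "d = c k * cis (real k * \<theta>)"
    have "c k * cis (real k * (\<theta> - u)) = d * cis (- (real k * u))" for u
      by (simp add: d_def cis_mult algebra_simps)
    then have "cot (u / 2) * Re (c k * cis (real k * (\<theta> - u))) =
        Re d * (cot (u / 2) * cos (real k * u)) + Im d * (cot (u / 2) * sin (real k * u))" for u
      by (simp add: algebra_simps)
    moreover have "set_integrable lborel (cutoff \<epsilon>) (\<lambda>u. cot (u / 2) * cos (real k * u))"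
         "set_integrable lborel (cutoff \<epsilon>) (\<lambda>u. cot (u / 2) * sin (real k * u))"
      by (intro set_integrable_mult_bounded[where B = 1] cot_integrable_cutoff[OF \<epsilon>]; simp)+
    ultimately have "(LBINT u:cutoff \<epsilon>. cot (u / 2) * Re (c k * cis (real k * (\<theta> - u)))) =
      Re d * (LBINT u:cutoff \<epsilon>. cot (u / 2) * cos (real k * u)) + Im d * conj_kernel k \<epsilon>"
      by (simp only: set_integral_add(2) set_integrable_mult_right set_integral_mult_right conj_kernel_def)
    \<comment> \<open>Cotangent times cosine is odd, so only the sine part of each mode survives:
      the transform turns Re into Im.\<close>
    moreover have "(LBINT u:cutoff \<epsilon>. cot (u / 2) * cos (real k * u)) = 0"
      by (rule integral_cutoff_odd) (simp add: cot_def)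
    ultimately show "(LBINT u:cutoff \<epsilon>. cot (u / 2) * Re (c k * cis (real k * (\<theta> - u)))) =
        Im (c k * cis (real k * \<theta>)) * conj_kernel k \<epsilon>" by (simp add: d_def)
  qed
  finally show ?thesis .
qed

text \<open>Tannery's theorem with majorant 16 sqrt k |c_k| exchanges the limit of the cuts with the
  series. The principal value sees \<open>f\<close> only through integrals, so equality almost
  everywhere determines it at every point.\<close>

lemma hilbert_transform_tser:
  assumes c: "summable (\<lambda>k. sqrt (real k) * cmod (c k))" "summable (\<lambda>k. cmod (c k))"
    and f: "f \<in> borel_measurable borel" "AE x in lborel. f x = tser c x"
  shows "hilbert_transform f \<theta> = tser (\<lambda>k. if k = 0 then 0 else - \<i> * c k) \<theta>"
proof -
  let ?S = "\<lambda>\<epsilon>. {\<theta> - pi..\<theta> + pi} - {\<theta> - \<epsilon><..<\<theta> + \<epsilon>}"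
  have "((\<lambda>\<epsilon>. \<Sum>k. Im (c k * cis (real k * \<theta>)) * conj_kernel k \<epsilon>) \<longlongrightarrow>
      (\<Sum>k. Im (c k * cis (real k * \<theta>)) * (if k = 0 then 0 else 2 * pi))) (at_right 0)"
  proof (rule tannerys_theorem[THEN conjunct2, THEN conjunct2])
    show "((\<lambda>\<epsilon>. Im (c k * cis (real k * \<theta>)) * conj_kernel k \<epsilon>) \<longlongrightarrow> Im (c k * cis (real k * \<theta>)) * (if k = 0 then 0 else 2 * pi)) (at_right 0)" for k
      by (intro tendsto_intros conj_kernel_tendsto)
    show "summable (\<lambda>k. 16 * (sqrt (real k) * cmod (c k)))" by (intro summable_mult c)
    show "\<forall>\<^sub>F (k, \<epsilon>) in at_top \<times>\<^sub>F at_right 0. norm (Im (c k * cis (real k * \<theta>)) * conj_kernel k \<epsilon>) \<le> 16 * (sqrt (real k) * cmod (c k))"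
    proof -
      have "\<forall>\<^sub>F \<epsilon> in at_right 0. \<epsilon> \<in> {0<..<pi}" by (rule eventually_at_right_real) simp
      then have "\<forall>\<^sub>F z in at_top \<times>\<^sub>F at_right 0. snd z \<in> {0<..<pi}"
        by (rule eventually_compose_filterlim[OF _ filterlim_snd])
      then show ?thesis
      proof eventually_elim
        case (elim z)
        obtain k \<epsilon> where z: "z = (k, \<epsilon>)" by force
        have "\<bar>Im (c k * cis (real k * \<theta>))\<bar> * \<bar>conj_kernel k \<epsilon>\<bar> \<le> cmod (c k) * (16 * sqrt (real k))"
          using elim z abs_Im_le_cmod[of "c k * cis (real k * \<theta>)"]
          by (intro mult_mono conj_kernel_bound) (auto simp: norm_mult simp del: times_complex.sel)
        then show ?case by (simp only: z prod.case real_norm_def abs_mult mult_ac)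
      qed
    qed
  qed simp
  then have "((\<lambda>\<epsilon>. 1 / (2 * pi) * (\<Sum>k. Im (c k * cis (real k * \<theta>)) * conj_kernel k \<epsilon>)) \<longlongrightarrow>
      1 / (2 * pi) * (\<Sum>k. Im (c k * cis (real k * \<theta>)) * (if k = 0 then 0 else 2 * pi))) (at_right 0)"
    by (intro tendsto_intros)
  also have "1 / (2 * pi) * (\<Sum>k. Im (c k * cis (real k * \<theta>)) * (if k = 0 then 0 else 2 * pi)) =
      tser (\<lambda>k. if k = 0 then 0 else - \<i> * c k) \<theta>"
  proof -
    have eq: "Im (c k * cis (real k * \<theta>)) * (if k = 0 then 0 else 2 * pi) =
        2 * pi * Re ((if k = 0 then 0 else - \<i> * c k) * cis (real k * \<theta>))" for k
      by simp
    have "summable (\<lambda>k. cmod (if k = 0 then 0 else - \<i> * c k))"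
      by (rule summable_comparison_test'[OF c(2)]) (auto simp: norm_mult)
    from suminf_mult[OF tser_summable[OF this]] show ?thesis
      unfolding eq tser_def by simp
  qed
  finally have "((\<lambda>\<epsilon>. 1 / (2 * pi) * (LBINT \<phi>:?S \<epsilon>. cot ((\<theta> - \<phi>) / 2) * f \<phi>)) \<longlongrightarrow>
      tser (\<lambda>k. if k = 0 then 0 else - \<i> * c k) \<theta>) (at_right 0)"
  proof (rule Lim_transform_eventually)
    have "\<forall>\<^sub>F \<epsilon> in at_right 0. \<epsilon> \<in> {0<..<pi}" by (rule eventually_at_right_real) simp
    then show "\<forall>\<^sub>F \<epsilon> in at_right 0. 1 / (2 * pi) * (\<Sum>k. Im (c k * cis (real k * \<theta>)) * conj_kernel k \<epsilon>) =
        1 / (2 * pi) * (LBINT \<phi>:?S \<epsilon>. cot ((\<theta> - \<phi>) / 2) * f \<phi>)"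
    proof eventually_elim
      case (elim \<epsilon>)
      have "(LBINT \<phi>:?S \<epsilon>. cot ((\<theta> - \<phi>) / 2) * f \<phi>) = (LBINT \<phi>:?S \<epsilon>. cot ((\<theta> - \<phi>) / 2) * tser c \<phi>)"
        unfolding set_lebesgue_integral_def cot_def
      proof (rule integral_cong_AE)
        have [measurable]: "tser c \<in> borel_measurable borel" by (rule tser_measurable[OF c(2)])
        show "(\<lambda>x. indicator (?S \<epsilon>) x *\<^sub>R (cos ((\<theta> - x) / 2) / sin ((\<theta> - x) / 2) * f x)) \<in> borel_measurable lborel"
          using f(1) by measurable
        show "(\<lambda>x. indicator (?S \<epsilon>) x *\<^sub>R (cos ((\<theta> - x) / 2) / sin ((\<theta> - x) / 2) * tser c x)) \<in> borel_measurable lborel"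
          by measurable
        show "AE x in lborel. indicator (?S \<epsilon>) x *\<^sub>R (cos ((\<theta> - x) / 2) / sin ((\<theta> - x) / 2) * f x) =
            indicator (?S \<epsilon>) x *\<^sub>R (cos ((\<theta> - x) / 2) / sin ((\<theta> - x) / 2) * tser c x)"
          using f(2) by eventually_elim simp
      qed
      then show ?case using elim hilbert_integral_tser[OF c(2), of \<epsilon> \<theta>] by simp
    qed
  qed
  then show ?thesis
    unfolding hilbert_transform_def by (intro tendsto_Lim) simp_all
qed

section \<open>The velocity and the linearized operator on Fourier modes\<close>

lemma weighted_summable_cmod:
  assumes "summable (\<lambda>k. real k * cmod (c k))"
  shows "summable (\<lambda>k. cmod (c k))"
proof (rule summable_comparison_test)
  show "\<exists>N. \<forall>k\<ge>N. norm (cmod (c k)) \<le> real k * cmod (c k)"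
    by (intro exI[of _ 1]) (auto simp: mult_le_cancel_right1)
qed (rule assms)

lemma tser_has_derivative:
  assumes c: "summable (\<lambda>k. real k * cmod (c k))"
  shows "(tser c has_real_derivative tser (\<lambda>k. \<i> * of_nat k * c k) x) (at x)"
proof -
  have c': "summable (\<lambda>k. cmod (\<i> * of_nat k * c k))" using c by (simp add: norm_mult)
  have "((\<lambda>x. \<Sum>k. Re (c k * cis (real k * x))) has_real_derivative (\<Sum>k. Re (\<i> * of_nat k * c k * cis (real k * x)))) (at x)"
  proof (rule has_field_derivative_series'(2)[of UNIV _ _ 0])
    show "((\<lambda>x. Re (c k * cis (real k * x))) has_real_derivative Re (\<i> * of_nat k * c k * cis (real k * x))) (at x within UNIV)" for k x
      by (auto intro!: derivative_eq_intros simp: algebra_simps)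
    show "uniformly_convergent_on UNIV (\<lambda>n x. \<Sum>k<n. Re (\<i> * of_nat k * c k * cis (real k * x)))"
      using tser_uniform_limit[OF c'] by (auto simp: uniformly_convergent_on_def)
    show "summable (\<lambda>k. Re (c k * cis (real k * 0)))"
      by (rule tser_summable[OF weighted_summable_cmod[OF c]])
  qed auto
  then show ?thesis by (simp only: tser_def[abs_def])
qed

definition hilbert_mult :: "(nat \<Rightarrow> complex) \<Rightarrow> nat \<Rightarrow> complex" where
  "hilbert_mult c k = (if k = 0 then 0 else - \<i> * c k)"

text \<open>Integrating the Hilbert transform divides by ik: -i c/(ik) = -c/k. The zero at k = 0 is
  the mean condition on the velocity.\<close>

definition velocity_mult :: "(nat \<Rightarrow> complex) \<Rightarrow> nat \<Rightarrow> complex" where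
  "velocity_mult c k = (if k = 0 then 0 else - c k / of_nat k)"

lemma multipliers_0 [simp]: "hilbert_mult c 0 = 0" "velocity_mult c 0 = 0"
  by (simp_all add: hilbert_mult_def velocity_mult_def)

lemma hilbert_mult_summable:
  assumes "summable (\<lambda>k. cmod (c k))"
  shows "summable (\<lambda>k. cmod (hilbert_mult c k))"
  by (rule summable_comparison_test'[OF assms]) (auto simp: hilbert_mult_def norm_mult)

lemma velocity_mult_weighted_summable:
  assumes "summable (\<lambda>k. cmod (c k))"
  shows "summable (\<lambda>k. real k * cmod (velocity_mult c k))"
  by (rule summable_comparison_test'[OF assms]) (auto simp: velocity_mult_def norm_divide)

lemmas velocity_mult_summable = weighted_summable_cmod[OF velocity_mult_weighted_summable]

lemma hilbert_transform_in_sobolev: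
  assumes "in_sobolev (3/2) f"
  shows "hilbert_transform f \<theta> = tser (hilbert_mult (fhat f)) \<theta>"
  unfolding hilbert_mult_def
  using weighted_imp_sqrt_summable[OF fhat_weighted_summable[OF assms]] fhat_summable[OF assms]
    in_sobolev_AE_eq_tser[OF assms] assms
  by (intro hilbert_transform_tser) (auto simp: in_sobolev_def)

lemma tser_velocity_has_derivative:
  assumes "in_sobolev (3/2) f"
  shows "(tser (velocity_mult (fhat f)) has_real_derivative hilbert_transform f x) (at x)"
proof -
  have "(\<lambda>k. \<i> * of_nat k * velocity_mult (fhat f) k) = hilbert_mult (fhat f)"
    by (auto simp: velocity_mult_def hilbert_mult_def fun_eq_iff)
  then show ?thesis
    using tser_has_derivative[OF velocity_mult_weighted_summable[OF fhat_summable[OF assms]], of x]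
    by (simp add: hilbert_transform_in_sobolev[OF assms])
qed

lemma integral_tser:
  assumes "summable (\<lambda>k. cmod (c k))" "Im (c 0) = 0"
  shows "(LBINT x:{-pi..pi}. tser c x) = 2 * pi * Re (c 0)"
  using fourier_pairing[OF tser_set_integrable[OF assms(1)], of 1 0] fourier_coeff_tser[OF assms, of 0]
  by simp

lemma is_velocity_tser:
  assumes "in_sobolev (3/2) f"
  shows "is_velocity f (tser (velocity_mult (fhat f)))"
  unfolding is_velocity_def
  using integral_tser[OF velocity_mult_summable[OF fhat_summable[OF assms]]]
  by (auto simp: tser_periodic tser_velocity_has_derivative[OF assms])

text \<open>Two velocities have the same derivative and differ by a constant, which the mean
  condition kills. The arbitrary witness in the definition of a solution thus becomes an explicit
  series.\<close>

lemma is_velocity_unique: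
  assumes f: "in_sobolev (3/2) f" and v: "is_velocity f v"
  shows "v = tser (velocity_mult (fhat f))"
proof -
  let ?w = "tser (velocity_mult (fhat f))"
  have "((\<lambda>x. v x - ?w x) has_real_derivative 0) (at x)" for x
    using DERIV_diff[OF _ tser_velocity_has_derivative[OF f, of x]] v by (fastforce simp: is_velocity_def)
  then have "v x - ?w x = v 0 - ?w 0" for x
    using DERIV_isconst_all by blast
  then obtain d where d: "\<And>x. v x = d + ?w x" by (metis diff_add_cancel)
  have wi: "set_integrable lborel {-pi..pi} ?w"
    by (intro tser_set_integrable velocity_mult_summable fhat_summable f)
  have "0 = (LBINT x:{-pi..pi}. d + ?w x)" using v by (simp add: is_velocity_def d)
  also have "\<dots> = (LBINT x:{-pi..pi}. d) + (LBINT x:{-pi..pi}. ?w x)"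
    by (intro set_integral_add wi borel_integrable_atLeastAtMost' continuous_intros)
  also have "\<dots> = 2 * pi * d"
    using integral_tser[OF velocity_mult_summable[OF fhat_summable[OF f]]]
    by (simp add: set_integral_const)
  finally have "d = 0" by simp
  then show ?thesis by (auto simp: d)
qed

text \<open>The linearized operator on coefficients of a general real function. Mode 1 shifted down
  lands on frequency -1 and is reflected to 1 by conjugation with coefficient B_1 = -3/4; this damps
  real parts and amplifies imaginary ones. A constant has zero velocity and is mapped to a multiple
  of cos 2\<theta>, so it feeds mode 2 only.\<close>

definition symbol :: "(nat \<Rightarrow> complex) \<Rightarrow> nat \<Rightarrow> complex" where
  "symbol c k = of_real (A_coeff (k - 2)) * c (k - 2) + of_real (B_coeff (k + 2)) * c (k + 2)
     - (if k = 1 then 3/4 * cnj (c 1) else 0) + (if k = 2 then c 0 else 0)"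

section \<open>The weak pairing evaluated on Fourier modes\<close>

locale sobolev_velocity =
  fixes f v :: "real \<Rightarrow> real"
  assumes f: "in_sobolev (3/2) f" and v: "is_velocity f v"
begin

abbreviation "h \<equiv> tser (hilbert_mult (fhat f))"

lemma deriv_v: "deriv v x = h x"
  using v hilbert_transform_in_sobolev[OF f] by (auto simp: is_velocity_def intro!: DERIV_imp_deriv)

lemmas f_integrable = in_sobolev_set_integrable[OF f]
lemmas coeffs_summable = fhat_summable[OF f]

lemma h_integrable: "set_integrable lborel {-pi..pi} h"
  by (intro tser_set_integrable hilbert_mult_summable coeffs_summable)

lemma v_integrable: "set_integrable lborel {-pi..pi} v"
  unfolding is_velocity_unique[OF f v] by (intro tser_set_integrable velocity_mult_summable coeffs_summable)

lemma trig_times: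
  assumes "set_integrable lborel S g"
  shows "set_integrable lborel S (\<lambda>x. cos (a * x) * g x)" "set_integrable lborel S (\<lambda>x. sin (a * x) * g (x::real) :: real)"
  using set_integrable_mult_bounded[OF assms, of "\<lambda>x. cos (a * x)" 1] set_integrable_mult_bounded[OF assms, of "\<lambda>x. sin (a * x)" 1]
  by (simp_all add: mult.commute)

text \<open>The pairing is regrouped by the derivative falling on the test function:
  \<open>W1\<close> meets \<rho>', \<open>W2\<close> meets \<rho>. Differentiating sin(2x) \<rho>
  yields a second cos(2x) f, whence the first 2 in \<open>W2\<close>.\<close>

definition "W1 x = 1/2 * (sin (2 * x) * f x)"
definition "W2 x = 2 * (cos (2 * x) * f x) - sin (2 * x) * h x + 2 * (cos (2 * x) * v x)"

lemma W1_integrable: "set_integrable lborel {-pi..pi} W1"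
  unfolding W1_def[abs_def] by (intro set_integrable_mult_right trig_times f_integrable)

lemma W2_integrable: "set_integrable lborel {-pi..pi} W2"
  unfolding W2_def[abs_def]
  by (intro set_integral_add(1) set_integral_diff(1) set_integrable_mult_right trig_times f_integrable h_integrable v_integrable)

lemma pairing_split:
  assumes \<rho>: "\<And>x. (\<rho> has_real_derivative \<rho>' x) (at x)"
    and m: "\<rho> \<in> borel_measurable borel" "\<rho>' \<in> borel_measurable borel"
    and b: "\<And>x. \<bar>\<rho> x\<bar> \<le> B" "\<And>x. \<bar>\<rho>' x\<bar> \<le> B'"
  shows "L2_pairing f v \<rho> = (LBINT x:{-pi..pi}. W1 x * \<rho>' x) + (LBINT x:{-pi..pi}. W2 x * \<rho> x)"
proof -
  have "deriv (\<lambda>x. sin (2 * x) * \<rho> x) x = 2 * cos (2 * x) * \<rho> x + sin (2 * x) * \<rho>' x" for x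
    by (rule DERIV_imp_deriv) (auto intro!: derivative_eq_intros \<rho>)
  then have "L2_pairing f v \<rho> = (LBINT x:{-pi..pi}. W1 x * \<rho>' x + W2 x * \<rho> x)"
    unfolding L2_pairing_def deriv_v W1_def W2_def by (simp add: algebra_simps)
  also have "\<dots> = (LBINT x:{-pi..pi}. W1 x * \<rho>' x) + (LBINT x:{-pi..pi}. W2 x * \<rho> x)"
    by (intro set_integral_add(2) set_integrable_mult_bounded[where B = B] set_integrable_mult_bounded[where B = B'] W1_integrable W2_integrable)
       (use m b in auto)
  finally show ?thesis .
qed

text \<open>Product-to-sum formulas: multiplying the mode k by sin 2x or cos 2x moves it to the
  frequencies k + 2 and k - 2, the latter possibly negative.\<close>

lemma pairing_mode_coeffs:
  fixes k :: nat
  defines "F \<equiv> fourier_coeff f" and "Fh \<equiv> fourier_coeff h" and "Fv \<equiv> fourier_coeff v"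
    and "m \<equiv> int k + 2" and "l \<equiv> int k - 2"
  shows "L2_pairing f v (\<lambda>x. Re (q * cis (real k * x))) = 2 * pi *
    ((real k / 4 + 1) * Re (q * F (- m)) + (1 - real k / 4) * Re (q * F (- l))
      + 1/2 * Re (\<i> * q * Fh (- m)) - 1/2 * Re (\<i> * q * Fh (- l))
      + Re (q * Fv (- m)) + Re (q * Fv (- l)))"
proof -
  let ?\<rho> = "\<lambda>x. Re (q * cis (real k * x))" and ?\<rho>' = "\<lambda>x. Re (\<i> * real k * q * cis (real k * x))"
  have \<rho>m: "?\<rho> \<in> borel_measurable borel" "?\<rho>' \<in> borel_measurable borel"
    by (intro borel_measurable_continuous_onI continuous_intros)+
  have split: "L2_pairing f v ?\<rho> = (LBINT x:{-pi..pi}. W1 x * ?\<rho>' x) + (LBINT x:{-pi..pi}. W2 x * ?\<rho> x)"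
  proof (rule pairing_split[OF _ \<rho>m tser_term_le tser_term_le])
    show "(?\<rho> has_real_derivative ?\<rho>' x) (at x)" for x
      by (auto intro!: derivative_eq_intros simp: algebra_simps)
  qed
  define R where "R p n x = Re (p * cis (of_int n * x))" for p n x
  have Ri: "set_integrable lborel {-pi..pi} (\<lambda>x. g x * R p n x)" if "set_integrable lborel {-pi..pi} g" for g p n
  proof (rule set_integrable_mult_bounded[OF that])
    show "R p n \<in> borel_measurable lborel"
    proof -
      have "R p n \<in> borel_measurable borel"
        unfolding R_def by (intro borel_measurable_continuous_onI continuous_intros)
      then show ?thesis by simp
    qed
    show "norm (R p n x) \<le> cmod p" for x unfolding R_def real_norm_def by (rule tser_term_le)
  qed
  have "W1 x * ?\<rho>' x + W2 x * ?\<rho> x = (real k / 4 + 1) * (f x * R q m x) + (1 - real k / 4) * (f x * R q l x)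
      + 1/2 * (h x * R (\<i> * q) m x) - 1/2 * (h x * R (\<i> * q) l x) + v x * R q m x + v x * R q l x" for x
  proof -
    have "of_int m * x = real k * x + 2 * x" "of_int l * x = real k * x - 2 * x"
      by (simp_all add: m_def l_def algebra_simps)
    then show ?thesis
      unfolding R_def W1_def W2_def
      by (simp add: cos_add sin_add cos_diff sin_diff) (simp add: field_simps)
  qed
  moreover have "(LBINT x:{-pi..pi}. W1 x * ?\<rho>' x) + (LBINT x:{-pi..pi}. W2 x * ?\<rho> x) = (LBINT x:{-pi..pi}. W1 x * ?\<rho>' x + W2 x * ?\<rho> x)"
    by (intro set_integral_add(2)[symmetric] set_integrable_mult_bounded[OF W1_integrable, where B = "cmod (\<i> * real k * q)"]
        set_integrable_mult_bounded[OF W2_integrable, where B = "cmod q"])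
       (use \<rho>m in simp, simp only: real_norm_def tser_term_le, use \<rho>m in simp, simp only: real_norm_def tser_term_le)
  ultimately have "L2_pairing f v ?\<rho> = (LBINT x:{-pi..pi}. (real k / 4 + 1) * (f x * R q m x) + (1 - real k / 4) * (f x * R q l x)
      + 1/2 * (h x * R (\<i> * q) m x) - 1/2 * (h x * R (\<i> * q) l x) + v x * R q m x + v x * R q l x)"
    by (simp only: split)
  also have "\<dots> = (real k / 4 + 1) * (LBINT x:{-pi..pi}. f x * R q m x) + (1 - real k / 4) * (LBINT x:{-pi..pi}. f x * R q l x)
      + 1/2 * (LBINT x:{-pi..pi}. h x * R (\<i> * q) m x) - 1/2 * (LBINT x:{-pi..pi}. h x * R (\<i> * q) l x)
      + (LBINT x:{-pi..pi}. v x * R q m x) + (LBINT x:{-pi..pi}. v x * R q l x)"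
    by (simp only: set_integral_add set_integral_diff set_integrable_mult_right Ri f_integrable h_integrable v_integrable set_integral_mult_right)
  also have "\<dots> = 2 * pi *
    ((real k / 4 + 1) * Re (q * F (- m)) + (1 - real k / 4) * Re (q * F (- l))
      + 1/2 * Re (\<i> * q * Fh (- m)) - 1/2 * Re (\<i> * q * Fh (- l))
      + Re (q * Fv (- m)) + Re (q * Fv (- l)))"
    unfolding R_def fourier_pairing[OF f_integrable] fourier_pairing[OF h_integrable] fourier_pairing[OF v_integrable] F_def Fh_def Fv_def
    by (simp only: distrib_left right_diff_distrib mult_ac)
  finally show ?thesis .
qed

lemma pairing_mode:
  "L2_pairing f v (\<lambda>x. Re (q * cis (real k * x))) = pi * Re (q * cnj (symbol (fhat f) k))"
proof -
  have fh: "fhat h = hilbert_mult (fhat f)"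
    by (intro fhat_tser hilbert_mult_summable coeffs_summable) (simp add: hilbert_mult_def)
  have fv: "fhat v = velocity_mult (fhat f)"
    unfolding is_velocity_unique[OF f v] by (intro fhat_tser velocity_mult_summable coeffs_summable) (simp add: velocity_mult_def)
  note F = fourier_coeff_eq_fhat fh fv hilbert_mult_def velocity_mult_def
  have c0: "cnj (fhat f 0) = fhat f 0" using Im_fhat_0[of f] by (simp add: complex_eq_iff)
  \<comment> \<open>For k \<le> 2 the lower frequency k - 2 is negative, to be folded back by
    conjugation, or the mean; from k = 3 on the formula is uniform.\<close>
  consider "k = 0" | "k = 1" | "k = 2" | n where "k = n + 3"
    by (metis One_nat_def Suc_1 add.commute less_2_cases_iff linorder_not_less nat_less_le not_less_eq_eq numeral_3_eq_3 le_Suc_ex)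
  then show ?thesis
  proof cases
    case 1
    then show ?thesis unfolding pairing_mode_coeffs
      by (simp add: F symbol_def B_coeff_def) (simp add: field_simps)
  next
    case 2
    then show ?thesis unfolding pairing_mode_coeffs
      by (simp add: F symbol_def B_coeff_def nat_add_distrib field_simps numeral_3_eq_3)
  next
    case 3
    then show ?thesis unfolding pairing_mode_coeffs
      by (simp add: F symbol_def B_coeff_def A_coeff_def c0 nat_add_distrib field_simps)
  next
    case 4
    define x where "x = real n"
    have x: "x \<ge> 0" by (simp add: x_def)
    have nat: "nat (- (int k - 2)) = 0" "nat (int k - 2) = n + 1" "nat (int k + 2) = n + 5" using 4 by auto
    have A: "A_coeff (k - 2) = - ((x - 1)\<^sup>2 / (4 * (x + 1)))" and B: "B_coeff (k + 2) = (x + 7) * (x + 3) / (4 * (x + 5))"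
      using 4 by (simp_all add: A_coeff_def B_coeff_def x_def algebra_simps)
    define u w where "u = Re (q * cnj (fhat f (n + 5)))" and "w = Re (q * cnj (fhat f (n + 1)))"
    have l: "- (int k - 2) \<noteq> 0" "\<not> - (int k - 2) > 0" "- (- (int k - 2)) = int (n + 1)"
      and m: "- (int k + 2) \<noteq> 0" "\<not> - (int k + 2) > 0" "- (- (int k + 2)) = int (n + 5)" using 4 by auto
    have Fl: "fourier_coeff g (- (int k - 2)) = cnj (fhat g (n + 1)) / 2"
      and Fm: "fourier_coeff g (- (int k + 2)) = cnj (fhat g (n + 5)) / 2" for g
      using fourier_coeff_eq_fhat[of g "- (int k - 2)"] fourier_coeff_eq_fhat[of g "- (int k + 2)"] l m
      by (simp_all only: if_False nat_int)
    have eqs: "Re (q * (cnj (fhat f (n + 5)) / 2)) = u / 2" "Re (q * (cnj (fhat f (n + 1)) / 2)) = w / 2"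
      "Re (\<i> * q * (cnj (fhat h (n + 5)) / 2)) = - u / 2" "Re (\<i> * q * (cnj (fhat h (n + 1)) / 2)) = - w / 2"
      "Re (q * (cnj (fhat v (n + 5)) / 2)) = - u / (2 * (x + 5))" "Re (q * (cnj (fhat v (n + 1)) / 2)) = - w / (2 * (x + 1))"
      unfolding u_def w_def fh fv x_def
      by (simp_all add: hilbert_mult_def velocity_mult_def complex_eq_iff divide_simps Re_divide_of_nat del: of_nat_Suc)
         (simp_all add: algebra_simps)
    have "symbol (fhat f) k = of_real (A_coeff (k - 2)) * fhat f (n + 1) + of_real (B_coeff (k + 2)) * fhat f (n + 5)"
    proof -
      have kk: "k - 2 = n + 1" "k + 2 = n + 5" "k \<noteq> 1" "k \<noteq> 2" using 4 by auto
      show ?thesis unfolding symbol_def kk(1,2) using kk(3,4) by simp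
    qed
    then have sy: "Re (q * cnj (symbol (fhat f) k)) = A_coeff (k - 2) * w + B_coeff (k + 2) * u"
      unfolding u_def w_def by (simp add: algebra_simps)
    have kx: "real k = x + 3" using 4 by (simp add: x_def)
    show ?thesis
    proof -
      define p r where "p = 1 / (x + 5)" and "r = 1 / (x + 1)"
      have e: "- u / (2 * (x + 5)) = - (p * u) / 2" "- w / (2 * (x + 1)) = - (r * w) / 2"
        by (simp_all add: p_def r_def)
      \<comment> \<open>A_(k-2), and next B_(k+2), in partial fractions. The polynomial part comes
        from the function and its Hilbert transform, the fraction 1/(k-2) or 1/(k+2) from the
        velocity.\<close>
      have a: "- ((x - 1)\<^sup>2 / (4 * (x + 1))) = 1 - (x + 3) / 4 + 1/2 - r"
        using x by (simp add: r_def field_simps power2_eq_square)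
      have b: "(x + 7) * (x + 3) / (4 * (x + 5)) = (x + 3) / 4 + 1 - 1/2 - p"
        using x by (simp add: p_def field_simps)
      show ?thesis
        unfolding pairing_mode_coeffs Fl Fm eqs sy A B unfolding kx a b e by (simp add: field_simps)
    qed
  qed
qed

end

section \<open>Test functions\<close>

lemma continuous_AE_eq_imp_eq:
  fixes f g :: "real \<Rightarrow> real"
  assumes ae: "AE x in lborel. f x = g x" and c: "continuous_on UNIV f" "continuous_on UNIV g"
  shows "f x = g x"
proof -
  have "open {x. f x \<noteq> g x}" using c by (intro open_Collect_neq)
  moreover have "negligible {x. f x \<noteq> g x}"
  proof -
    obtain N where "{x. f x \<noteq> g x} \<subseteq> N" "N \<in> null_sets lborel"
      using ae by (auto simp: eventually_ae_filter)
    then show ?thesis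
      using negligible_iff_null_sets null_sets_completionI negligible_subset by metis
  qed
  ultimately have "{x. f x \<noteq> g x} = {}" using open_not_negligible by blast
  then show ?thesis by blast
qed

lemma set_integral_eq_integral_Icc:
  fixes g :: "real \<Rightarrow> 'a::euclidean_space"
  assumes "continuous_on {a..b} g"
  shows "(LBINT x:{a..b}. g x) = integral {a..b} g"
  by (rule set_borel_integral_eq_integral(2)[OF borel_integrable_atLeastAtMost'[OF assms]])

lemma fourier_coeff_deriv:
  assumes g: "\<And>x. (g has_real_derivative g' x) (at x)" and g': "continuous_on UNIV g'"
    and per: "\<And>x. g (x + 2 * pi) = g x"
  shows "fourier_coeff g' n = \<i> * of_int n * fourier_coeff g n"
proof -
  define e where "e x = cis (- (of_int n * x))" for x
  have gc: "continuous_on UNIV g" using g by (meson DERIV_continuous_on DERIV_subset subset_UNIV)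
  have c1: "continuous_on {-pi..pi} (\<lambda>x. g' x *\<^sub>R e x)" and c2: "continuous_on {-pi..pi} (\<lambda>x. g x *\<^sub>R e x)"
    unfolding e_def by (intro continuous_intros continuous_on_subset[OF g'] continuous_on_subset[OF gc]; simp)+
  have "((\<lambda>x. g' x *\<^sub>R e x + (- \<i> * of_int n) * (g x *\<^sub>R e x)) has_integral (g pi *\<^sub>R e pi - g (-pi) *\<^sub>R e (-pi))) {-pi..pi}"
  proof (rule fundamental_theorem_of_calculus)
    fix x
    have gv: "(g has_derivative (\<lambda>h. g' x * h)) (at x within {-pi..pi})"
      by (rule has_derivative_at_withinI[OF g[of x, unfolded has_field_derivative_def]])
    have "((\<lambda>x. g x *\<^sub>R e x) has_derivative (\<lambda>h. g x *\<^sub>R ((- (of_int n * h)) *\<^sub>R (\<i> * e x)) + (g' x * h) *\<^sub>R e x)) (at x within {-pi..pi})"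
      unfolding e_def by (rule has_derivative_eq_rhs, (rule derivative_intros gv)+) auto
    then show "((\<lambda>x. g x *\<^sub>R e x) has_vector_derivative g' x *\<^sub>R e x + (- \<i> * of_int n) * (g x *\<^sub>R e x)) (at x within {-pi..pi})"
      unfolding has_vector_derivative_def
      by (rule has_derivative_eq_rhs) (auto simp: fun_eq_iff scaleR_conv_of_real algebra_simps)
  qed simp
  moreover have "e pi = e (-pi)" unfolding e_def using cis_periodic[of "- n" "- pi"] by simp
  moreover have "g pi = g (-pi)" using per[of "- pi"] by simp
  ultimately have "((\<lambda>x. g' x *\<^sub>R e x + (- \<i> * of_int n) * (g x *\<^sub>R e x)) has_integral 0) {-pi..pi}" by simp
  moreover have "((\<lambda>x. g' x *\<^sub>R e x + (- \<i> * of_int n) * (g x *\<^sub>R e x)) has_integral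
      (integral {-pi..pi} (\<lambda>x. g' x *\<^sub>R e x) + (- \<i> * of_int n) * integral {-pi..pi} (\<lambda>x. g x *\<^sub>R e x))) {-pi..pi}"
    by (intro has_integral_add has_integral_mult_right integrable_integral integrable_continuous_real c1 c2)
  ultimately have "integral {-pi..pi} (\<lambda>x. g' x *\<^sub>R e x) + (- \<i> * of_int n) * integral {-pi..pi} (\<lambda>x. g x *\<^sub>R e x) = 0"
    using has_integral_unique by blast
  then show ?thesis
    unfolding fourier_coeff_def e_def[symmetric] set_integral_eq_integral_Icc[OF c1] set_integral_eq_integral_Icc[OF c2]
    by (simp add: scaleR_conv_of_real algebra_simps)
qed

lemma fourier_coeff_bound:
  assumes g: "continuous_on {-pi..pi} g" and B: "\<And>x. x \<in> {-pi..pi} \<Longrightarrow> \<bar>g x\<bar> \<le> B"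
  shows "cmod (fourier_coeff g n) \<le> B"
proof -
  have c: "continuous_on {-pi..pi} (\<lambda>x. g x *\<^sub>R cis (- (of_int n * x)))" by (intro continuous_intros g)
  have "cmod (integral {-pi..pi} (\<lambda>x. g x *\<^sub>R cis (- (of_int n * x)))) \<le> B * (pi - - pi)"
    by (rule integral_bound) (use c B in auto)
  then show ?thesis
    unfolding fourier_coeff_def set_integral_eq_integral_Icc[OF c] by (simp add: field_simps)
qed

lemma integral_mult_tser:
  assumes f: "set_integrable lborel {-pi..pi} f" and r: "summable (\<lambda>k. cmod (r k))"
  shows "(\<lambda>k. 2 * pi * Re (r k * cnj (fourier_coeff f (int k)))) sums (LBINT x:{-pi..pi}. f x * tser r x)"
proof -
  have "(\<lambda>k. LBINT x:{-pi..pi}. f x * Re (r k * cis (real k * x))) sums (LBINT x:{-pi..pi}. f x * (\<Sum>k. Re (r k * cis (real k * x))))"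
  proof (rule set_integral_mult_suminf[OF f _ _ r])
    show "(\<lambda>x. Re (r k * cis (real k * x))) \<in> borel_measurable lborel" for k
    proof -
      have "(\<lambda>x. Re (r k * cis (real k * x))) \<in> borel_measurable borel"
        by (intro borel_measurable_continuous_onI continuous_intros)
      then show ?thesis by simp
    qed
  qed (simp only: real_norm_def tser_term_le)
  moreover have "(LBINT x:{-pi..pi}. f x * Re (r k * cis (real k * x))) = 2 * pi * Re (r k * cnj (fourier_coeff f (int k)))" for k
    using fourier_pairing[OF f, of "r k" "int k"] unfolding fourier_coeff_uminus by (simp only: of_int_of_nat_eq)
  ultimately show ?thesis by (simp only: tser_def)
qed

context sobolev_velocity
begin

text \<open>Two fixed integrable functions, \<open>W1\<close> and \<open>W2\<close>, meet absolutely
  convergent series. So the pairing is expanded in the test function alone, without differentiating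
  \<open>f\<close>.\<close>

lemma pairing_tser:
  assumes r: "summable (\<lambda>k. real k * cmod (r k))"
  shows "(\<lambda>k. pi * Re (r k * cnj (symbol (fhat f) k))) sums L2_pairing f v (tser r)"
proof -
  let ?r' = "\<lambda>k. \<i> * of_nat k * r k"
  have r0: "summable (\<lambda>k. cmod (r k))" by (rule weighted_summable_cmod[OF r])
  have r1: "summable (\<lambda>k. cmod (?r' k))" using r by (simp add: norm_mult)
  have "L2_pairing f v (tser r) = (LBINT x:{-pi..pi}. W1 x * tser ?r' x) + (LBINT x:{-pi..pi}. W2 x * tser r x)"
    by (rule pairing_split[OF tser_has_derivative[OF r] tser_measurable[OF r0] tser_measurable[OF r1] tser_bound[OF r0] tser_bound[OF r1]])
  moreover have "L2_pairing f v (\<lambda>x. Re (r k * cis (real k * x))) =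
      2 * pi * Re (?r' k * cnj (fourier_coeff W1 (int k))) + 2 * pi * Re (r k * cnj (fourier_coeff W2 (int k)))" for k
  proof -
    have m: "(\<lambda>x. Re (q * cis (real k * x))) \<in> borel_measurable borel" for q
      by (intro borel_measurable_continuous_onI continuous_intros)
    have "L2_pairing f v (\<lambda>x. Re (r k * cis (real k * x))) =
       (LBINT x:{-pi..pi}. W1 x * Re (?r' k * cis (real k * x))) + (LBINT x:{-pi..pi}. W2 x * Re (r k * cis (real k * x)))"
      by (rule pairing_split[OF _ m m tser_term_le tser_term_le])
         (auto intro!: derivative_eq_intros simp: algebra_simps)
    then show ?thesis
      using fourier_pairing[OF W1_integrable, of "?r' k" "int k"] fourier_pairing[OF W2_integrable, of "r k" "int k"]
      unfolding fourier_coeff_uminus by (simp only: of_int_of_nat_eq)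
  qed
  ultimately show ?thesis
    unfolding pairing_mode[symmetric]
    using sums_add[OF integral_mult_tser[OF W1_integrable r1] integral_mult_tser[OF W2_integrable r0]] by simp
qed

end

text \<open>Compact support in time is kept as vanishing at 0 and T, the form in which integration
  by parts uses it.\<close>

locale periodic_test_function =
  fixes T :: real and \<psi> :: "real \<Rightarrow> real \<Rightarrow> real" and D :: "nat \<Rightarrow> nat \<Rightarrow> real \<Rightarrow> real \<Rightarrow> real"
  assumes D0: "D 0 0 = \<psi>"
    and Dcont: "\<And>i j. continuous_on UNIV (\<lambda>(t, x). D i j t x)"
    and Dt: "\<And>i j t x. ((\<lambda>r. D i j r x) has_real_derivative D (Suc i) j t x) (at t)"
    and Dx: "\<And>i j t x. (D i j t has_real_derivative D i (Suc j) t x) (at x)"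
    and per: "\<And>t x. \<psi> t (x + 2 * pi) = \<psi> t x"
    and T: "0 < T" and ends: "\<And>x. \<psi> 0 x = 0" "\<And>x. \<psi> T x = 0"
begin

lemma D_periodic: "D i j t (x + 2 * pi) = D i j t x"
proof -
  have 0: "D i 0 t (x + 2 * pi) = D i 0 t x" for i t x
  proof (induction i arbitrary: t x)
    case (Suc i)
    have "(\<lambda>r. D i 0 r (x + 2 * pi)) = (\<lambda>r. D i 0 r x)" using Suc by auto
    then show ?case using DERIV_unique[OF Dt[of i 0 "x + 2 * pi" t]] Dt[of i 0 x t] by auto
  qed (simp add: D0 per)
  show ?thesis
  proof (induction j arbitrary: x)
    case (Suc j)
    have "((\<lambda>x. D i j t (x + 2 * pi)) has_real_derivative D i (Suc j) t (x + 2 * pi)) (at x)"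
      using DERIV_shift[of "D i j t"] Dx by blast
    moreover have "(\<lambda>x. D i j t (x + 2 * pi)) = D i j t" using Suc by auto
    ultimately show ?case using DERIV_unique[OF Dx[of i j t x]] by simp
  qed (rule 0)
qed

lemma D_cont_x: "continuous_on UNIV (D i j t)"
  using Dx by (meson DERIV_continuous_on DERIV_subset subset_UNIV)

definition r :: "nat \<Rightarrow> real \<Rightarrow> nat \<Rightarrow> complex" where "r i t k = fhat (D i 0 t) k"

text \<open>Three spatial derivatives, bounded on a compact rectangle, give decay k^-3 uniformly in
  time. Against the linear growth of the mode equations this leaves a summable k^-2.\<close>

lemma coeff_decay:
  obtains B where "\<And>t k. t \<in> {0..T} \<Longrightarrow> real k ^ 3 * cmod (r i t k) \<le> B" "B \<ge> 0"
proof -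
  have "compact ((\<lambda>(t, x). D i 3 t x) ` ({0..T} \<times> {-pi..pi}))"
    by (intro compact_continuous_image continuous_on_subset[OF Dcont] compact_Times compact_Icc) auto
  then obtain B where B: "\<And>t x. t \<in> {0..T} \<Longrightarrow> x \<in> {-pi..pi} \<Longrightarrow> \<bar>D i 3 t x\<bar> \<le> B"
    by (force simp: bounded_iff dest!: compact_imp_bounded)
  have "0 \<le> B" using B[of 0 0] T by force
  have "real k ^ 3 * cmod (r i t k) \<le> 2 * B" if t: "t \<in> {0..T}" for t k
  proof -
    have step: "cmod (fourier_coeff (D i (Suc j) t) (int k)) = real k * cmod (fourier_coeff (D i j t) (int k))" for j
      by (subst fourier_coeff_deriv[OF Dx D_cont_x D_periodic]) (simp add: norm_mult)
    have "cmod (fourier_coeff (D i 3 t) (int k)) = real k ^ 3 * cmod (fourier_coeff (D i 0 t) (int k))"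
      by (simp only: numeral_3_eq_3 step power_Suc power_0 mult_1_right mult.assoc)
    moreover have "cmod (fourier_coeff (D i 3 t) (int k)) \<le> B"
      by (intro fourier_coeff_bound continuous_on_subset[OF D_cont_x] B t) auto
    moreover have "cmod (r i t k) \<le> 2 * cmod (fourier_coeff (D i 0 t) (int k))"
      by (simp add: r_def fhat_def norm_mult)
    then have "real k ^ 3 * cmod (r i t k) \<le> real k ^ 3 * (2 * cmod (fourier_coeff (D i 0 t) (int k)))"
      by (intro mult_left_mono) auto
    ultimately show ?thesis by simp
  qed
  then show ?thesis using \<open>0 \<le> B\<close> by (intro that[of "2 * B"]) auto
qed

lemma coeff_summable:
  assumes "t \<in> {0..T}"
  shows "summable (\<lambda>k. real k * cmod (r i t k))"
proof -
  obtain B where B: "\<And>t k. t \<in> {0..T} \<Longrightarrow> real k ^ 3 * cmod (r i t k) \<le> B" using coeff_decay by blast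
  show ?thesis
  proof (rule summable_comparison_test')
    show "summable (\<lambda>k. B * inverse (real k ^ 2))" by (intro summable_mult inverse_power_summable) simp
    show "norm (real k * cmod (r i t k)) \<le> B * inverse (real k ^ 2)" if "k \<ge> 1" for k
      using B[OF assms, of k] that by (simp add: field_simps power2_eq_square power3_eq_cube)
  qed
qed

lemma D_eq_tser:
  assumes "t \<in> {0..T}"
  shows "D i 0 t = tser (r i t)"
proof
  fix x
  have s: "summable (\<lambda>k. cmod (fhat (D i 0 t) k))"
    using weighted_summable_cmod[OF coeff_summable[OF assms]] by (simp add: r_def)
  show "D i 0 t x = tser (r i t) x"
    unfolding r_def
    by (rule continuous_AE_eq_imp_eq[OF AE_eq_tser D_cont_x tser_continuous[OF s]])
       (auto intro: s borel_integrable_atLeastAtMost' continuous_on_subset[OF D_cont_x] D_periodic)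
qed

lemma coeff_has_derivative: "((\<lambda>t. r i t k) has_vector_derivative r (Suc i) t k) (at t)"
proof -
  define e where "e x = cis (- (of_int (int k) * x))" for x
  define \<kappa> where "\<kappa> = (if k = 0 then 1 else 2) / (2 * pi)"
  have ec: "continuous_on UNIV e" unfolding e_def by (intro continuous_intros)
  have c: "continuous_on {-pi..pi} (\<lambda>x. D i 0 t x *\<^sub>R e x)" for i t
    by (intro continuous_intros continuous_on_subset[OF D_cont_x] continuous_on_subset[OF ec]) auto
  have "((\<lambda>t. integral (cbox (-pi) pi) (\<lambda>x. D i 0 t x *\<^sub>R e x)) has_vector_derivative
      integral (cbox (-pi) pi) (\<lambda>x. D (Suc i) 0 t x *\<^sub>R e x)) (at t within UNIV)"
  proof (rule leibniz_rule_vector_derivative[where U = UNIV])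
    show "((\<lambda>t. D i 0 t x *\<^sub>R e x) has_vector_derivative D (Suc i) 0 t x *\<^sub>R e x) (at t within UNIV)" for t x
      using bounded_linear.has_vector_derivative[OF bounded_linear_scaleR_left, of "\<lambda>t. D i 0 t x"] Dt[of i 0 x t]
      by (simp add: has_real_derivative_iff_has_vector_derivative)
    show "(\<lambda>x. D i 0 t x *\<^sub>R e x) integrable_on cbox (-pi) pi" for t
      using integrable_continuous_real[OF c] by simp
    have "continuous_on (UNIV \<times> cbox (-pi) pi) (\<lambda>z. (case z of (t, x) \<Rightarrow> D (Suc i) 0 t x) *\<^sub>R e (snd z))"
      by (intro continuous_intros continuous_on_subset[OF Dcont] continuous_on_compose2[OF ec]) auto
    then show "continuous_on (UNIV \<times> cbox (-pi) pi) (\<lambda>(t, x). D (Suc i) 0 t x *\<^sub>R e x)"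
      by (simp add: case_prod_beta)
  qed auto
  then have "((\<lambda>t. complex_of_real \<kappa> * integral {-pi..pi} (\<lambda>x. D i 0 t x *\<^sub>R e x)) has_vector_derivative
      complex_of_real \<kappa> * integral {-pi..pi} (\<lambda>x. D (Suc i) 0 t x *\<^sub>R e x)) (at t)"
    by (intro has_vector_derivative_mult_right) simp
  moreover have "r i t k = complex_of_real \<kappa> * integral {-pi..pi} (\<lambda>x. D i 0 t x *\<^sub>R e x)" for i t
    unfolding r_def fhat_def fourier_coeff_def e_def[symmetric] set_integral_eq_integral_Icc[OF c]
    by (cases "k = 0") (simp_all add: \<kappa>_def scaleR_conv_of_real field_simps)
  ultimately show ?thesis by simp
qed

lemma coeff_ends: "r 0 0 k = 0" "r 0 T k = 0"
  using ends by (simp_all add: r_def D0 fhat_def fourier_coeff_def)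

end

lemma test_function_imp:
  assumes "test_function T \<psi>" and T: "0 < T"
  obtains D where "periodic_test_function T \<psi> D"
proof -
  obtain D where D: "D 0 0 = \<psi>" "\<forall>i j. continuous_on UNIV (\<lambda>(t, \<theta>). D i j t \<theta>) \<and>
      (\<forall>t \<theta>. ((\<lambda>r. D i j r \<theta>) has_real_derivative D (Suc i) j t \<theta>) (at t) \<and>
               ((\<lambda>x. D i j t x) has_real_derivative D i (Suc j) t \<theta>) (at \<theta>))"
    using assms unfolding test_function_def smooth2_def by blast
  obtain a b where ab: "0 < a" "b < T" "\<And>t \<theta>. t \<notin> {a..b} \<Longrightarrow> \<psi> t \<theta> = 0"
    using assms unfolding test_function_def by blast
  have "periodic_test_function T \<psi> D"
  proof
    show "\<psi> t (x + 2 * pi) = \<psi> t x" for t x using assms(1) by (simp add: test_function_def)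
    show "\<psi> 0 x = 0" "\<psi> T x = 0" for x using ab by auto
  qed (use D T in auto)
  then show ?thesis by (rule that)
qed

section \<open>Mode solutions solve the equation\<close>

lemma Re_symbol: "Re (symbol c k) = mode_rhs 1 (\<lambda>j. Re (c j)) k + (if k = 2 then Re (c 0) else 0)"
  by (simp add: symbol_def mode_rhs_def)

lemma Im_symbol: "Im (symbol c k) = mode_rhs (- 1) (\<lambda>j. Im (c j)) k + (if k = 2 then Im (c 0) else 0)"
  by (simp add: symbol_def mode_rhs_def)

text \<open>Real and zero at index 0: an equation \<open>fhat f = cos_hat a\<close> thus expresses
  evenness and zero mean as well.\<close>

definition cos_hat :: "(nat \<Rightarrow> real) \<Rightarrow> nat \<Rightarrow> complex" where
  "cos_hat a k = (if k = 0 then 0 else of_real (a k))"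

lemma cos_hat_0 [simp]: "cos_hat a 0 = 0" by (simp add: cos_hat_def)

section \<open>Cosine sums in square mean and Fourier coefficients\<close>

lemma tser_cos_partial: "(\<Sum>k<Suc N. Re (cos_hat a k * cis (real k * x))) = (\<Sum>k=1..N. a k * cos (real k * x))"
proof -
  have "(\<Sum>k<Suc N. Re (cos_hat a k * cis (real k * x))) = (\<Sum>k\<in>{1..N}. Re (cos_hat a k * cis (real k * x)))"
    by (rule sum.mono_neutral_right) (auto simp: cos_hat_def)
  also have "\<dots> = (\<Sum>k=1..N. a k * cos (real k * x))"
    by (rule sum.cong) (auto simp: cos_hat_def)
  finally show ?thesis .
qed

lemma fourier_coeff_cos_partial:
  "fourier_coeff (\<lambda>x. \<Sum>k=1..N. a k * cos (real k * x)) (int n) = (if n \<in> {1..N} then of_real (a n) / 2 else 0)"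
proof -
  define c where "c k = (if k < Suc N then cos_hat a k else 0)" for k
  have fin: "finite {k. c k \<noteq> 0}" by (rule finite_subset[of _ "{..<Suc N}"]) (auto simp: c_def)
  have "(\<lambda>x. \<Sum>k=1..N. a k * cos (real k * x)) = tser c"
  proof
    fix x
    have "tser c x = (\<Sum>k<Suc N. Re (c k * cis (real k * x)))"
      unfolding tser_def by (rule suminf_finite) (auto simp: c_def)
    also have "\<dots> = (\<Sum>k<Suc N. Re (cos_hat a k * cis (real k * x)))" by (simp add: c_def)
    finally show "(\<Sum>k=1..N. a k * cos (real k * x)) = tser c x" by (simp only: tser_cos_partial)
  qed
  moreover have "summable (\<lambda>k. cmod (c k))"
    by (rule summable_finite[of "{..<Suc N}"]) (auto simp: c_def)
  ultimately show ?thesis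
    using fourier_coeff_tser[of c n] by (auto simp: c_def cos_hat_def)
qed

text \<open>An additive substitute for the Cauchy-Schwarz inequality, from |y| \<le> e + y^2/e. In
  applications the square mean tends to 0 first, and e afterwards.\<close>

lemma fourier_coeff_bound_L2:
  assumes g: "set_integrable lborel {-pi..pi} g" "set_integrable lborel {-pi..pi} (\<lambda>x. (g x)\<^sup>2)" and e: "e > 0"
  shows "cmod (fourier_coeff g n) \<le> e + (LBINT x:{-pi..pi}. (g x)\<^sup>2) / e"
proof -
  have AM: "\<bar>y\<bar> \<le> e + y\<^sup>2 / e" for y
  proof -
    have "2 * (e * \<bar>y\<bar>) \<le> e\<^sup>2 + y\<^sup>2" using sum_squares_bound[of e "\<bar>y\<bar>"] by simp
    moreover have "0 \<le> e * \<bar>y\<bar>" using e by simp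
    ultimately have "e * \<bar>y\<bar> \<le> e\<^sup>2 + y\<^sup>2" by linarith
    then show ?thesis using e by (simp add: field_simps power2_eq_square)
  qed
  have "cmod (LBINT x:{-pi..pi}. g x *\<^sub>R cis (- (of_int n * x))) \<le> (LBINT x:{-pi..pi}. e + (g x)\<^sup>2 / e)"
    unfolding set_lebesgue_integral_def
  proof (rule Bochner_Integration.integral_norm_bound_integral)
    show "integrable lborel (\<lambda>x. indicator {-pi..pi} x *\<^sub>R g x *\<^sub>R cis (- (of_int n * x)))"
      using set_integrable_scaleR_cis[OF g(1), of "- of_int n"] by (simp add: set_integrable_def)
    show "integrable lborel (\<lambda>x. indicat_real {-pi..pi} x *\<^sub>R (e + (g x)\<^sup>2 / e))"
      unfolding set_integrable_def[symmetric]
      by (intro set_integral_add(1) set_integrable_divide g borel_integrable_atLeastAtMost' continuous_intros)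
    show "norm (indicator {-pi..pi} x *\<^sub>R g x *\<^sub>R cis (- (of_int n * x))) \<le> indicat_real {-pi..pi} x *\<^sub>R (e + (g x)\<^sup>2 / e)" for x
      using AM[of "g x"] by (auto simp: indicator_def)
  qed
  also have "\<dots> = (LBINT x:{-pi..pi}. e) + (LBINT x:{-pi..pi}. (g x)\<^sup>2 / e)"
    by (intro set_integral_add(2) set_integrable_divide g borel_integrable_atLeastAtMost' continuous_intros)
  also have "\<dots> = 2 * pi * e + (LBINT x:{-pi..pi}. (g x)\<^sup>2) / e"
    by (simp add: set_integral_const)
  also have "\<dots> \<le> 2 * pi * (e + (LBINT x:{-pi..pi}. (g x)\<^sup>2) / e)"
  proof -
    have "0 \<le> (LBINT x:{-pi..pi}. (g x)\<^sup>2)"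
      unfolding set_lebesgue_integral_def by (intro integral_nonneg_AE) auto
    then have "1 * ((LBINT x:{-pi..pi}. (g x)\<^sup>2) / e) \<le> 2 * pi * ((LBINT x:{-pi..pi}. (g x)\<^sup>2) / e)"
      using e pi_gt3 by (intro mult_right_mono) auto
    then show ?thesis by (simp add: algebra_simps)
  qed
  finally show ?thesis
    by (simp add: fourier_coeff_def field_simps)
qed

lemma cosine_sums_imp_fhat:
  assumes f: "in_sobolev s f" and a: "cosine_sums a f"
  shows "fhat f = cos_hat a"
proof
  fix n
  define S where "S N x = (\<Sum>k=1..N. a k * cos (real k * x))" for N x
  have fi: "set_integrable lborel {-pi..pi} f" by (rule in_sobolev_set_integrable[OF f])
  have Sc: "continuous_on UNIV (S N)" for N unfolding S_def by (intro continuous_intros)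
  have Si: "set_integrable lborel {-pi..pi} (S N)" for N
    by (intro borel_integrable_atLeastAtMost' continuous_on_subset[OF Sc]) auto
  have f2: "set_integrable lborel {-pi..pi} (\<lambda>x. (f x)\<^sup>2)" using f by (simp add: in_sobolev_def)
  have fS2: "set_integrable lborel {-pi..pi} (\<lambda>x. (f x - S N x)\<^sup>2)" for N
  proof -
    obtain B where B: "\<And>x. \<bar>S N x\<bar> \<le> B"
    proof
      show "\<bar>S N x\<bar> \<le> (\<Sum>k=1..N. \<bar>a k\<bar>)" for x
        unfolding S_def by (intro order_trans[OF sum_abs] sum_mono) (auto simp: abs_mult mult_left_le)
    qed
    have "set_integrable lborel {-pi..pi} (\<lambda>x. (f x)\<^sup>2 - 2 * (f x * S N x) + (S N x)\<^sup>2)"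
      using borel_measurable_continuous_onI[OF Sc] B
      by (intro set_integral_add(1) set_integral_diff(1) set_integrable_mult_right f2 set_integrable_mult_bounded[OF fi, where B = B]
          borel_integrable_atLeastAtMost' continuous_intros continuous_on_subset[OF Sc]) auto
    then show ?thesis by (simp add: power2_diff algebra_simps)
  qed
  define d where "d = cmod (fourier_coeff f (int n) - (if n = 0 then 0 else of_real (a n) / 2))"
  have le: "d \<le> e + (LBINT x:{-pi..pi}. (f x - S N x)\<^sup>2) / e" if "N \<ge> n" "e > 0" for N e
  proof -
    have "fourier_coeff (\<lambda>x. f x - S N x) (int n) = fourier_coeff f (int n) - (if n = 0 then 0 else of_real (a n) / 2)"
      using fourier_coeff_diff[OF fi Si[of N]] fourier_coeff_cos_partial[of a N n] that(1)
      by (auto simp: S_def[abs_def])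
    then show ?thesis
      using fourier_coeff_bound_L2[OF set_integral_diff(1)[OF fi Si] fS2 that(2), of N "int n"] by (simp add: d_def)
  qed
  have "d \<le> 0 + e" if e: "e > 0" for e
  proof (rule LIMSEQ_le_const)
    have "(\<lambda>N. LBINT x:{-pi..pi}. (f x - S N x)\<^sup>2) \<longlonglongrightarrow> 0"
      using a unfolding cosine_sums_def S_def .
    then have "(\<lambda>N. e + (LBINT x:{-pi..pi}. (f x - S N x)\<^sup>2) / e) \<longlonglongrightarrow> e + 0 / e"
      using e by (intro tendsto_intros) auto
    then show "(\<lambda>N. e + (LBINT x:{-pi..pi}. (f x - S N x)\<^sup>2) / e) \<longlonglongrightarrow> 0 + e" by simp
    show "\<exists>N0. \<forall>N\<ge>N0. d \<le> e + (LBINT x:{-pi..pi}. (f x - S N x)\<^sup>2) / e" using le e by blast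
  qed
  then have "d \<le> 0" by (rule field_le_epsilon)
  then have "fourier_coeff f (int n) = (if n = 0 then 0 else of_real (a n) / 2)" by (simp add: d_def)
  then show "fhat f n = cos_hat a n" by (simp add: fhat_def cos_hat_def)
qed

text \<open>In H^(3/2) the series converges uniformly, so the square mean is eventually at most 2 pi
  d^2, which is e/2 for the chosen d.\<close>

lemma cosine_sums_if_fhat:
  assumes f: "in_sobolev (3/2) f" and a: "fhat f = cos_hat a"
  shows "cosine_sums a f"
proof -
  define S where "S N x = (\<Sum>k=1..N. a k * cos (real k * x))" for N x
  have Sc: "continuous_on UNIV (S N)" for N unfolding S_def by (intro continuous_intros)
  note c = fhat_summable[OF f]
  have eq: "(LBINT x:{-pi..pi}. (f x - S N x)\<^sup>2) = (LBINT x:{-pi..pi}. (tser (fhat f) x - S N x)\<^sup>2)" for N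
    unfolding set_lebesgue_integral_def
  proof (rule integral_cong_AE)
    have [measurable]: "f \<in> borel_measurable borel" "tser (fhat f) \<in> borel_measurable borel" "S N \<in> borel_measurable borel"
      using f tser_measurable[OF c] borel_measurable_continuous_onI[OF Sc] by (auto simp: in_sobolev_def)
    show "(\<lambda>x. indicator {-pi..pi} x *\<^sub>R (f x - S N x)\<^sup>2) \<in> borel_measurable lborel"
      "(\<lambda>x. indicator {-pi..pi} x *\<^sub>R (tser (fhat f) x - S N x)\<^sup>2) \<in> borel_measurable lborel" by measurable
    show "AE x in lborel. indicator {-pi..pi} x *\<^sub>R (f x - S N x)\<^sup>2 = indicator {-pi..pi} x *\<^sub>R (tser (fhat f) x - S N x)\<^sup>2"
      using in_sobolev_AE_eq_tser[OF f] by eventually_elim simp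
  qed
  have lim: "uniform_limit UNIV S (tser (fhat f)) sequentially"
  proof -
    have "S = (\<lambda>N x. \<Sum>k<Suc N. Re (fhat f k * cis (real k * x)))"
      unfolding S_def a tser_cos_partial ..
    moreover have "uniform_limit UNIV (\<lambda>N x. \<Sum>k<Suc N. Re (fhat f k * cis (real k * x))) (tser (fhat f)) sequentially"
      by (rule filterlim_compose[OF tser_uniform_limit[OF c] filterlim_Suc])
    ultimately show ?thesis by simp
  qed
  have "(\<lambda>N. LBINT x:{-pi..pi}. (f x - S N x)\<^sup>2) \<longlonglongrightarrow> 0"
    unfolding eq
  proof (rule LIMSEQ_I)
    fix e :: real assume e: "e > 0"
    define d where "d = sqrt (e / (4 * pi))"
    have d: "d > 0" "d\<^sup>2 = e / (4 * pi)" using e by (auto simp: d_def)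
    obtain N0 where N0: "\<And>N x. N \<ge> N0 \<Longrightarrow> \<bar>S N x - tser (fhat f) x\<bar> < d"
      using uniform_limitD[OF lim d(1)] by (auto simp: eventually_sequentially dist_real_def)
    show "\<exists>N0. \<forall>N\<ge>N0. norm ((LBINT x:{-pi..pi}. (tser (fhat f) x - S N x)\<^sup>2) - 0) < e"
    proof (intro exI[of _ N0] allI impI)
      fix N assume N: "N \<ge> N0"
      have cc: "continuous_on {-pi..pi} (\<lambda>x. (tser (fhat f) x - S N x)\<^sup>2)"
        by (intro continuous_intros continuous_on_subset[OF tser_continuous[OF c]] continuous_on_subset[OF Sc]) auto
      have "norm (integral {-pi..pi} (\<lambda>x. (tser (fhat f) x - S N x)\<^sup>2)) \<le> d\<^sup>2 * (pi - - pi)"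
      proof (rule integral_bound)
        show "norm ((tser (fhat f) x - S N x)\<^sup>2) \<le> d\<^sup>2" for x
          using power_mono[of "\<bar>S N x - tser (fhat f) x\<bar>" d 2] N0[OF N, of x] by (simp add: power2_commute)
      qed (use cc in auto)
      also have "\<dots> < e" using e d(2) by (simp add: field_simps)
      finally show "norm ((LBINT x:{-pi..pi}. (tser (fhat f) x - S N x)\<^sup>2) - 0) < e"
        by (simp add: set_integral_eq_integral_Icc[OF cc])
    qed
  qed
  then show ?thesis unfolding cosine_sums_def S_def .
qed

section \<open>The time-dependent function built from a mode solution\<close>

lemma tser_diff:
  assumes "summable (\<lambda>k. cmod (c k))" "summable (\<lambda>k. cmod (d k))"
  shows "tser c x - tser d x = tser (\<lambda>k. c k - d k) x"
  unfolding tser_def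
  by (subst suminf_diff[OF tser_summable tser_summable]) (auto simp: assms algebra_simps)

lemma cmod_cos_hat: "real k ^ 3 * (cmod (cos_hat a k))\<^sup>2 = real k ^ 3 * (a k)\<^sup>2"
  by (simp add: cos_hat_def)

context mode_solution
begin

definition field :: "real \<Rightarrow> real \<Rightarrow> real" where
  "field t = tser (cos_hat (\<lambda>k. y k t))"

lemma field_sobolev: "t \<in> {0..T} \<Longrightarrow> in_sobolev (3/2) (field t)"
  unfolding field_def
  by (intro in_sobolev_tser(1)) (simp_all only: cmod_cos_hat summable_weighted cos_hat_0 zero_complex.sel)

lemma cos_hat_summable: "t \<in> {0..T} \<Longrightarrow> summable (\<lambda>k. cmod (cos_hat (\<lambda>k. y k t) k))"
  using weighted_imp_summable[of "\<lambda>k. cmod (cos_hat (\<lambda>k. y k t) k)"] summable_weighted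
  by (simp add: cmod_cos_hat)

lemma fhat_field: "t \<in> {0..T} \<Longrightarrow> fhat (field t) = cos_hat (\<lambda>k. y k t)"
  unfolding field_def by (intro fhat_tser cos_hat_summable) auto

lemma field_in_C_sobolev: "in_C_sobolev T (3/2) field"
  unfolding in_C_sobolev_def
proof (intro conjI ballI field_sobolev)
  fix t assume t: "t \<in> {0..T}"
  show "((\<lambda>s. sobolev_norm (3/2) (\<lambda>\<theta>. field s \<theta> - field t \<theta>)) \<longlongrightarrow> 0) (at t within {0..T})"
  proof (rule real_tendsto_sandwich)
    have nonneg: "0 \<le> sobolev_norm (3/2) g" for g
      unfolding sobolev_norm_def by (simp add: infsum_nonneg)
    then show "\<forall>\<^sub>F s in at t within {0..T}. 0 \<le> sobolev_norm (3/2) (\<lambda>\<theta>. field s \<theta> - field t \<theta>)" by simp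
    have "((\<lambda>s. sqrt (2 * (\<Sum>k. real k ^ 3 * (y k s - y k t)\<^sup>2))) \<longlongrightarrow> sqrt (2 * 0)) (at t within {0..T})"
      by (intro tendsto_intros weighted_continuous t)
    then show "((\<lambda>s. sqrt (2 * (\<Sum>k. real k ^ 3 * (y k s - y k t)\<^sup>2))) \<longlongrightarrow> 0) (at t within {0..T})" by simp
    have "sobolev_norm (3/2) (\<lambda>\<theta>. field s \<theta> - field t \<theta>) \<le> sqrt (2 * (\<Sum>k. real k ^ 3 * (y k s - y k t)\<^sup>2))"
      if s: "s \<in> {0..T}" for s
    proof -
      define d where "d = cos_hat (\<lambda>k. y k s - y k t)"
      have "d = (\<lambda>k. cos_hat (\<lambda>k. y k s) k - cos_hat (\<lambda>k. y k t) k)"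
        by (auto simp: d_def cos_hat_def)
      then have eq: "(\<lambda>\<theta>. field s \<theta> - field t \<theta>) = tser d"
        unfolding field_def by (simp only: tser_diff[OF cos_hat_summable[OF s] cos_hat_summable[OF t]])
      have w: "summable (\<lambda>k. real k ^ 3 * (cmod (d k))\<^sup>2)"
      proof (rule summable_comparison_test')
        show "summable (\<lambda>k. 2 * (real k ^ 3 * (y k s)\<^sup>2) + 2 * (real k ^ 3 * (y k t)\<^sup>2))"
          by (intro summable_add summable_mult summable_weighted s t)
        from mult_left_mono[OF square_diff_le[of "y _ s" "y _ t"], of "real _ ^ 3"]
        show "norm (real k ^ 3 * (cmod (d k))\<^sup>2) \<le> 2 * (real k ^ 3 * (y k s)\<^sup>2) + 2 * (real k ^ 3 * (y k t)\<^sup>2)" for k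
          by (auto simp: d_def cmod_cos_hat algebra_simps)
      qed
      have "(sobolev_norm (3/2) (tser d))\<^sup>2 \<le> 2 * (\<Sum>k. real k ^ 3 * (y k s - y k t)\<^sup>2)"
        using in_sobolev_tser(2)[OF w] by (simp add: d_def cmod_cos_hat)
      then show ?thesis unfolding eq by (rule real_le_rsqrt)
    qed
    then show "\<forall>\<^sub>F s in at t within {0..T}. sobolev_norm (3/2) (\<lambda>\<theta>. field s \<theta> - field t \<theta>) \<le> sqrt (2 * (\<Sum>k. real k ^ 3 * (y k s - y k t)\<^sup>2))"
      by (simp add: eventually_at_filter)
  qed simp
qed

lemma mode_bound:
  assumes t: "t \<in> {0..T}" and k: "k \<ge> 1"
  shows "\<bar>y k t\<bar> \<le> 1 + K"
proof -
  have "(y k t)\<^sup>2 \<le> real k ^ 3 * (y k t)\<^sup>2"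
    using k mult_right_mono[of 1 "real k ^ 3" "(y k t)\<^sup>2"] by simp
  also have "\<dots> \<le> (\<Sum>j\<le>k. real j ^ 3 * (y j t)\<^sup>2)"
    by (rule member_le_sum) auto
  also have "\<dots> \<le> K" by (rule bound[OF t])
  finally have "\<bar>y k t\<bar>\<^sup>2 \<le> K" by simp
  moreover have "\<bar>y k t\<bar> \<le> 1 + \<bar>y k t\<bar>\<^sup>2"
    using zero_le_power2[of "\<bar>y k t\<bar> - 1"] by (simp add: power2_diff)
  ultimately show ?thesis by linarith
qed

lemma rhs_bound:
  assumes t: "t \<in> {0..T}" and k: "k \<ge> 1" and \<sigma>: "\<bar>\<sigma>\<bar> \<le> 1"
  shows "\<bar>mode_rhs \<sigma> (\<lambda>j. y j t) k\<bar> \<le> 3 * real k * (1 + K)"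
proof -
  have K: "0 \<le> 1 + K" using mode_bound[OF t k] by linarith
  \<comment> \<open>\<open>mode_bound\<close> controls positive indices, whereas
    \<open>mode_rhs_bound\<close> asks for all of them; index 0 may be zeroed since A_0 = 0.\<close>
  have "mode_rhs \<sigma> (\<lambda>j. y j t) k = mode_rhs \<sigma> (\<lambda>j. if j = 0 then 0 else y j t) k"
    using A_coeff_0 by (cases "k - 2 = 0") (simp_all add: mode_rhs_def)
  then have "\<bar>mode_rhs \<sigma> (\<lambda>j. y j t) k\<bar> \<le> (\<bar>A_coeff (k - 2)\<bar> + \<bar>B_coeff (k + 2)\<bar> + \<bar>\<sigma>\<bar>) * (1 + K)"
    using mode_bound[OF t] K by (simp only:) (rule mode_rhs_bound, auto)
  also have "\<dots> \<le> (real k + real k + real k) * (1 + K)"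
  proof (intro mult_right_mono add_mono K)
    show "\<bar>A_coeff (k - 2)\<bar> \<le> real k"
    proof (cases "k \<le> 2")
      case False
      define x where "x = real (k - 2)"
      have x: "x \<ge> 1" "real k = x + 2" using False by (auto simp: x_def)
      have "0 \<le> 3 * (x * x)" by simp
      then have "(x - 2)\<^sup>2 \<le> (x + 2) * (4 * x)" using x(1) unfolding power2_eq_square by (simp only: algebra_simps)
      then show ?thesis using x by (simp add: A_coeff_def x_def[symmetric] divide_le_eq)
    qed (use k in auto)
    show "\<bar>B_coeff (k + 2)\<bar> \<le> real k"
      by (simp add: B_coeff_def abs_mult divide_le_eq algebra_simps)
    show "\<bar>\<sigma>\<bar> \<le> real k" using \<sigma> k by linarith
  qed
  finally show ?thesis by simp
qed

end

text \<open>Expanding the test function rather than the solution lets every spatial derivative fall on smooth data.\<close>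

lemma (in mode_solution) field_is_solution:
  assumes T: "0 < T" and \<sigma>: "\<sigma> = 1" and f0: "in_sobolev (3/2) f0" "fhat f0 = cos_hat (\<lambda>k. y k 0)"
  shows "is_solution T f0 field"
  unfolding is_solution_def
proof (intro conjI field_in_C_sobolev exI[of _ "\<lambda>t. tser (velocity_mult (fhat (field t)))"] ballI allI impI)
  show "AE \<theta> in lborel. field 0 \<theta> = f0 \<theta>"
    using in_sobolev_AE_eq_tser[OF f0(1)] by eventually_elim (simp add: field_def f0(2))
  show "is_velocity (field t) (tser (velocity_mult (fhat (field t))))" if "t \<in> {0..T}" for t
    by (rule is_velocity_tser[OF field_sobolev[OF that]])
  fix \<psi> assume "test_function T \<psi>"
  then obtain D where "periodic_test_function T \<psi> D" by (rule test_function_imp[OF _ T])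
  then interpret P: periodic_test_function T \<psi> D .
  let ?v = "\<lambda>t. tser (velocity_mult (fhat (field t)))"
  let ?F = "\<lambda>t. (LBINT \<theta>:{-pi..pi}. field t \<theta> * deriv (\<lambda>r. \<psi> r \<theta>) t) + L2_pairing (field t) (?v t) (\<psi> t)"
  \<comment> \<open>On modes the integrand of the weak equation is a sum of exact time derivatives:
    H k is the derivative of pi Re(r_k) y_k, with r_k the coefficient of the test function.\<close>
  define H where "H k t = pi * (Re (P.r 1 t k) * y k t + Re (P.r 0 t k) * mode_rhs \<sigma> (\<lambda>j. y j t) k)" for k t
  have Fsums: "(\<lambda>k. if k = 0 then 0 else H k t) sums ?F t" if t: "t \<in> {0..T}" for t
  proof -
    interpret S: sobolev_velocity "field t" "?v t"
      by unfold_locales (intro field_sobolev t is_velocity_tser)+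
    have d: "deriv (\<lambda>r. \<psi> r \<theta>) t = tser (P.r 1 t) \<theta>" for \<theta>
      using P.Dt[of 0 0 \<theta> t] P.D_eq_tser[OF t, of 1] by (auto simp: P.D0 intro!: DERIV_imp_deriv)
    have \<psi>: "\<psi> t = tser (P.r 0 t)" using P.D_eq_tser[OF t, of 0] by (simp add: P.D0)
    have "(\<lambda>k. 2 * pi * Re (P.r 1 t k * cnj (fourier_coeff (field t) (int k))) +
        pi * Re (P.r 0 t k * cnj (symbol (fhat (field t)) k))) sums ?F t"
      unfolding d \<psi>
      by (intro sums_add integral_mult_tser S.pairing_tser S.f_integrable P.coeff_summable weighted_summable_cmod[OF P.coeff_summable] t)
    moreover have "2 * pi * Re (P.r 1 t k * cnj (fourier_coeff (field t) (int k))) +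
        pi * Re (P.r 0 t k * cnj (symbol (fhat (field t)) k)) = (if k = 0 then 0 else H k t)" for k
    proof -
      have sy: "symbol (cos_hat (\<lambda>k. y k t)) k = of_real (if k = 0 then 0 else mode_rhs 1 (\<lambda>j. y j t) k)"
      proof -
        have "Re (symbol (cos_hat (\<lambda>k. y k t)) k) = mode_rhs 1 (\<lambda>j. if j = 0 then 0 else y j t) k"
          by (simp add: Re_symbol cos_hat_def if_distrib[of Re] cong: if_cong)
        also have "\<dots> = (if k = 0 then 0 else mode_rhs 1 (\<lambda>j. y j t) k)"
          using A_coeff_0 by (cases "k - 2 = 0") (simp_all add: mode_rhs_def B_coeff_def)
        moreover have "Im (symbol (cos_hat (\<lambda>k. y k t)) k) = 0"
          by (simp add: Im_symbol cos_hat_def if_distrib[of Im] mode_rhs_def cong: if_cong)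
        ultimately show ?thesis by (simp add: complex_eq_iff)
      qed
      have "fourier_coeff (field t) (int k) = of_real (if k = 0 then 0 else y k t / 2)"
        by (simp add: fourier_coeff_eq_fhat fhat_field[OF t] cos_hat_def)
      then show ?thesis
        unfolding fhat_field[OF t] sy by (simp add: H_def \<sigma> algebra_simps)
    qed
    ultimately show ?thesis by simp
  qed
  obtain B0 B1 where B: "\<And>t k. t \<in> {0..T} \<Longrightarrow> real k ^ 3 * cmod (P.r 0 t k) \<le> B0" "0 \<le> B0"
      "\<And>t k. t \<in> {0..T} \<Longrightarrow> real k ^ 3 * cmod (P.r 1 t k) \<le> B1" "0 \<le> B1"
    using P.coeff_decay by metis
  have K: "0 \<le> 1 + K" using mode_bound[of 0 1] T by force
  define M where "M k = pi * (B1 + 3 * B0) * (1 + K) * inverse (real k ^ 2)" for k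
  have Hb: "\<bar>H k t\<bar> \<le> M k" if t: "t \<in> {0..T}" and k: "k \<ge> 1" for k t
  proof -
    have k3: "real k ^ 3 > 0" using k by simp
    have r: "\<bar>Re (P.r i t k)\<bar> \<le> B / real k ^ 3" if "real k ^ 3 * cmod (P.r i t k) \<le> B" for i B
      using order_trans[OF abs_Re_le_cmod, of "P.r i t k" "B / real k ^ 3"] that k3 by (simp add: le_divide_eq mult.commute)
    have "\<bar>Re (P.r 1 t k) * y k t\<bar> \<le> B1 / real k ^ 3 * (1 + K)"
      unfolding abs_mult by (intro mult_mono r B t mode_bound k) (use B(4) in auto)
    also have "\<dots> \<le> B1 * (1 + K) * inverse (real k ^ 2)"
    proof -
      have "inverse (real k ^ 3) \<le> inverse (real k ^ 2)"
        using k by (intro le_imp_inverse_le power_increasing) auto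
      from mult_left_mono[OF this, of "B1 * (1 + K)"] show ?thesis
        using B(4) K by (simp add: divide_inverse mult_ac)
    qed
    finally have 1: "\<bar>Re (P.r 1 t k) * y k t\<bar> \<le> B1 * (1 + K) * inverse (real k ^ 2)" .
    have "\<bar>Re (P.r 0 t k) * mode_rhs \<sigma> (\<lambda>j. y j t) k\<bar> \<le> B0 / real k ^ 3 * (3 * real k * (1 + K))"
      unfolding abs_mult by (intro mult_mono r B t rhs_bound k) (use B(2) \<sigma> in auto)
    also have "\<dots> = 3 * B0 * (1 + K) * inverse (real k ^ 2)"
      using k by (simp add: field_simps power2_eq_square power3_eq_cube)
    finally have 2: "\<bar>Re (P.r 0 t k) * mode_rhs \<sigma> (\<lambda>j. y j t) k\<bar> \<le> 3 * B0 * (1 + K) * inverse (real k ^ 2)" .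
    have "\<bar>H k t\<bar> \<le> pi * (\<bar>Re (P.r 1 t k) * y k t\<bar> + \<bar>Re (P.r 0 t k) * mode_rhs \<sigma> (\<lambda>j. y j t) k\<bar>)"
      unfolding H_def abs_mult[of pi] by simp
    also have "\<dots> \<le> pi * (B1 * (1 + K) * inverse (real k ^ 2) + 3 * B0 * (1 + K) * inverse (real k ^ 2))"
      using 1 2 by (intro mult_left_mono add_mono) auto
    also have "\<dots> = M k" by (simp add: M_def algebra_simps)
    finally show ?thesis .
  qed
  have rd: "((\<lambda>t. Re (P.r i t k)) has_real_derivative Re (P.r (Suc i) t k)) (at t within {0..T})" for i k t
    using bounded_linear.has_vector_derivative[OF bounded_linear_Re P.coeff_has_derivative[of i k t]]
    by (auto simp: has_real_derivative_iff_has_vector_derivative intro: has_vector_derivative_at_within)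
  have rc: "continuous_on {0..T} (\<lambda>t. Re (P.r i t k))" for i k
    using rd by (meson DERIV_continuous_on)
  have mc: "continuous_on {0..T} (\<lambda>t. mode_rhs \<sigma> (\<lambda>j. y j t) k)" for k
  proof -
    have "continuous_on {0..T} (\<lambda>t. A_coeff (k - 2) * y (k - 2) t)"
    proof (cases "k - 2 = 0")
      case True
      show ?thesis unfolding True by simp
    qed (auto intro!: continuous_intros cont)
    then show ?thesis
      unfolding mode_rhs_def by (cases "k = 1") (auto intro!: continuous_intros cont)
  qed
  have Hc: "continuous_on {0..T} (H k)" if "k \<ge> 1" for k
    unfolding H_def[abs_def] by (intro continuous_intros rc mc cont that)
  \<comment> \<open>Integration by parts in time; the boundary terms vanish with the test function
    at 0 and T.\<close>
  have H0: "(LBINT t:{0..T}. H k t) = 0" if k: "k \<ge> 1" for k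
  proof -
    have "(H k has_integral (pi * (Re (P.r 0 T k) * y k T) - pi * (Re (P.r 0 0 k) * y k 0))) {0..T}"
    proof (rule fundamental_theorem_of_calculus)
      fix t assume t: "t \<in> {0..T}"
      show "((\<lambda>t. pi * (Re (P.r 0 t k) * y k t)) has_vector_derivative H k t) (at t within {0..T})"
        unfolding has_real_derivative_iff_has_vector_derivative[symmetric] H_def
        using DERIV_cmult[OF DERIV_mult[OF rd[of 0 k t] ode[OF k t]], of pi] by (simp add: algebra_simps)
    qed (use T in simp)
    then show ?thesis
      unfolding set_integral_eq_integral_Icc[OF Hc[OF k]] by (simp add: integral_unique P.coeff_ends)
  qed
  \<comment> \<open>The inner indicator makes the majorant valid for all real t, and the constant 1
    takes the place of the integrable factor in \<open>set_integral_mult_suminf\<close>.\<close>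
  have "(\<lambda>k. LBINT t:{0..T}. 1 * (indicator {0..T} t *\<^sub>R (if k = 0 then 0 else H k t))) sums
      (LBINT t:{0..T}. 1 * (\<Sum>k. indicator {0..T} t *\<^sub>R (if k = 0 then 0 else H k t)))"
  proof (rule set_integral_mult_suminf)
    show "set_integrable lborel {0..T} (\<lambda>t. 1 :: real)"
      by (intro borel_integrable_atLeastAtMost' continuous_intros)
    show "(\<lambda>t. indicator {0..T} t *\<^sub>R (if k = 0 then 0 else H k t)) \<in> borel_measurable lborel" for k
      using borel_measurable_continuous_on_indicator[OF _ Hc[of k]] by (cases "k = 0") auto
    show "norm (indicator {0..T} t *\<^sub>R (if k = 0 then 0 else H k t)) \<le> M k" for k t
      using Hb[of t k] B K by (auto simp: indicator_def M_def)
    show "summable M" unfolding M_def[abs_def] by (intro summable_mult inverse_power_summable) simp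
  qed
  moreover have "(LBINT t:{0..T}. 1 * (indicator {0..T} t *\<^sub>R (if k = 0 then 0 else H k t))) = 0" for k
  proof -
    have "(LBINT t:{0..T}. 1 * (indicator {0..T} t *\<^sub>R (if k = 0 then 0 else H k t))) = (LBINT t:{0..T}. if k = 0 then 0 else H k t)"
      by (rule set_lebesgue_integral_cong) auto
    then show ?thesis using H0[of k] by (cases "k = 0") auto
  qed
  moreover have "(LBINT t:{0..T}. 1 * (\<Sum>k. indicator {0..T} t *\<^sub>R (if k = 0 then 0 else H k t))) = (LBINT t:{0..T}. ?F t)"
    by (rule set_lebesgue_integral_cong) (use Fsums in \<open>auto simp: sums_iff\<close>)
  ultimately have "(\<lambda>k. 0) sums (LBINT t:{0..T}. ?F t)" by (simp only:)
  then show "(LBINT t:{0..T}. ?F t) = 0" by (rule sums_unique2[OF _ sums_zero])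
qed

section \<open>Smooth cutoffs and the du Bois-Reymond lemma\<close>

definition smooth_family :: "(nat \<Rightarrow> real \<Rightarrow> real) \<Rightarrow> bool" where
  "smooth_family d \<longleftrightarrow> (\<forall>i x. (d i has_real_derivative d (Suc i) x) (at x))"

text \<open>The powers of 1/x are carried along because differentiating exp(-1/x) produces exactly
  such factors.\<close>

definition flat :: "nat \<Rightarrow> real \<Rightarrow> real" where
  "flat m x = (if x > 0 then inverse x ^ m * exp (- inverse x) else 0)"

lemma flat_tendsto_0: "(flat m \<longlongrightarrow> 0) (at 0)"
proof -
  have "((\<lambda>x. inverse x ^ m / exp (inverse x)) \<longlongrightarrow> (0::real)) (at_right 0)"
    by (rule filterlim_compose[OF tendsto_power_div_exp_0 filterlim_inverse_at_top_right])
  then have "(flat m \<longlongrightarrow> 0) (at_right 0)"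
    by (rule Lim_transform_eventually)
       (auto simp: flat_def exp_minus divide_inverse eventually_at_filter)
  moreover have "(flat m \<longlongrightarrow> 0) (at_left 0)"
    by (rule tendsto_eventually) (auto simp: flat_def eventually_at_filter)
  ultimately show ?thesis by (rule filterlim_split_at_real[rotated])
qed

text \<open>The delicate point is 0, where the difference quotient of \<open>flat m\<close> is
  \<open>flat (m + 1)\<close>, which tends to 0.\<close>

lemma flat_has_derivative:
  "(flat m has_real_derivative flat (m + 2) x - real m * flat (m + 1) x) (at x)"
proof -
  consider "x > 0" | "x < 0" | "x = 0" by linarith
  then show ?thesis
  proof cases
    case 1
    have "((\<lambda>x. inverse x ^ m * exp (- inverse x)) has_real_derivative flat (m + 2) x - real m * flat (m + 1) x) (at x)"
    proof -
      have pw: "((\<lambda>x. inverse x ^ m) has_real_derivative - real m * inverse x ^ (m + 1)) (at x)"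
      proof (induction m)
        case (Suc m)
        from DERIV_mult[OF DERIV_inverse[of x] this] 1 show ?case
          by (simp add: algebra_simps)
      qed simp
      have ex: "((\<lambda>x. exp (- inverse x)) has_real_derivative exp (- inverse x) * inverse x ^ 2) (at x)"
        using 1 by (auto intro!: derivative_eq_intros simp: power2_eq_square)
      show ?thesis
        using DERIV_mult[OF pw ex] 1 by (simp add: flat_def algebra_simps power_add power2_eq_square)
    qed
    then show ?thesis
      by (rule DERIV_cong_ev[OF refl _ refl, THEN iffD1, rotated])
         (use 1 in \<open>auto simp: flat_def intro!: eventually_mono[OF eventually_nhds_in_open[of "{0<..}"]]\<close>)
  next
    case 2
    have "((\<lambda>x. 0) has_real_derivative flat (m + 2) x - real m * flat (m + 1) x) (at x)"
      using 2 by (simp add: flat_def)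
    then show ?thesis
      by (rule DERIV_cong_ev[OF refl _ refl, THEN iffD1, rotated])
         (use 2 in \<open>auto simp: flat_def intro!: eventually_mono[OF eventually_nhds_in_open[of "{..<0}"]]\<close>)
  next
    case 3
    have "flat m h / h = flat (m + 1) h" for h
      by (simp add: flat_def divide_inverse mult_ac)
    moreover have "flat j 0 = 0" for j by (simp add: flat_def)
    ultimately show ?thesis
      using flat_tendsto_0[of "m + 1"] 3 by (simp add: DERIV_def)
  qed
qed

text \<open>Products of flat functions span a class closed under differentiation, so the Leibniz rule for higher derivatives is not needed.\<close>

inductive flat_span :: "real \<Rightarrow> (real \<Rightarrow> real) \<Rightarrow> bool" for w where
  prod: "flat_span w (\<lambda>x. c * (flat m x * flat n (w - x)))"
| add: "flat_span w f \<Longrightarrow> flat_span w g \<Longrightarrow> flat_span w (\<lambda>x. f x + g x)"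

lemma flat_span_deriv:
  assumes "flat_span w f"
  shows "\<exists>f'. flat_span w f' \<and> (\<forall>x. (f has_real_derivative f' x) (at x))"
  using assms
proof (induction rule: flat_span.induct)
  case (prod c m n)
  let ?f' = "\<lambda>x. (c * (flat (m + 2) x * flat n (w - x)) + (- c * real m) * (flat (m + 1) x * flat n (w - x)))
      + ((- c) * (flat m x * flat (n + 2) (w - x)) + (c * real n) * (flat m x * flat (n + 1) (w - x)))"
  have "((\<lambda>x. c * (flat m x * flat n (w - x))) has_real_derivative ?f' x) (at x)" for x
  proof -
    have "((\<lambda>x. flat n (w - x)) has_real_derivative (flat (n + 2) (w - x) - real n * flat (n + 1) (w - x)) * (0 - 1)) (at x)"
      by (rule DERIV_chain2[OF flat_has_derivative]) (auto intro!: derivative_eq_intros)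
    from DERIV_cmult[OF DERIV_mult[OF flat_has_derivative[of m x] this], of c] show ?thesis
      by (rule DERIV_cong) (simp add: algebra_simps)
  qed
  then show ?case by (intro exI[of _ ?f'] conjI allI flat_span.intros)
next
  case (add f g)
  then obtain f' g' where "flat_span w f'" "flat_span w g'"
    "\<And>x. (f has_real_derivative f' x) (at x)" "\<And>x. (g has_real_derivative g' x) (at x)"
    by blast
  then show ?case by (intro exI[of _ "\<lambda>x. f' x + g' x"] conjI allI flat_span.add DERIV_add)
qed

definition bump :: "real \<Rightarrow> real \<Rightarrow> real" where
  "bump w x = flat 0 x * flat 0 (w - x)"

lemma bump_nonneg: "bump w x \<ge> 0" by (simp add: bump_def flat_def)

lemma bump_pos: "0 < x \<Longrightarrow> x < w \<Longrightarrow> bump w x > 0" by (simp add: bump_def flat_def)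

lemma bump_eq_0: "x \<le> 0 \<or> w \<le> x \<Longrightarrow> bump w x = 0" by (auto simp: bump_def flat_def)

lemma bump_smooth: "smooth_family (\<lambda>i. (deriv ^^ i) (bump w))"
proof -
  have span: "flat_span w ((deriv ^^ i) (bump w))" for i
  proof (induction i)
    case 0
    then show ?case using flat_span.prod[of w 1 0 0] by (simp add: bump_def[abs_def])
  next
    case (Suc i)
    then obtain f' where f': "flat_span w f'" "\<And>x. ((deriv ^^ i) (bump w) has_real_derivative f' x) (at x)"
      using flat_span_deriv by blast
    then have "deriv ((deriv ^^ i) (bump w)) = f'" by (intro ext DERIV_imp_deriv)
    then show ?case using f'(1) by simp
  qed
  show ?thesis
    unfolding smooth_family_def
  proof (intro allI)
    fix i x
    obtain f' where f': "\<And>x. ((deriv ^^ i) (bump w) has_real_derivative f' x) (at x)"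
      using flat_span_deriv[OF span] by blast
    then show "((deriv ^^ i) (bump w) has_real_derivative (deriv ^^ Suc i) (bump w) x) (at x)"
      using DERIV_imp_deriv[OF f'[of x]] by simp
  qed
qed

lemma bump_continuous: "continuous_on A (bump w)"
proof -
  have "(bump w has_real_derivative deriv (bump w) x) (at x within A)" for x
  proof -
    have "((deriv ^^ 0) (bump w) has_real_derivative (deriv ^^ Suc 0) (bump w) x) (at x)"
      using bump_smooth[of w] unfolding smooth_family_def by blast
    then show ?thesis by (auto intro: DERIV_subset)
  qed
  then show ?thesis by (rule DERIV_continuous_on)
qed

text \<open>Integrating from -1 rather than 0 makes every x \<ge> 0 an interior point of the domain,
  so the derivative at 0 is two-sided.\<close>

definition step :: "real \<Rightarrow> real \<Rightarrow> real" where
  "step w x = integral {-1..x} (bump w)"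

lemma step_eq_0: "x \<le> 0 \<Longrightarrow> step w x = 0"
  unfolding step_def by (intro integral_unique has_integral_is_0) (auto simp: bump_eq_0)

lemma step_eq_const:
  assumes "0 \<le> w" "w \<le> x"
  shows "step w x = step w w"
proof -
  have "integral {-1..w} (bump w) + integral {w..x} (bump w) = integral {-1..x} (bump w)"
    using assms by (intro Henstock_Kurzweil_Integration.integral_combine integrable_continuous_real bump_continuous) auto
  moreover have "integral {w..x} (bump w) = 0" by (intro integral_unique has_integral_is_0) (auto simp: bump_eq_0)
  ultimately show ?thesis by (simp add: step_def)
qed

lemma step_has_derivative: "(step w has_real_derivative bump w x) (at x)"
proof (cases "x < 0")
  case True
  have "((\<lambda>x. 0) has_real_derivative bump w x) (at x)" using True by (simp add: bump_eq_0)
  then show ?thesis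
    by (rule DERIV_cong_ev[OF refl _ refl, THEN iffD1, rotated])
       (use True in \<open>auto simp: step_eq_0 intro!: eventually_mono[OF eventually_nhds_in_open[of "{..<0}"]]\<close>)
next
  case False
  have "((\<lambda>x. integral {-1..x} (bump w)) has_real_derivative bump w x) (at x within {-1..x + 1})"
    by (rule integral_has_real_derivative[OF bump_continuous]) (use False in auto)
  moreover have "at x within {-1..x + 1} = at x"
    by (rule at_within_interior) (use False in auto)
  ultimately show ?thesis by (simp add: step_def[abs_def])
qed

section \<open>From orthogonality to cutoffs to classical derivatives\<close>

lemma smooth_family_shift:
  assumes "smooth_family d"
  shows "smooth_family (\<lambda>i x. d i (x - p))"
  unfolding smooth_family_def
proof (intro allI)
  show "((\<lambda>x. d i (x - p)) has_real_derivative d (Suc i) (x - p)) (at x)" for i x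
    using assms DERIV_shift[of "d i" "d (Suc i) (x - p)" x "- p"] by (simp add: smooth_family_def)
qed

lemma smooth_family_diff:
  assumes "smooth_family d" "smooth_family e"
  shows "smooth_family (\<lambda>i x. d i x - e i x)"
  using assms unfolding smooth_family_def by (auto intro: DERIV_diff)

definition step_family :: "real \<Rightarrow> nat \<Rightarrow> real \<Rightarrow> real" where
  "step_family w i = (case i of 0 \<Rightarrow> step w | Suc j \<Rightarrow> (deriv ^^ j) (bump w))"

lemma step_family_smooth: "smooth_family (step_family w)"
  unfolding smooth_family_def
proof (intro allI)
  fix i x
  show "(step_family w i has_real_derivative step_family w (Suc i) x) (at x)"
  proof (cases i)
    case 0
    then show ?thesis using step_has_derivative[of w x] by (simp add: step_family_def)
  next
    case (Suc j)
    have "((deriv ^^ j) (bump w) has_real_derivative (deriv ^^ Suc j) (bump w) x) (at x)"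
      using bump_smooth[of w] unfolding smooth_family_def by blast
    then show ?thesis unfolding Suc step_family_def by (simp only: nat.case)
  qed
qed

text \<open>If F p > F q, take for d' a bump just right of p minus the same bump just right of q.
  Equal integrals give d compact support. Against F minus the midpoint m of the two values, d'
  yields a nonnegative integrand that is positive somewhere, yet its integral is zero.\<close>

lemma vanishing_moment_imp_le:
  fixes F :: "real \<Rightarrow> real"
  assumes F: "continuous_on {0..T} F"
    and orth: "\<And>d a b. smooth_family d \<Longrightarrow> 0 < a \<Longrightarrow> b < T \<Longrightarrow> (\<And>t. t \<notin> {a..b} \<Longrightarrow> d 0 t = 0) \<Longrightarrow>
        integral {0..T} (\<lambda>t. F t * d 1 t) = 0"
    and pq: "0 < p" "p < T" "0 < q" "q < T"
  shows "F p \<le> F q"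
proof (rule ccontr)
  assume "\<not> F p \<le> F q"
  define m where "m = (F p + F q) / 2"
  have m: "F q < m" "m < F p" using \<open>\<not> F p \<le> F q\<close> by (auto simp: m_def)
  have iso: "isCont F p" "isCont F q"
    using continuous_on_interior[OF F] pq by auto
  have "\<forall>\<^sub>F x in at p. F x > m" by (rule order_tendstoD(1)[OF iso(1)[unfolded isCont_def] m(2)])
  then obtain e1 where "e1 > 0" "\<forall>x. x \<noteq> p \<and> dist x p < e1 \<longrightarrow> F x > m"
    unfolding eventually_at by blast
  then have e1: "e1 > 0" "\<bar>x - p\<bar> < e1 \<Longrightarrow> F x > m" for x
    using m(2) by (cases "x = p"; simp add: dist_real_def)+
  have "\<forall>\<^sub>F x in at q. F x < m" by (rule order_tendstoD(2)[OF iso(2)[unfolded isCont_def] m(1)])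
  then obtain e2 where "e2 > 0" "\<forall>x. x \<noteq> q \<and> dist x q < e2 \<longrightarrow> F x < m"
    unfolding eventually_at by blast
  then have e2: "e2 > 0" "\<bar>x - q\<bar> < e2 \<Longrightarrow> F x < m" for x
    using m(1) by (cases "x = q"; simp add: dist_real_def)+
  \<comment> \<open>So small that F stays on its side of m along each bump and both bumps fit into
    (0, T); the half makes the inequalities strict.\<close>
  define w where "w = Min {e1, e2, T - p, T - q} / 2"
  have w: "0 < w" "w < e1" "w < e2" "w < T - p" "w < T - q"
    using e1(1) e2(1) pq by (auto simp: w_def min_def)
  define d where "d i x = step_family w i (x - p) - step_family w i (x - q)" for i x
  have d0: "d 0 x = step w (x - p) - step w (x - q)" and d1: "d 1 x = bump w (x - p) - bump w (x - q)" for x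
    by (simp_all add: d_def step_family_def)
  have sm: "smooth_family d"
    unfolding d_def[abs_def] by (intro smooth_family_diff smooth_family_shift step_family_smooth)
  have supp: "d 0 t = 0" if "t \<notin> {min p q..max p q + w}" for t
  proof (cases "t < min p q")
    case True
    then show ?thesis by (simp add: d0 step_eq_0)
  next
    case False
    then show ?thesis using that w step_eq_const[of w "t - p"] step_eq_const[of w "t - q"] by (auto simp: d0)
  qed
  have I: "integral {0..T} (\<lambda>t. F t * d 1 t) = 0"
    by (rule orth[OF sm _ _ supp]) (use pq w in auto)
  have d1c: "continuous_on {0..T} (d 1)"
  proof (rule DERIV_continuous_on)
    show "(d 1 has_real_derivative d (Suc 1) x) (at x within {0..T})" for x
      using sm unfolding smooth_family_def by (blast intro: DERIV_subset)
  qed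
  have J: "(d 1 has_integral 0) {0..T}"
  proof -
    have "(d 1 has_integral d 0 T - d 0 0) {0..T}"
    proof (rule fundamental_theorem_of_calculus)
      show "(d 0 has_vector_derivative d 1 x) (at x within {0..T})" for x
        using sm unfolding smooth_family_def has_real_derivative_iff_has_vector_derivative[symmetric] One_nat_def
        by (blast intro: DERIV_subset)
    qed (use pq in simp)
    moreover have "d 0 T = 0" "d 0 0 = 0"
      by (rule supp, use pq w in \<open>simp add: max_def min_def\<close>)+
    ultimately show ?thesis by simp
  qed
  have G0: "integral {0..T} (\<lambda>t. (F t - m) * d 1 t) = 0"
  proof -
    have "((\<lambda>t. F t * d 1 t - m * d 1 t) has_integral integral {0..T} (\<lambda>t. F t * d 1 t) - m * 0) {0..T}"
      by (intro has_integral_diff has_integral_mult_right J integrable_integral integrable_continuous_real continuous_intros F d1c)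
    then show ?thesis using I by (simp add: algebra_simps integral_unique)
  qed
  have nonneg: "(F t - m) * d 1 t \<ge> 0" for t
  proof -
    have "F t > m \<or> bump w (t - p) = 0" using e1(2)[of t] w bump_eq_0[of "t - p" w] by force
    moreover have "F t < m \<or> bump w (t - q) = 0" using e2(2)[of t] w bump_eq_0[of "t - q" w] by force
    ultimately show ?thesis
      using bump_nonneg[of w "t - p"] bump_nonneg[of w "t - q"]
      by (auto simp: d1[unfolded One_nat_def] mult_nonpos_nonneg mult_nonneg_nonneg mult_nonneg_nonpos mult_nonpos_nonpos)
  qed
  have "(F (p + w / 2) - m) * d 1 (p + w / 2) = 0"
  proof -
    have "\<forall>t\<in>{0..T}. (F t - m) * d 1 t = 0"
    proof -
      have "continuous_on {0..T} (\<lambda>t. (F t - m) * d 1 t)" by (intro continuous_intros F d1c)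
      from integral_eq_0_iff[OF this _ nonneg] show ?thesis using G0 pq by simp
    qed
    then show ?thesis using pq w by auto
  qed
  moreover have "F (p + w / 2) > m" using e1(2)[of "p + w / 2"] w by simp
  moreover have "bump w (p + w / 2 - p) > 0" using w by (intro bump_pos) auto
  moreover have "bump w (p + w / 2 - q) = 0"
    using e2(2)[of "p + w / 2"] e1(2)[of "p + w / 2"] w bump_eq_0[of "p + w / 2 - q" w] by force
  ultimately show False by (simp add: d1[unfolded One_nat_def])
qed

text \<open>c minus the integral of l is orthogonal to all derivatives of cutoffs. The preceding
  comparison in both orders makes it constant on the open interval, and continuity extends this to
  the endpoints, so the one-sided derivatives there are covered too.\<close>

lemma du_bois_reymond:
  fixes c l :: "real \<Rightarrow> real"
  assumes T: "0 < T" and c: "continuous_on {0..T} c" and l: "continuous_on {0..T} l"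
    and weak: "\<And>d a b. smooth_family d \<Longrightarrow> 0 < a \<Longrightarrow> b < T \<Longrightarrow> (\<And>t. t \<notin> {a..b} \<Longrightarrow> d 0 t = 0) \<Longrightarrow>
        integral {0..T} (\<lambda>t. c t * d 1 t + l t * d 0 t) = 0"
    and t: "t \<in> {0..T}"
  shows "(c has_real_derivative l t) (at t within {0..T})"
proof -
  define L where "L u = integral {0..u} l" for u
  have Ld: "(L has_real_derivative l u) (at u within {0..T})" if "u \<in> {0..T}" for u
    unfolding L_def by (rule integral_has_real_derivative[OF l that])
  have Lc: "continuous_on {0..T} L" by (rule DERIV_continuous_on[OF Ld])
  define F where "F u = c u - L u" for u
  have Fc: "continuous_on {0..T} F" unfolding F_def by (intro continuous_intros c Lc)
  have orth: "integral {0..T} (\<lambda>t. F t * d 1 t) = 0"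
    if d: "smooth_family d" "0 < a" "b < T" "\<And>t. t \<notin> {a..b} \<Longrightarrow> d 0 t = 0" for d a b
  proof -
    have dd: "(d i has_real_derivative d (Suc i) x) (at x within {0..T})" for i x
      using d(1) unfolding smooth_family_def by (blast intro: DERIV_subset)
    have dc: "continuous_on {0..T} (d i)" for i by (rule DERIV_continuous_on[OF dd])
    have "((\<lambda>x. L x * d 1 x + l x * d 0 x) has_integral L T * d 0 T - L 0 * d 0 0) {0..T}"
    proof (rule fundamental_theorem_of_calculus)
      fix x assume "x \<in> {0..T}"
      from DERIV_mult[OF Ld[OF this] dd[of 0 x]]
      show "((\<lambda>x. L x * d 0 x) has_vector_derivative L x * d 1 x + l x * d 0 x) (at x within {0..T})"
        by (simp add: has_real_derivative_iff_has_vector_derivative algebra_simps)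
    qed (use T in simp)
    moreover have "d 0 T = 0" "d 0 0 = 0" using d(2-4) by auto
    ultimately have 1: "((\<lambda>x. L x * d 1 x + l x * d 0 x) has_integral 0) {0..T}" by simp
    have 2: "((\<lambda>t. c t * d 1 t + l t * d 0 t) has_integral 0) {0..T}"
      using weak[OF d] integrable_integral[OF integrable_continuous_real, of 0 T "\<lambda>t. c t * d 1 t + l t * d 0 t"]
      by (simp add: continuous_intros c l dc)
    have "((\<lambda>t. F t * d 1 t) has_integral 0 - 0) {0..T}"
      using has_integral_diff[OF 2 1] by (simp add: F_def algebra_simps)
    then show ?thesis by (simp add: integral_unique)
  qed
  have le: "F p \<le> F q" if "p \<in> {0<..<T}" "q \<in> {0<..<T}" for p q
  proof (rule vanishing_moment_imp_le[OF Fc])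
    show "integral {0..T} (\<lambda>t. F t * d 1 t) = 0"
      if "smooth_family d" "0 < a" "b < T" "\<And>t. t \<notin> {a..b} \<Longrightarrow> d 0 t = 0" for d a b
      by (rule orth[OF that])
  qed (use that in auto)
  then have const: "F p = F q" if "p \<in> {0<..<T}" "q \<in> {0<..<T}" for p q
    using that by (intro antisym)
  have F: "F u = F (T / 2)" if "u \<in> {0..T}" for u
  proof -
    have cl: "closure {0<..<T} = {0..T}" using T by (simp add: closure_greaterThanLessThan)
    show ?thesis
    proof (rule continuous_constant_on_closure[of "{0<..<T}" F])
      show "F x = F (T / 2)" if "x \<in> {0<..<T}" for x
        by (rule const[OF that]) (use T in simp)
    qed (use Fc that in \<open>simp_all only: cl\<close>)
  qed
  have "((\<lambda>u. F (T / 2) + L u) has_real_derivative 0 + l t) (at t within {0..T})"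
    by (intro DERIV_add DERIV_const Ld t)
  moreover have "F (T / 2) + L u = c u" if "u \<in> {0..T}" for u
    using F[OF that] by (simp add: F_def)
  ultimately show ?thesis
    using has_field_derivative_transform_within[where d = 1 and g = c, OF _ _ t] by simp
qed

section \<open>Fourier coefficients of distributional solutions\<close>

lemma in_sobolev_diff:
  assumes f: "in_sobolev s f" and g: "in_sobolev s g"
  shows "in_sobolev s (\<lambda>x. f x - g x)"
  unfolding in_sobolev_def
proof (intro conjI allI)
  note fi = in_sobolev_set_integrable[OF f] and gi = in_sobolev_set_integrable[OF g]
  show m: "(\<lambda>x. f x - g x) \<in> borel_measurable lborel"
    using f g by (intro borel_measurable_diff) (auto simp: in_sobolev_def)
  show "f (x + 2 * pi) - g (x + 2 * pi) = f x - g x" for x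
    by (simp add: in_sobolev_periodic[OF f] in_sobolev_periodic[OF g])
  show "set_integrable lborel {-pi..pi} (\<lambda>x. (f x - g x)\<^sup>2)"
  proof (rule set_integrable_bound)
    show "set_integrable lborel {-pi..pi} (\<lambda>x. 2 * (f x)\<^sup>2 + 2 * (g x)\<^sup>2)"
      using f g by (intro set_integral_add(1) set_integrable_mult_right) (auto simp: in_sobolev_def)
    show "set_borel_measurable lborel {-pi..pi} (\<lambda>x. (f x - g x)\<^sup>2)"
      unfolding set_borel_measurable_def using m by (intro borel_measurable_scaleR borel_measurable_indicator borel_measurable_power) auto
    show "AE x in lborel. x \<in> {-pi..pi} \<longrightarrow> norm ((f x - g x)\<^sup>2) \<le> norm (2 * (f x)\<^sup>2 + 2 * (g x)\<^sup>2)"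
      using square_diff_le by (intro AE_I2) (auto simp: abs_of_nonneg)
  qed
  let ?w = "\<lambda>n::int. (1 + (of_int n)\<^sup>2) powr s"
  let ?G = "\<lambda>n. 2 * (?w n * (cmod (fourier_coeff f n))\<^sup>2) + 2 * (?w n * (cmod (fourier_coeff g n))\<^sup>2)"
  have G: "?G summable_on UNIV"
    using f g by (intro summable_on_add summable_on_cmult_right) (auto simp: in_sobolev_def)
  have le: "?w n * (cmod (fourier_coeff (\<lambda>x. f x - g x) n))\<^sup>2 \<le> ?G n" for n
  proof -
    have "(cmod (fourier_coeff f n - fourier_coeff g n))\<^sup>2 \<le> 2 * (cmod (fourier_coeff f n))\<^sup>2 + 2 * (cmod (fourier_coeff g n))\<^sup>2"
      using square_diff_le[of "Re (fourier_coeff f n)" "Re (fourier_coeff g n)"] square_diff_le[of "Im (fourier_coeff f n)" "Im (fourier_coeff g n)"]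
      by (simp add: cmod_power2)
    from mult_left_mono[OF this, of "?w n"] show ?thesis
      by (simp add: fourier_coeff_diff[OF fi gi] algebra_simps)
  qed
  show "(\<lambda>n. ?w n * (cmod (fourier_coeff (\<lambda>x. f x - g x) n))\<^sup>2) summable_on UNIV"
  proof (rule nonneg_bdd_above_summable_on)
    show "bdd_above (sum (\<lambda>n. ?w n * (cmod (fourier_coeff (\<lambda>x. f x - g x) n))\<^sup>2) ` {F. F \<subseteq> UNIV \<and> finite F})"
    proof (rule bdd_aboveI2)
      fix F :: "int set" assume F: "F \<in> {F. F \<subseteq> UNIV \<and> finite F}"
      have "(\<Sum>n\<in>F. ?w n * (cmod (fourier_coeff (\<lambda>x. f x - g x) n))\<^sup>2) \<le> (\<Sum>n\<in>F. ?G n)"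
        by (intro sum_mono le)
      also have "\<dots> \<le> infsum ?G UNIV" using F by (intro finite_sum_le_infsum G) auto
      finally show "(\<Sum>n\<in>F. ?w n * (cmod (fourier_coeff (\<lambda>x. f x - g x) n))\<^sup>2) \<le> infsum ?G UNIV" .
    qed
  qed auto
qed

lemma fourier_coeff_le_sobolev_norm:
  assumes f: "in_sobolev s f" and s: "s \<ge> 0"
  shows "cmod (fourier_coeff f n) \<le> sobolev_norm s f"
  unfolding sobolev_norm_def
proof (rule real_le_rsqrt)
  let ?g = "\<lambda>n::int. (1 + (of_int n)\<^sup>2) powr s * (cmod (fourier_coeff f n))\<^sup>2"
  have "1 \<le> (1 + (real_of_int n)\<^sup>2) powr s" using s by (intro ge_one_powr_ge_zero) auto
  from mult_right_mono[OF this, of "(cmod (fourier_coeff f n))\<^sup>2"]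
  have "(cmod (fourier_coeff f n))\<^sup>2 \<le> (\<Sum>m\<in>{n}. ?g m)" by simp
  also have "\<dots> \<le> infsum ?g UNIV"
    using f by (intro finite_sum_le_infsum) (auto simp: in_sobolev_def)
  finally show "(cmod (fourier_coeff f n))\<^sup>2 \<le> infsum ?g UNIV" .
qed

lemma fhat_diff:
  assumes "set_integrable lborel {-pi..pi} f" "set_integrable lborel {-pi..pi} g"
  shows "fhat (\<lambda>x. f x - g x) k = fhat f k - fhat g k"
  by (simp add: fhat_def fourier_coeff_diff[OF assms])

text \<open>A product of a time cutoff and one mode isolates a single Fourier coefficient in the
  weak equation.\<close>

lemma test_function_mode:
  assumes d: "smooth_family d" "0 < a" "b < T" "\<And>t. t \<notin> {a..b} \<Longrightarrow> d 0 t = 0"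
  shows "test_function T (\<lambda>t \<theta>. d 0 t * Re (q * cis (real k * \<theta>)))"
proof -
  define D where "D i j t \<theta> = d i t * Re ((\<i> * of_nat k) ^ j * q * cis (real k * \<theta>))" for i j t \<theta>
  have dd: "(d i has_real_derivative d (Suc i) t) (at t)" for i t
    using d(1) by (simp add: smooth_family_def)
  have dc: "continuous_on UNIV (d i)" for i
    using dd by (intro DERIV_continuous_on) auto
  have "smooth2 (\<lambda>t \<theta>. d 0 t * Re (q * cis (real k * \<theta>)))"
    unfolding smooth2_def
  proof (intro exI[of _ D] conjI allI)
    show "D 0 0 = (\<lambda>t \<theta>. d 0 t * Re (q * cis (real k * \<theta>)))" by (intro ext) (simp add: D_def)
    fix i j
    have "continuous_on UNIV (\<lambda>z. d i (fst z) * Re ((\<i> * of_nat k) ^ j * q * cis (real k * snd z)))"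
      by (intro continuous_intros continuous_on_compose2[OF dc]) auto
    then show "continuous_on UNIV (\<lambda>(t, \<theta>). D i j t \<theta>)" by (simp add: D_def case_prod_beta)
    fix t \<theta>
    show "((\<lambda>r. D i j r \<theta>) has_real_derivative D (Suc i) j t \<theta>) (at t)"
      unfolding D_def by (rule DERIV_cmult_right[OF dd])
    have "((\<lambda>x. Re (p * cis (real k * x))) has_real_derivative Re (\<i> * of_nat k * p * cis (real k * \<theta>))) (at \<theta>)" for p
      by (auto intro!: derivative_eq_intros simp: algebra_simps)
    from DERIV_cmult[OF this[of "(\<i> * of_nat k) ^ j * q"], of "d i t"]
    show "((\<lambda>x. D i j t x) has_real_derivative D i (Suc j) t \<theta>) (at \<theta>)"
      unfolding D_def by (simp only: power_Suc mult.assoc)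
  qed
  moreover have "cis (real k * (\<theta> + 2 * pi)) = cis (real k * \<theta>)" for \<theta>
    using cis_periodic[of "int k" \<theta>] by (simp only: of_int_of_nat_eq)
  ultimately show ?thesis
    unfolding test_function_def using d(2-4)
    by (intro conjI exI[of _ b] exI[of _ a] allI impI) simp_all
qed

locale weak_solution =
  fixes T :: real and f0 :: "real \<Rightarrow> real" and \<zeta> :: "real \<Rightarrow> real \<Rightarrow> real"
  assumes T: "0 < T" and sol: "is_solution T f0 \<zeta>" and f0: "in_sobolev (3/2) f0"
begin

lemma sob: "t \<in> {0..T} \<Longrightarrow> in_sobolev (3/2) (\<zeta> t)"
  using sol by (simp add: is_solution_def in_C_sobolev_def)

lemma norm_tendsto:
  "t \<in> {0..T} \<Longrightarrow> ((\<lambda>s. sobolev_norm (3/2) (\<lambda>\<theta>. \<zeta> s \<theta> - \<zeta> t \<theta>)) \<longlongrightarrow> 0) (at t within {0..T})"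
  using sol by (simp add: is_solution_def in_C_sobolev_def)

lemma coeff_cont: "continuous_on {0..T} (\<lambda>t. fhat (\<zeta> t) k)"
  unfolding continuous_on
proof
  fix t assume t: "t \<in> {0..T}"
  have "((\<lambda>s. fhat (\<zeta> s) k - fhat (\<zeta> t) k) \<longlongrightarrow> 0) (at t within {0..T})"
  proof (rule Lim_null_comparison)
    show "((\<lambda>s. 2 * sobolev_norm (3/2) (\<lambda>\<theta>. \<zeta> s \<theta> - \<zeta> t \<theta>)) \<longlongrightarrow> 0) (at t within {0..T})"
      using tendsto_mult[OF tendsto_const norm_tendsto[OF t], of 2] by simp
    have "norm (fhat (\<zeta> s) k - fhat (\<zeta> t) k) \<le> 2 * sobolev_norm (3/2) (\<lambda>\<theta>. \<zeta> s \<theta> - \<zeta> t \<theta>)" if s: "s \<in> {0..T}" for s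
    proof -
      have "cmod (fhat (\<lambda>\<theta>. \<zeta> s \<theta> - \<zeta> t \<theta>) k) \<le> 2 * cmod (fourier_coeff (\<lambda>\<theta>. \<zeta> s \<theta> - \<zeta> t \<theta>) (int k))"
        by (simp add: fhat_def norm_mult)
      also have "\<dots> \<le> 2 * sobolev_norm (3/2) (\<lambda>\<theta>. \<zeta> s \<theta> - \<zeta> t \<theta>)"
        by (intro mult_left_mono fourier_coeff_le_sobolev_norm in_sobolev_diff sob s t) auto
      finally show ?thesis by (simp only: fhat_diff[OF in_sobolev_set_integrable[OF sob[OF s]] in_sobolev_set_integrable[OF sob[OF t]]])
    qed
    then show "\<forall>\<^sub>F s in at t within {0..T}. norm (fhat (\<zeta> s) k - fhat (\<zeta> t) k) \<le> 2 * sobolev_norm (3/2) (\<lambda>\<theta>. \<zeta> s \<theta> - \<zeta> t \<theta>)"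
      by (simp add: eventually_at_filter)
  qed
  then show "((\<lambda>s. fhat (\<zeta> s) k) \<longlongrightarrow> fhat (\<zeta> t) k) (at t within {0..T})" by (rule Lim_null[THEN iffD2])
qed

definition weighted_sum :: "nat \<Rightarrow> real \<Rightarrow> real" where
  "weighted_sum N t = (\<Sum>k\<le>N. real k ^ 3 * (cmod (fhat (\<zeta> t) k))\<^sup>2)"

text \<open>Norm continuity gives a bound near each time, and compactness of [0,T] makes it uniform.
  An inequality between squares of coefficients does the work of the triangle inequality.\<close>

lemma weighted_bound: "\<exists>K. \<forall>t\<in>{0..T}. \<forall>N. weighted_sum N t \<le> K"
proof -
  have "\<exists>e>0. \<exists>B\<ge>0. \<forall>s\<in>{0..T}. \<bar>s - t\<bar> < e \<longrightarrow> (\<forall>N. weighted_sum N s \<le> B)" if t: "t \<in> {0..T}" for t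
  proof -
    \<comment> \<open>Factor 2 from squaring a sum, 4 from \<open>fhat_weighted_sum_le\<close>;
      nearby the difference has norm below 1.\<close>
    define B where "B = 8 + 8 * (sobolev_norm (3/2) (\<zeta> t))\<^sup>2"
    have "\<forall>\<^sub>F s in at t within {0..T}. sobolev_norm (3/2) (\<lambda>\<theta>. \<zeta> s \<theta> - \<zeta> t \<theta>) < 1"
      by (rule order_tendstoD(2)[OF norm_tendsto[OF t]]) simp
    then obtain e where e: "e > 0" "\<And>s. s \<in> {0..T} \<Longrightarrow> s \<noteq> t \<Longrightarrow> dist s t < e \<Longrightarrow> sobolev_norm (3/2) (\<lambda>\<theta>. \<zeta> s \<theta> - \<zeta> t \<theta>) < 1"
      unfolding eventually_at by blast
    have "weighted_sum N s \<le> B" if s: "s \<in> {0..T}" "\<bar>s - t\<bar> < e" for s N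
    proof (cases "s = t")
      case True
      then show ?thesis
        using fhat_weighted_sum_le[OF sob[OF t], of N] zero_le_power2[of "sobolev_norm (3/2) (\<zeta> t)"]
        unfolding weighted_sum_def B_def by (simp only:)
    next
      case False
      let ?n = "sobolev_norm (3/2) (\<lambda>\<theta>. \<zeta> s \<theta> - \<zeta> t \<theta>)"
      have n: "0 \<le> ?n" "?n < 1"
        using e(2)[OF s(1) False] s(2) by (auto simp: dist_real_def sobolev_norm_def infsum_nonneg)
      have tri: "(cmod z)\<^sup>2 \<le> 2 * (cmod (z - w))\<^sup>2 + 2 * (cmod w)\<^sup>2" for z w
      proof -
        have "p\<^sup>2 \<le> 2 * (p - q)\<^sup>2 + 2 * q\<^sup>2" for p q :: real
          using zero_le_power2[of "p - 2 * q"] by (simp add: power2_diff power2_eq_square algebra_simps)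
        from add_mono[OF this[of "Re z" "Re w"] this[of "Im z" "Im w"]] show ?thesis by (simp add: cmod_power2)
      qed
      have "weighted_sum N s \<le> (\<Sum>k\<le>N. 2 * (real k ^ 3 * (cmod (fhat (\<lambda>\<theta>. \<zeta> s \<theta> - \<zeta> t \<theta>) k))\<^sup>2) + 2 * (real k ^ 3 * (cmod (fhat (\<zeta> t) k))\<^sup>2))"
        unfolding weighted_sum_def
      proof (rule sum_mono)
        fix k
        have eq: "fhat (\<lambda>\<theta>. \<zeta> s \<theta> - \<zeta> t \<theta>) k = fhat (\<zeta> s) k - fhat (\<zeta> t) k"
          by (intro fhat_diff in_sobolev_set_integrable[OF sob] s t)
        from mult_left_mono[OF tri[of "fhat (\<zeta> s) k" "fhat (\<zeta> t) k"], of "real k ^ 3"]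
        show "real k ^ 3 * (cmod (fhat (\<zeta> s) k))\<^sup>2 \<le> 2 * (real k ^ 3 * (cmod (fhat (\<lambda>\<theta>. \<zeta> s \<theta> - \<zeta> t \<theta>) k))\<^sup>2) + 2 * (real k ^ 3 * (cmod (fhat (\<zeta> t) k))\<^sup>2)"
          unfolding eq by (simp add: algebra_simps)
      qed
      also have "\<dots> \<le> 2 * (4 * ?n\<^sup>2) + 2 * (4 * (sobolev_norm (3/2) (\<zeta> t))\<^sup>2)"
        unfolding sum.distrib sum_distrib_left[symmetric]
        by (intro add_mono mult_left_mono fhat_weighted_sum_le in_sobolev_diff sob s t) auto
      also have "?n\<^sup>2 \<le> 1" using power_mono[of ?n 1 2] n by simp
      finally show ?thesis by (simp add: B_def)
    qed
    then show ?thesis using e(1) by (intro exI[of _ e] conjI exI[of _ B]) (auto simp: B_def)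
  qed
  then have "\<forall>t\<in>{0..T}. \<exists>e. e > 0 \<and> (\<exists>B\<ge>0. \<forall>s\<in>{0..T}. \<bar>s - t\<bar> < e \<longrightarrow> (\<forall>N. weighted_sum N s \<le> B))" by blast
  from bchoice[OF this] obtain e where
    e: "\<forall>t\<in>{0..T}. e t > 0 \<and> (\<exists>B\<ge>0. \<forall>s\<in>{0..T}. \<bar>s - t\<bar> < e t \<longrightarrow> (\<forall>N. weighted_sum N s \<le> B))" by blast
  then have "\<forall>t\<in>{0..T}. \<exists>B. B \<ge> 0 \<and> (\<forall>s\<in>{0..T}. \<bar>s - t\<bar> < e t \<longrightarrow> (\<forall>N. weighted_sum N s \<le> B))" by blast
  from bchoice[OF this] obtain B where
    B: "\<forall>t\<in>{0..T}. B t \<ge> 0 \<and> (\<forall>s\<in>{0..T}. \<bar>s - t\<bar> < e t \<longrightarrow> (\<forall>N. weighted_sum N s \<le> B t))" by blast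
  have "{0..T} \<subseteq> (\<Union>t\<in>{0..T}. ball t (e t))" using e by force
  then obtain C where C: "C \<subseteq> {0..T}" "finite C" "{0..T} \<subseteq> (\<Union>t\<in>C. ball t (e t))"
    using compactE_image[OF compact_Icc, of "{0..T}" "\<lambda>t. ball t (e t)"] by (metis open_ball)
  show ?thesis
  proof (intro exI[of _ "\<Sum>t\<in>C. B t"] ballI allI)
    fix s N assume s: "s \<in> {0..T}"
    then obtain t where t: "t \<in> C" "\<bar>s - t\<bar> < e t" using C(3) by (force simp: dist_real_def abs_minus_commute)
    then have "weighted_sum N s \<le> B t" using B C(1) s by blast
    also have "\<dots> \<le> (\<Sum>t\<in>C. B t)" using B C t by (intro member_le_sum) auto
    finally show "weighted_sum N s \<le> (\<Sum>t\<in>C. B t)" .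
  qed
qed

text \<open>The weak equation tested with d(t) Re(q e^(ik\<theta>)) and divided by pi. The 2 at k =
  0 appears because \<open>fhat\<close> does not double the mean.\<close>

lemma coeff_weak:
  assumes d: "smooth_family d" "0 < a" "b < T" "\<And>t. t \<notin> {a..b} \<Longrightarrow> d 0 t = 0"
  shows "integral {0..T} (\<lambda>t. ((if k = 0 then 2 else 1) * Re (q * cnj (fhat (\<zeta> t) k))) * d 1 t
      + Re (q * cnj (symbol (fhat (\<zeta> t)) k)) * d 0 t) = 0"
proof -
  define \<psi> where "\<psi> t \<theta> = d 0 t * Re (q * cis (real k * \<theta>))" for t \<theta>
  define G where "G t = ((if k = 0 then 2 else 1) * Re (q * cnj (fhat (\<zeta> t) k))) * d 1 t
      + Re (q * cnj (symbol (fhat (\<zeta> t)) k)) * d 0 t" for t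
  have dd: "(d i has_real_derivative d (Suc i) t) (at t)" for i t
    using d(1) by (simp add: smooth_family_def)
  have dc: "continuous_on {0..T} (d i)" for i
    by (rule DERIV_continuous_on[OF DERIV_subset[OF dd subset_UNIV]])
  have Gc: "continuous_on {0..T} G"
    unfolding G_def symbol_def by (cases "k = 1"; cases "k = 2") (auto intro!: continuous_intros coeff_cont dc)
  obtain v where v: "\<And>t. t \<in> {0..T} \<Longrightarrow> is_velocity (\<zeta> t) (v t)"
    and eq: "\<And>\<psi>. test_function T \<psi> \<Longrightarrow> (LBINT t:{0..T}. (LBINT \<theta>:{-pi..pi}. \<zeta> t \<theta> * deriv (\<lambda>r. \<psi> r \<theta>) t)
              + L2_pairing (\<zeta> t) (v t) (\<psi> t)) = 0"
    using sol unfolding is_solution_def by blast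
  have "(LBINT \<theta>:{-pi..pi}. \<zeta> t \<theta> * deriv (\<lambda>r. \<psi> r \<theta>) t) + L2_pairing (\<zeta> t) (v t) (\<psi> t) = pi * G t"
    if t: "t \<in> {0..T}" for t
  proof -
    interpret S: sobolev_velocity "\<zeta> t" "v t" by unfold_locales (intro sob v t)+
    have der: "deriv (\<lambda>r. \<psi> r \<theta>) t = d 1 t * Re (q * cis (real k * \<theta>))" for \<theta>
      unfolding \<psi>_def using DERIV_cmult_right[OF dd[of 0 t]] by (simp add: DERIV_imp_deriv)
    have "(LBINT \<theta>:{-pi..pi}. \<zeta> t \<theta> * deriv (\<lambda>r. \<psi> r \<theta>) t) = d 1 t * (LBINT \<theta>:{-pi..pi}. \<zeta> t \<theta> * Re (q * cis (of_int (int k) * \<theta>)))"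
      unfolding der set_integral_mult_right[symmetric] by (simp only: of_int_of_nat_eq mult_ac)
    also have "\<dots> = pi * (((if k = 0 then 2 else 1) * Re (q * cnj (fhat (\<zeta> t) k))) * d 1 t)"
      unfolding fourier_pairing[OF S.f_integrable] fourier_coeff_uminus by (simp add: fhat_def algebra_simps)
    finally have 1: "(LBINT \<theta>:{-pi..pi}. \<zeta> t \<theta> * deriv (\<lambda>r. \<psi> r \<theta>) t) = \<dots>" .
    have "\<psi> t = (\<lambda>\<theta>. Re ((of_real (d 0 t) * q) * cis (real k * \<theta>)))"
      by (intro ext) (simp add: \<psi>_def algebra_simps)
    then have "L2_pairing (\<zeta> t) (v t) (\<psi> t) = pi * (Re (q * cnj (symbol (fhat (\<zeta> t)) k)) * d 0 t)"
      by (simp only: S.pairing_mode) (simp add: algebra_simps)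
    with 1 show ?thesis by (simp only: G_def distrib_left)
  qed
  then have "(LBINT t:{0..T}. (LBINT \<theta>:{-pi..pi}. \<zeta> t \<theta> * deriv (\<lambda>r. \<psi> r \<theta>) t) + L2_pairing (\<zeta> t) (v t) (\<psi> t)) = (LBINT t:{0..T}. pi * G t)"
    by (intro set_lebesgue_integral_cong) auto
  also have "\<dots> = pi * integral {0..T} G"
    by (simp add: set_integral_eq_integral_Icc[OF Gc])
  finally have "pi * integral {0..T} G = 0"
    using eq[OF test_function_mode[OF d, of q k]] unfolding \<psi>_def by simp
  then show ?thesis unfolding G_def by simp
qed

text \<open>q = 1 gives the equation of the real part, q = i that of the imaginary part.\<close>

lemma coeff_ode:
  assumes t: "t \<in> {0..T}"
  shows "((\<lambda>t. (if k = 0 then 2 else 1) * Re (q * cnj (fhat (\<zeta> t) k))) has_real_derivative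
      Re (q * cnj (symbol (fhat (\<zeta> t)) k))) (at t within {0..T})"
proof (rule du_bois_reymond[OF T _ _ _ t])
  show "continuous_on {0..T} (\<lambda>t. (if k = 0 then 2 else 1) * Re (q * cnj (fhat (\<zeta> t) k)))"
    by (intro continuous_intros coeff_cont)
  show "continuous_on {0..T} (\<lambda>t. Re (q * cnj (symbol (fhat (\<zeta> t)) k)))"
    unfolding symbol_def by (cases "k = 1"; cases "k = 2") (auto intro!: continuous_intros coeff_cont)
qed (rule coeff_weak)

lemma fhat_initial: "fhat (\<zeta> 0) = fhat f0"
proof -
  have "fourier_coeff (\<zeta> 0) n = fourier_coeff f0 n" for n
    unfolding fourier_coeff_def set_lebesgue_integral_def
  proof (subst integral_cong_AE)
    have [measurable]: "\<zeta> 0 \<in> borel_measurable borel" "f0 \<in> borel_measurable borel"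
      using sob[of 0] f0 T by (auto simp: in_sobolev_def)
    have [measurable]: "(\<lambda>x. cis (- (real_of_int n * x))) \<in> borel_measurable borel"
      by (intro borel_measurable_continuous_onI continuous_intros)
    show "(\<lambda>x. indicator {-pi..pi} x *\<^sub>R \<zeta> 0 x *\<^sub>R cis (- (real_of_int n * x))) \<in> borel_measurable lborel"
      "(\<lambda>x. indicator {-pi..pi} x *\<^sub>R f0 x *\<^sub>R cis (- (real_of_int n * x))) \<in> borel_measurable lborel" by measurable
    have "AE x in lborel. \<zeta> 0 x = f0 x" using sol by (simp add: is_solution_def)
    then show "AE x in lborel. indicator {-pi..pi} x *\<^sub>R \<zeta> 0 x *\<^sub>R cis (- (real_of_int n * x)) = indicator {-pi..pi} x *\<^sub>R f0 x *\<^sub>R cis (- (real_of_int n * x))"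
      by eventually_elim simp
  qed simp
  then show ?thesis by (simp add: fhat_def fun_eq_iff)
qed

text \<open>Only mode 2 could feed the mean, and B_2 = 0.\<close>

lemma mean_conserved:
  assumes "t \<in> {0..T}"
  shows "fhat (\<zeta> t) 0 = fhat f0 0"
proof -
  have "((\<lambda>t. 2 * Re (fhat (\<zeta> t) 0)) has_real_derivative 0) (at s within {0..T})" if "s \<in> {0..T}" for s
    using coeff_ode[OF that, of 0 1] by (simp add: symbol_def B_coeff_def)
  then obtain C where "\<And>s. s \<in> {0..T} \<Longrightarrow> 2 * Re (fhat (\<zeta> s) 0) = C"
    using has_field_derivative_zero_constant[of "{0..T}" "\<lambda>t. 2 * Re (fhat (\<zeta> t) 0)"] by auto
  from this[OF assms] this[of 0] T have "Re (fhat (\<zeta> t) 0) = Re (fhat f0 0)" by (simp add: fhat_initial)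
  then show ?thesis by (simp add: complex_eq_iff Im_fhat_0)
qed

text \<open>Zero mean removes the feed from the constant into mode 2, the one term by which
  \<open>symbol\<close> differs from the two real mode systems.\<close>

lemma mode_solutions:
  assumes mean: "fhat f0 0 = 0"
  obtains K where "mode_solution 1 T K (\<lambda>k t. Re (fhat (\<zeta> t) k))" "mode_solution (-1) T K (\<lambda>k t. Im (fhat (\<zeta> t) k))"
proof -
  obtain K where K: "\<And>t N. t \<in> {0..T} \<Longrightarrow> weighted_sum N t \<le> K" using weighted_bound by blast
  have "mode_solution 1 T K (\<lambda>k t. Re (fhat (\<zeta> t) k))"
  proof
    show "((\<lambda>t. Re (fhat (\<zeta> t) k)) has_real_derivative mode_rhs 1 (\<lambda>j. Re (fhat (\<zeta> t) j)) k) (at t within {0..T})"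
      if "k \<ge> 1" "t \<in> {0..T}" for k t
      using coeff_ode[OF that(2), of k 1] that by (simp add: Re_symbol mean_conserved[OF that(2)] mean cong: if_cong)
    show "(\<Sum>k\<le>N. real k ^ 3 * (Re (fhat (\<zeta> t) k))\<^sup>2) \<le> K" if "t \<in> {0..T}" for N t
      by (rule order_trans[OF _ K[OF that, of N]]) (auto simp: weighted_sum_def cmod_power2 intro!: sum_mono mult_left_mono)
  qed
  moreover have "mode_solution (-1) T K (\<lambda>k t. Im (fhat (\<zeta> t) k))"
  proof
    show "((\<lambda>t. Im (fhat (\<zeta> t) k)) has_real_derivative mode_rhs (-1) (\<lambda>j. Im (fhat (\<zeta> t) j)) k) (at t within {0..T})"
      if "k \<ge> 1" "t \<in> {0..T}" for k t
      using coeff_ode[OF that(2), of k "\<i>"] that by (simp add: Im_symbol mean_conserved[OF that(2)] mean cong: if_cong)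
    show "(\<Sum>k\<le>N. real k ^ 3 * (Im (fhat (\<zeta> t) k))\<^sup>2) \<le> K" if "t \<in> {0..T}" for N t
      by (rule order_trans[OF _ K[OF that, of N]]) (auto simp: weighted_sum_def cmod_power2 intro!: sum_mono mult_left_mono)
  qed
  ultimately show ?thesis by (rule that)
qed

end

section \<open>Uniqueness and conclusion\<close>

lemma mode_rhs_diff: "mode_rhs \<sigma> (\<lambda>j. x j - y j) k = mode_rhs \<sigma> x k - mode_rhs \<sigma> y k"
  by (simp add: mode_rhs_def field_simps)

lemma mode_solution_diff:
  assumes "mode_solution \<sigma> T K x" "mode_solution \<sigma> T L y"
  shows "mode_solution \<sigma> T (2 * K + 2 * L) (\<lambda>k t. x k t - y k t)"
proof -
  interpret x: mode_solution \<sigma> T K x by fact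
  interpret y: mode_solution \<sigma> T L y by fact
  show ?thesis
  proof
    show "((\<lambda>t. x k t - y k t) has_real_derivative mode_rhs \<sigma> (\<lambda>j. x j t - y j t) k) (at t within {0..T})"
      if "k \<ge> 1" "t \<in> {0..T}" for k t
      unfolding mode_rhs_diff using that by (intro DERIV_diff x.ode y.ode)
    fix N t assume t: "t \<in> {0..T}"
    have "(\<Sum>k\<le>N. real k ^ 3 * (x k t - y k t)\<^sup>2) \<le> (\<Sum>k\<le>N. 2 * (real k ^ 3 * (x k t)\<^sup>2) + 2 * (real k ^ 3 * (y k t)\<^sup>2))"
    proof (rule sum_mono)
      show "real k ^ 3 * (x k t - y k t)\<^sup>2 \<le> 2 * (real k ^ 3 * (x k t)\<^sup>2) + 2 * (real k ^ 3 * (y k t)\<^sup>2)" for k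
        using mult_left_mono[OF square_diff_le[of "x k t" "y k t"], of "real k ^ 3"] by (simp add: algebra_simps)
    qed
    also have "\<dots> \<le> 2 * K + 2 * L"
      unfolding sum.distrib sum_distrib_left[symmetric] using x.bound[OF t, of N] y.bound[OF t, of N] by linarith
    finally show "(\<Sum>k\<le>N. real k ^ 3 * (x k t - y k t)\<^sup>2) \<le> 2 * K + 2 * L" .
  qed
qed

lemma energy_ge:
  assumes "summable (\<lambda>k. real k ^ 3 * (y k)\<^sup>2)"
  shows "g_e k * (y k)\<^sup>2 \<le> energy y"
proof -
  have "(\<Sum>j\<in>{k}. g_e j * (y j)\<^sup>2) \<le> energy y"
    unfolding energy_def by (rule sum_le_suminf[OF weighted_summable[OF assms]]) (auto simp: g_e_nonneg)
  then show ?thesis by simp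
qed

context mode_solution
begin

lemma energy_nonneg: "t \<in> {0..T} \<Longrightarrow> 0 \<le> energy (\<lambda>k. y k t)"
  unfolding energy_def by (intro suminf_nonneg weighted_summable summable_weighted) (auto simp: g_e_nonneg)

text \<open>Mode 2 satisfies y_2' = B_4 y_4 with B_4 = 3/4, and g_4 = 1 bounds y_4 by the square
  root of the energy.\<close>

lemma mode_2_bound:
  assumes E: "\<And>t. t \<in> {0..T} \<Longrightarrow> energy (\<lambda>k. y k t) \<le> E0" and t: "t \<in> {0..T}"
  shows "\<bar>y 2 t - y 2 0\<bar> \<le> 3/4 * sqrt E0 * t"
proof -
  have "norm (y 2 t - y 2 0) \<le> (3/4 * sqrt E0) * norm (t - 0)"
  proof (rule field_differentiable_bound[of "{0..T}"])
    show "(y 2 has_field_derivative mode_rhs \<sigma> (\<lambda>j. y j s) 2) (at s within {0..T})" if "s \<in> {0..T}" for s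
      using that by (intro ode) auto
    show "norm (mode_rhs \<sigma> (\<lambda>j. y j s) 2) \<le> 3/4 * sqrt E0" if s: "s \<in> {0..T}" for s
    proof -
      have "(y 4 s)\<^sup>2 \<le> E0"
        using energy_ge[OF summable_weighted[OF s], of 4] E[OF s] by (simp add: g_e_initial)
      then have "\<bar>y 4 s\<bar> \<le> sqrt E0" by (intro real_le_rsqrt) (simp add: power2_abs)
      then show ?thesis by (simp add: mode_rhs_def B_coeff_def abs_mult)
    qed
  qed (use t in auto)
  then show ?thesis using t by simp
qed

text \<open>Since g_1 = 1, y_1^2 is at most the energy, which therefore grows no faster than
  exp(3t/2) for either sign of \<sigma>. Zero energy leaves mode 2 open, but its driver, mode 4,
  then vanishes.\<close>

lemma zero_initial_imp_zero:
  assumes \<sigma>: "\<bar>\<sigma>\<bar> \<le> 1" and init: "\<And>k. k \<ge> 1 \<Longrightarrow> y k 0 = 0" and t: "t \<in> {0..T}" and k: "k \<ge> 1"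
  shows "y k t = 0"
proof -
  define E where "E s = energy (\<lambda>k. y k s)" for s
  have "g_e k * (y k 0)\<^sup>2 = 0" for k using init[of k] by (cases "k = 0") auto
  then have E_init: "E 0 = 0" by (simp only: E_def energy_def suminf_zero)
  have E0: "E s = 0" if s: "s \<in> {0..T}" for s
  proof -
    have d: "((\<lambda>s. exp (- (3/2) * s) * E s) has_real_derivative
        exp (- (3/2) * r) * (- (3/2) * \<sigma> * (y 1 r)\<^sup>2 - (3/2) * E r)) (at r within {0..T})" if "r \<in> {0..T}" for r
    proof -
      have "((\<lambda>s. exp (- (3/2) * s)) has_real_derivative - (3/2) * exp (- (3/2) * r)) (at r within {0..T})"
        by (auto intro!: derivative_eq_intros)
      from DERIV_mult[OF this energy_has_derivative[OF that]] show ?thesis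
        unfolding E_def by (rule DERIV_cong) (simp add: algebra_simps)
    qed
    have "exp (- (3/2) * s) * E s \<le> exp (- (3/2) * 0) * E 0"
    proof (rule DERIV_nonpos_imp_decreasing_open[of 0 s "\<lambda>s. exp (- (3/2) * s) * E s"])
      fix r assume r: "0 < r" "r < s"
      then have rT: "r \<in> {0..T}" using s by auto
      have "at r within {0..T} = at r" using r s by (intro at_within_interior) auto
      moreover have "- (3/2) * \<sigma> * (y 1 r)\<^sup>2 - (3/2) * E r \<le> 0"
      proof -
        have "(y 1 r)\<^sup>2 \<le> E r"
          using energy_ge[OF summable_weighted[OF rT], of 1] by (simp add: g_e_initial[unfolded One_nat_def] E_def)
        moreover have "- \<sigma> * (y 1 r)\<^sup>2 \<le> 1 * (y 1 r)\<^sup>2" using \<sigma> by (intro mult_right_mono) auto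
        ultimately show ?thesis by linarith
      qed
      ultimately show "\<exists>D. ((\<lambda>s. exp (- (3/2) * s) * E s) has_real_derivative D) (at r) \<and> D \<le> 0"
        using d[OF rT] by (intro exI conjI) (auto simp: mult_le_0_iff)
    next
      show "continuous_on {0..s} (\<lambda>s. exp (- (3/2) * s) * E s)"
        by (rule continuous_on_subset[OF DERIV_continuous_on[OF d]]) (use s in auto)
    qed (use s in simp)
    then have "E s \<le> 0" using E_init by (simp add: mult_le_0_iff)
    then show ?thesis using energy_nonneg[OF s] by (simp add: E_def)
  qed
  show ?thesis
  proof (cases "k = 2")
    case True
    have "\<bar>y 2 t - y 2 0\<bar> \<le> 3/4 * sqrt 0 * t"
      by (rule mode_2_bound[OF _ t]) (use E0 in \<open>simp add: E_def\<close>)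
    then show ?thesis using init[of 2] True by simp
  next
    case False
    have "g_e k * (y k t)\<^sup>2 \<le> 0"
      using energy_ge[OF summable_weighted[OF t], of k] E0[OF t] by (simp add: E_def)
    moreover have "g_e k > 0"
    proof -
      have "0 < real k ^ 3 / 216" using k by simp
      then show ?thesis using g_e_lower[OF k False] by linarith
    qed
    ultimately show ?thesis by (simp add: mult_le_0_iff)
  qed
qed

end

text \<open>Nonnegative terms make the unordered sum agree with the series, and the omitted indices
  0 and 2 have weight zero.\<close>

lemma X_norm_sq_eq_energy:
  assumes "summable (\<lambda>k. real k ^ 3 * (y k)\<^sup>2)"
  shows "(\<lambda>k. g_e k * \<bar>y k\<bar>\<^sup>2) summable_on {1..} - {2}" "X_norm_sq y = energy y"
proof -
  have "((\<lambda>k. g_e k * (y k)\<^sup>2) has_sum energy y) UNIV"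
    unfolding energy_def
    by (intro sums_nonneg_imp_has_sum summable_sums weighted_summable assms) (simp add: g_e_nonneg)
  also have "?this \<longleftrightarrow> ((\<lambda>k. g_e k * \<bar>y k\<bar>\<^sup>2) has_sum energy y) ({1..} - {2})"
    by (rule has_sum_cong_neutral) (auto simp: g_e_initial not_le)
  finally have h: "((\<lambda>k. g_e k * \<bar>y k\<bar>\<^sup>2) has_sum energy y) ({1..} - {2})" .
  then show "(\<lambda>k. g_e k * \<bar>y k\<bar>\<^sup>2) summable_on {1..} - {2}" by (rule has_sum_imp_summable)
  show "X_norm_sq y = energy y" unfolding X_norm_sq_def using h by (rule infsumI)
qed

text \<open>By linearity the real parts minus the given modes solve the cosine system with zero
  data. The imaginary parts solve the sine system, with zero data because the initial function is
  even. Both vanish.\<close>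

lemma solution_coefficients:
  assumes f0: "in_sobolev (3/2) f0" "fhat f0 = cos_hat (\<lambda>k. y k 0)" and y: "mode_solution 1 T K y"
    and T: "0 < T" and \<zeta>: "is_solution T f0 \<zeta>" and t: "t \<in> {0..T}"
  shows "fhat (\<zeta> t) = cos_hat (\<lambda>k. y k t)"
proof -
  interpret W: weak_solution T f0 \<zeta> by unfold_locales (fact T \<zeta> f0)+
  have mean: "fhat f0 0 = 0" by (simp add: f0(2))
  obtain L where re: "mode_solution 1 T L (\<lambda>k t. Re (fhat (\<zeta> t) k))"
    and im: "mode_solution (-1) T L (\<lambda>k t. Im (fhat (\<zeta> t) k))"
    by (rule W.mode_solutions[OF mean])
  interpret im: mode_solution "-1" T L "\<lambda>k t. Im (fhat (\<zeta> t) k)" by (rule im)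
  interpret re: mode_solution 1 T "2 * L + 2 * K" "\<lambda>k t. Re (fhat (\<zeta> t) k) - y k t"
    by (rule mode_solution_diff[OF re y])
  show ?thesis
  proof
    fix k
    show "fhat (\<zeta> t) k = cos_hat (\<lambda>k. y k t) k"
    proof (cases "k = 0")
      case True
      then show ?thesis using W.mean_conserved[OF t] mean by simp
    next
      case False
      have "Im (fhat (\<zeta> t) k) = 0"
        by (rule im.zero_initial_imp_zero[OF _ _ t]) (use False in \<open>auto simp: W.fhat_initial f0(2) cos_hat_def\<close>)
      moreover have "Re (fhat (\<zeta> t) k) - y k t = 0"
        by (rule re.zero_initial_imp_zero[OF _ _ t]) (use False in \<open>auto simp: W.fhat_initial f0(2) cos_hat_def\<close>)
      ultimately show ?thesis using False by (simp add: cos_hat_def complex_eq_iff)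
    qed
  qed
qed

theorem theorem1p7:
  fixes \<eta>0 :: "real \<Rightarrow> real" and a :: "nat \<Rightarrow> real"
  assumes "in_sobolev (3/2) \<eta>0" and "cosine_sums a \<eta>0"
  shows "(\<forall>T>0. \<exists>\<eta>. is_solution T \<eta>0 \<eta> \<and>
            (\<forall>\<zeta>. is_solution T \<eta>0 \<zeta> \<longrightarrow> (\<forall>t\<in>{0..T}. AE \<theta> in lborel. \<zeta> t \<theta> = \<eta> t \<theta>)))
    \<and> g_e 1 = 1
    \<and> (\<exists>c C. 0 < c \<and> c \<le> C \<and>
          (\<forall>k\<ge>1. k \<noteq> 2 \<longrightarrow> c * real k ^ 3 \<le> g_e k \<and> g_e k \<le> C * real k ^ 3))
    \<and> (\<exists>M. \<forall>T>0. \<forall>\<eta>. is_solution T \<eta>0 \<eta> \<longrightarrow>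
          (\<exists>\<eta>e :: real \<Rightarrow> nat \<Rightarrow> real. \<forall>t\<in>{0..T}.
             cosine_sums (\<eta>e t) (\<eta> t) \<and>
             (\<lambda>k. g_e k * \<bar>\<eta>e t k\<bar>\<^sup>2) summable_on {1..} - {2} \<and>
             ((\<lambda>s. X_norm_sq (\<eta>e s)) has_real_derivative - (3/2) * \<bar>\<eta>e t 1\<bar>\<^sup>2)
               (at t within {0..T}) \<and>
             \<bar>\<eta>e t 2\<bar> \<le> M * (1 + t)))"
proof -
  have fa: "fhat \<eta>0 = cos_hat a" by (rule cosine_sums_imp_fhat[OF assms])
  have "summable (\<lambda>k. real k ^ 3 * (cmod (fhat \<eta>0 k))\<^sup>2)" by (rule fhat_weighted_summable[OF assms(1)])
  then have a: "summable (\<lambda>k. real k ^ 3 * (a k)\<^sup>2)" by (simp only: fa cmod_cos_hat)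
  obtain y K where y0: "\<And>k. k \<ge> 1 \<Longrightarrow> y k 0 = a k" and y: "\<And>T. T > 0 \<Longrightarrow> mode_solution 1 T (K T) y"
    using mode_solution_exists[OF a] by blast
  have fy: "fhat \<eta>0 = cos_hat (\<lambda>k. y k 0)"
    unfolding fa by (auto simp: cos_hat_def y0 fun_eq_iff)
  \<comment> \<open>Initial size of mode 2 plus its maximal rate of growth. For \<sigma> = 1 the
    energy does not increase, so the rate is fixed by the data and independent of T.\<close>
  define M where "M = \<bar>a 2\<bar> + 3/4 * sqrt (energy a)"
  have "\<exists>\<eta>. is_solution T \<eta>0 \<eta> \<and>
        (\<forall>\<zeta>. is_solution T \<eta>0 \<zeta> \<longrightarrow> (\<forall>t\<in>{0..T}. AE \<theta> in lborel. \<zeta> t \<theta> = \<eta> t \<theta>))" if T: "T > 0" for T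
  proof -
    interpret Y: mode_solution 1 T "K T" y by (rule y[OF T])
    have "AE \<theta> in lborel. \<zeta> t \<theta> = Y.field t \<theta>" if \<zeta>: "is_solution T \<eta>0 \<zeta>" and t: "t \<in> {0..T}" for \<zeta> t
    proof -
      have "in_sobolev (3/2) (\<zeta> t)" using \<zeta> t by (simp add: is_solution_def in_C_sobolev_def)
      from in_sobolev_AE_eq_tser[OF this] show ?thesis
        unfolding Y.field_def solution_coefficients[OF assms(1) fy y[OF T] T \<zeta> t] .
    qed
    then show ?thesis using Y.field_is_solution[OF T refl assms(1) fy] by blast
  qed
  moreover have "\<exists>\<eta>e :: real \<Rightarrow> nat \<Rightarrow> real. \<forall>t\<in>{0..T}.
             cosine_sums (\<eta>e t) (\<eta> t) \<and>
             (\<lambda>k. g_e k * \<bar>\<eta>e t k\<bar>\<^sup>2) summable_on {1..} - {2} \<and>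
             ((\<lambda>s. X_norm_sq (\<eta>e s)) has_real_derivative - (3/2) * \<bar>\<eta>e t 1\<bar>\<^sup>2)
               (at t within {0..T}) \<and>
             \<bar>\<eta>e t 2\<bar> \<le> M * (1 + t)" if T: "T > 0" and \<eta>: "is_solution T \<eta>0 \<eta>" for T \<eta>
  \<comment> \<open>By uniqueness every solution has the coefficients \<open>y\<close>, so its
    properties are read off from the one mode solution.\<close>
  proof (intro exI[of _ "\<lambda>t k. y k t"] ballI conjI)
    interpret Y: mode_solution 1 T "K T" y by (rule y[OF T])
    fix t assume t: "t \<in> {0..T}"
    have sob: "in_sobolev (3/2) (\<eta> t)" using \<eta> t by (simp add: is_solution_def in_C_sobolev_def)
    show "cosine_sums (\<lambda>k. y k t) (\<eta> t)"
      by (rule cosine_sums_if_fhat[OF sob solution_coefficients[OF assms(1) fy y[OF T] T \<eta> t]])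
    show "(\<lambda>k. g_e k * \<bar>y k t\<bar>\<^sup>2) summable_on {1..} - {2}"
      by (rule X_norm_sq_eq_energy(1)[OF Y.summable_weighted[OF t]])
    show "((\<lambda>s. X_norm_sq (\<lambda>k. y k s)) has_real_derivative - (3/2) * \<bar>y 1 t\<bar>\<^sup>2) (at t within {0..T})"
      using has_field_derivative_transform_within[where d = 1, OF Y.energy_has_derivative[OF t] _ t]
        X_norm_sq_eq_energy(2)[OF Y.summable_weighted] by simp
    have "energy (\<lambda>k. y k 0) = energy a"
    proof -
      have "g_e k * (y k 0)\<^sup>2 = g_e k * (a k)\<^sup>2" for k using y0[of k] by (cases "k = 0") auto
      then show ?thesis by (simp only: energy_def)
    qed
    then have "energy (\<lambda>k. y k s) \<le> energy a" if "s \<in> {0..T}" for s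
      using Y.energy_balance[of 0 s] that integral_nonneg[OF integrable_continuous_real, of 0 s "\<lambda>r. (y 1 r)\<^sup>2"]
        continuous_on_subset[OF Y.cont[of 1], of "{0..s}"] by (simp add: continuous_intros)
    then have "\<bar>y 2 t - y 2 0\<bar> \<le> 3/4 * sqrt (energy a) * t" by (rule Y.mode_2_bound[OF _ t])
    moreover have "y 2 0 = a 2" by (rule y0) simp
    ultimately have "\<bar>y 2 t\<bar> \<le> \<bar>a 2\<bar> + 3/4 * sqrt (energy a) * t" by linarith
    also have "\<dots> \<le> M * (1 + t)"
    proof -
      have "0 \<le> energy a" using Y.energy_nonneg[of 0] \<open>energy (\<lambda>k. y k 0) = energy a\<close> T by simp
      then have "0 \<le> \<bar>a 2\<bar> * t + 3/4 * sqrt (energy a)" using t by simp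
      moreover have "M * (1 + t) = \<bar>a 2\<bar> + 3/4 * sqrt (energy a) * t + (\<bar>a 2\<bar> * t + 3/4 * sqrt (energy a))"
        by (simp add: M_def field_simps)
      ultimately show ?thesis by linarith
    qed
    finally show "\<bar>y 2 t\<bar> \<le> M * (1 + t)" .
  qed
  moreover have "\<exists>c C. 0 < c \<and> c \<le> C \<and> (\<forall>k\<ge>1. k \<noteq> 2 \<longrightarrow> c * real k ^ 3 \<le> g_e k \<and> g_e k \<le> C * real k ^ 3)"
    using g_e_lower g_e_upper by (intro exI[of _ "1/216"] exI[of _ 1]) auto
  ultimately show ?thesis using g_e_initial(1) by blast
qed

end
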